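(* Let $G$ be a group which is polycyclic, metabelian and torsion free, and whose centre $Z(G)$ meets the derived subgroup $G'$ trivially, i.e. $Z(G)\cap G'=\{1\}$. Then $G$ has an asynchronous combing. When $G'$ has rank $2$ (as a finitely generated free abelian group), the combing is an indexed language; i.e. $G$ has an asynchronous combing which is an indexed language.
   Context: Generating sets are finite and inverse closed. For a group $G$ with identity $e$ and generating set $X$, $X^*$ is the set of all words over $X$; $w=_G v$ means that $w,v$ represent the same element of $G$; $l(w)$ is the length of $w$ as a string. $\Gamma_{G,X}$ is the Cayley graph (an edge labelled $x$ from $g$ to $gx$), and $d_{G,X}$ is the graph distance on vertices, extended to the path metric on the 1-skeleton. A word $w$ is identified with the path from $e$ labelled by $w$: for $0\le t<l(w)$, $w(t)$ is the point at distance $t$ along the path, and $w(t)=w(l(w))$ for $t\ge l(w)$. Words $v,w$ asynchronously $K$-fellow travel if there is a strictly increasing differentiable $h:\mathbf{R}\to\mathbf{R}$ mapping $[0,l(v)]$ onto $[0,l(w)]$ with $d_{G,X}(v(t),w(h(t)))\le K$ for all $t>0$. A language for $G$ over $X$ is a subset $L\subseteq X^*$ containing at least one representative of each element of $G$. It is an asynchronous combing if there is a constant $K$ such that all pairs $v,w\in L$ with $w=_G vx$ for some $x\in X\cup\{e\}$ asynchronously $K$-fellow travel. A group has an asynchronous combing if it has one over some finite generating set. A language is indexed (in the sense of Aho) if it is recognised by a one-way nested stack automaton, equivalently generated by an indexed grammar: a grammar with finite sets of nonterminals, terminals and indices and a start symbol, in which each nonterminal in a sentential form carries a finite string (stack)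 of indices, and with finitely many productions of the forms $A\to\alpha$ (the index string of $A$ is copied to every nonterminal of $\alpha$), $A\to Bf$ (the index $f$ is pushed onto the index string) and $Af\to\alpha$ (the leading index $f$ of $A$ is removed and the remaining index string is copied to every nonterminal of $\alpha$), where $\alpha$ is a string of terminals and nonterminals; the language consists of all terminal strings derivable from the start symbol with empty index string. *)

theory Defs
  imports Complex_Main "HOL-Algebra.Solvable_Groups" "HOL-Algebra.Elementary_Groups"
    "HOL-Algebra.Free_Abelian_Groups"
begin

section \<open>Groups\<close>

definition centre :: "('a, 'b) monoid_scheme \<Rightarrow> 'a set" where
  "centre G = {z \<in> carrier G. \<forall>g \<in> carrier G. z \<otimes>\<^bsub>G\<^esub> g = g \<otimes>\<^bsub>G\<^esub> z}"

abbreviation derived_subgroup :: "('a, 'b) monoid_scheme \<Rightarrow> 'a set" where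
  "derived_subgroup G \<equiv> derived G (carrier G)"

definition metabelian :: "('a, 'b) monoid_scheme \<Rightarrow> bool" where
  "metabelian G \<longleftrightarrow> comm_group (G\<lparr>carrier := derived_subgroup G\<rparr>)"

definition torsion_free :: "('a, 'b) monoid_scheme \<Rightarrow> bool" where
  "torsion_free G \<longleftrightarrow>
     (\<forall>g \<in> carrier G. \<forall>n::nat. 0 < n \<longrightarrow> g [^]\<^bsub>G\<^esub> n = \<one>\<^bsub>G\<^esub> \<longrightarrow> g = \<one>\<^bsub>G\<^esub>)"

text \<open>The analogue of \<^const>\<open>solvable_seq\<close> with cyclic instead of abelian factors.\<close>

inductive polycyclic_seq :: "('a, 'b) monoid_scheme \<Rightarrow> 'a set \<Rightarrow> bool" for G where
  unity: "polycyclic_seq G {\<one>\<^bsub>G\<^esub>}"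
| extension: "\<lbrakk> polycyclic_seq G K; K \<lhd> (G\<lparr>carrier := H\<rparr>); subgroup H G;
                cyclic_group ((G\<lparr>carrier := H\<rparr>) Mod K) \<rbrakk> \<Longrightarrow> polycyclic_seq G H"

definition polycyclic :: "('a, 'b) monoid_scheme \<Rightarrow> bool" where
  "polycyclic G \<longleftrightarrow> polycyclic_seq G (carrier G)"

definition free_abelian_of_rank :: "nat \<Rightarrow> ('a, 'b) monoid_scheme \<Rightarrow> bool" where
  "free_abelian_of_rank n G \<longleftrightarrow> G \<cong> free_Abelian_group {..<n}"

definition generating_set :: "('a, 'b) monoid_scheme \<Rightarrow> 'a set \<Rightarrow> bool" where
  "generating_set G S \<longleftrightarrow>
     finite S \<and> S \<subseteq> carrier G \<and> (\<forall>x \<in> S. inv\<^bsub>G\<^esub> x \<in> S) \<and> generate G S = carrier G"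

definition word_val :: "('a, 'b) monoid_scheme \<Rightarrow> 'a list \<Rightarrow> 'a" where
  "word_val G w = foldr (monoid.mult G) w \<one>\<^bsub>G\<^esub>"


section \<open>The Cayley graph and its path metric\<close>

text \<open>
  Points of the 1-skeleton: a vertex, or the point at distance s (with 0 < s < 1) from g along
  the edge labelled x from g to gx. There is one edge for each pair (g, x); the edge labelled by
  the inverse of x from gx to g is not identified with it. Identifying the two would change
  distances by at most 1, so it would affect only the values of fellow traveller constants.
\<close>

datatype 'a cayley_point = Vertex 'a | Inner 'a 'a real

definition edge_point :: "('a, 'b) monoid_scheme \<Rightarrow> 'a \<Rightarrow> 'a \<Rightarrow> real \<Rightarrow> 'a cayley_point" where
  "edge_point G g x s =
     (if s = 0 then Vertex g else if s = 1 then Vertex (g \<otimes>\<^bsub>G\<^esub> x) else Inner g x s)"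

text \<open>
  A route of length r from p to q is a finite concatenation of segments, each contained in one
  closed edge (of length 1); the path metric is the infimum of the lengths of routes.
\<close>

inductive cayley_route ::
  "('a, 'b) monoid_scheme \<Rightarrow> 'a set \<Rightarrow> 'a cayley_point \<Rightarrow> 'a cayley_point \<Rightarrow> real \<Rightarrow> bool"
  for G S where
  stay: "cayley_route G S p p 0"
| segment: "\<lbrakk> cayley_route G S p (edge_point G g x s) r;
              g \<in> carrier G; x \<in> S; s \<in> {0..1}; t \<in> {0..1} \<rbrakk>
            \<Longrightarrow> cayley_route G S p (edge_point G g x t) (r + \<bar>s - t\<bar>)"

definition cayley_dist ::
  "('a, 'b) monoid_scheme \<Rightarrow> 'a set \<Rightarrow> 'a cayley_point \<Rightarrow> 'a cayley_point \<Rightarrow> real" where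
  "cayley_dist G S p q = Inf {r. cayley_route G S p q r}"

text \<open>The point w(t), intended for t \<ge> 0.\<close>

definition word_path :: "('a, 'b) monoid_scheme \<Rightarrow> 'a list \<Rightarrow> real \<Rightarrow> 'a cayley_point" where
  "word_path G w t =
     (if t < real (length w)
      then edge_point G (word_val G (take (nat \<lfloor>t\<rfloor>) w)) (w ! nat \<lfloor>t\<rfloor>) (t - of_int \<lfloor>t\<rfloor>)
      else Vertex (word_val G w))"


section \<open>Asynchronous combings\<close>

definition async_fellow_travel ::
  "('a, 'b) monoid_scheme \<Rightarrow> 'a set \<Rightarrow> real \<Rightarrow> 'a list \<Rightarrow> 'a list \<Rightarrow> bool" where
  "async_fellow_travel G S K v w \<longleftrightarrow>
     (\<exists>h :: real \<Rightarrow> real. strict_mono h \<and> (\<forall>t. h differentiable (at t)) \<and>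
        h ` {0..real (length v)} = {0..real (length w)} \<and>
        (\<forall>t > 0. cayley_dist G S (word_path G v t) (word_path G w (h t)) \<le> K))"

definition language_for :: "('a, 'b) monoid_scheme \<Rightarrow> 'a set \<Rightarrow> 'a list set \<Rightarrow> bool" where
  "language_for G S L \<longleftrightarrow> L \<subseteq> lists S \<and> (\<forall>g \<in> carrier G. \<exists>w \<in> L. word_val G w = g)"

definition async_combing :: "('a, 'b) monoid_scheme \<Rightarrow> 'a set \<Rightarrow> 'a list set \<Rightarrow> bool" where
  "async_combing G S L \<longleftrightarrow>
     language_for G S L \<and>
     (\<exists>K. \<forall>v \<in> L. \<forall>w \<in> L. \<forall>x \<in> S \<union> {\<one>\<^bsub>G\<^esub>}.
        word_val G w = word_val G v \<otimes>\<^bsub>G\<^esub> x \<longrightarrow> async_fellow_travel G S K v w)"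

definition has_async_combing :: "('a, 'b) monoid_scheme \<Rightarrow> bool" where
  "has_async_combing G \<longleftrightarrow> (\<exists>S L. generating_set G S \<and> async_combing G S L)"


section \<open>Indexed languages\<close>

datatype ('n, 't) gsym = N 'n | T 't

datatype ('n, 't, 'f) production =
    Copy 'n "('n, 't) gsym list"      \<comment> \<open>\<open>A \<rightarrow> \<alpha>\<close>\<close>
  | Push 'n 'n 'f                     \<comment> \<open>\<open>A \<rightarrow> B f\<close>\<close>
  | Pop 'n 'f "('n, 't) gsym list"    \<comment> \<open>\<open>A f \<rightarrow> \<alpha>\<close>\<close>

record ('n, 't, 'f) indexed_grammar =
  nonterminals :: "'n set"
  terminals :: "'t set"
  indices :: "'f set"
  start :: 'n
  productions :: "('n, 't, 'f) production set"

fun gsym_over :: "('n, 't, 'f) indexed_grammar \<Rightarrow> ('n, 't) gsym \<Rightarrow> bool" where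
  "gsym_over \<Gamma> (N A) \<longleftrightarrow> A \<in> nonterminals \<Gamma>"
| "gsym_over \<Gamma> (T a) \<longleftrightarrow> a \<in> terminals \<Gamma>"

fun production_over :: "('n, 't, 'f) indexed_grammar \<Rightarrow> ('n, 't, 'f) production \<Rightarrow> bool" where
  "production_over \<Gamma> (Copy A \<alpha>) \<longleftrightarrow> A \<in> nonterminals \<Gamma> \<and> list_all (gsym_over \<Gamma>) \<alpha>"
| "production_over \<Gamma> (Push A B f) \<longleftrightarrow>
     A \<in> nonterminals \<Gamma> \<and> B \<in> nonterminals \<Gamma> \<and> f \<in> indices \<Gamma>"
| "production_over \<Gamma> (Pop A f \<alpha>) \<longleftrightarrow>
     A \<in> nonterminals \<Gamma> \<and> f \<in> indices \<Gamma> \<and> list_all (gsym_over \<Gamma>) \<alpha>"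

definition wf_indexed_grammar :: "('n, 't, 'f) indexed_grammar \<Rightarrow> bool" where
  "wf_indexed_grammar \<Gamma> \<longleftrightarrow>
     finite (nonterminals \<Gamma>) \<and> finite (terminals \<Gamma>) \<and> finite (indices \<Gamma>) \<and>
     finite (productions \<Gamma>) \<and> start \<Gamma> \<in> nonterminals \<Gamma> \<and>
     (\<forall>p \<in> productions \<Gamma>. production_over \<Gamma> p)"

text \<open>
  In a sentential form the nonterminals are pairs of a nonterminal and its index string, whose
  head is the leading index.
\<close>

definition attach :: "'f list \<Rightarrow> ('n, 't) gsym list \<Rightarrow> ('n \<times> 'f list, 't) gsym list" where
  "attach \<delta> \<alpha> = map (map_gsym (\<lambda>A. (A, \<delta>)) (\<lambda>a. a)) \<alpha>"

inductive derives1 ::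
  "('n, 't, 'f) indexed_grammar \<Rightarrow> ('n \<times> 'f list, 't) gsym list \<Rightarrow>
     ('n \<times> 'f list, 't) gsym list \<Rightarrow> bool" for \<Gamma> where
  copy: "Copy A \<alpha> \<in> productions \<Gamma> \<Longrightarrow>
           derives1 \<Gamma> (u @ [N (A, \<delta>)] @ v) (u @ attach \<delta> \<alpha> @ v)"
| push: "Push A B f \<in> productions \<Gamma> \<Longrightarrow>
           derives1 \<Gamma> (u @ [N (A, \<delta>)] @ v) (u @ [N (B, f # \<delta>)] @ v)"
| pop: "Pop A f \<alpha> \<in> productions \<Gamma> \<Longrightarrow>
           derives1 \<Gamma> (u @ [N (A, f # \<delta>)] @ v) (u @ attach \<delta> \<alpha> @ v)"

definition grammar_language :: "('n, 't, 'f) indexed_grammar \<Rightarrow> 't list set" where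
  "grammar_language \<Gamma> =
     {w \<in> lists (terminals \<Gamma>). (derives1 \<Gamma>)\<^sup>*\<^sup>* [N (start \<Gamma>, [])] (map T w)}"

text \<open>
  Nonterminals and indices form finite sets, so natural numbers can be taken as their names.
\<close>

definition indexed_language :: "'t list set \<Rightarrow> bool" where
  "indexed_language L \<longleftrightarrow>
     (\<exists>\<Gamma> :: (nat, 't, nat) indexed_grammar. wf_indexed_grammar \<Gamma> \<and> grammar_language \<Gamma> = L)"

end

theory Submission
  imports Defs
begin

text \<open>
  Let \<open>A = G'\<close>. For \<open>t \<in> G\<close> the map \<open>g \<mapsto> [g,t]\<close> is a crossed homomorphism \<open>G \<rightarrow> A\<close>, and
  so are all its images under \<open>G\<close>-endomorphisms of \<open>A\<close>. Since \<open>A\<close> has finite rank, its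
  restriction \<open>u\<^sub>t\<close> to \<open>A\<close> satisfies \<open>u\<^sub>t\<^sup>k q\<^sub>t(u\<^sub>t) = 0\<close> for an integer polynomial with \<open>q\<^sub>t(0) \<noteq> 0\<close>. Multiplying the \<open>q\<^sub>t(u\<^sub>t)\<close>
  over a finite generating set gives an endomorphism whose image is killed by powers of all \<open>u\<^sub>t\<close>; this
  image is trivial because \<open>A\<close> contains no nontrivial central element. Expanding the product yields a
  crossed homomorphism \<open>\<delta>: G \<rightarrow> A\<close> with \<open>\<delta>(a) = a\<^sup>M\<close> on \<open>A\<close>, where \<open>M > 0\<close>. Its kernel \<open>H\<close> is abelian, meets
  \<open>A\<close> trivially, and \<open>HA\<close> has finite index in \<open>G\<close>.

  An element \<open>h a c\<close> with \<open>h\<close> in a free abelian subgroup of finite index in \<open>H\<close>, \<open>a \<in> A\<close> and \<open>c\<close> from a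
  finite set is represented by a word for \<open>h\<close> in a fixed basis, then a word for \<open>a\<close> that stays close to a
  straight line in \<open>A \<otimes> \<real>\<close>, then \<open>c\<close>. Right multiplication by a generator changes \<open>h\<close> by a bounded amount
  and \<open>a\<close> by a bounded amount and one of finitely many linear maps, and linear maps take straight lines to
  straight lines.

  In rank two the straight words can be taken to be powers of Christoffel words. They are obtained from
  powers of a single letter by the substitutions \<open>x \<mapsto> x, y \<mapsto> xy\<close> and \<open>x \<mapsto> xy, y \<mapsto> y\<close>, which an
  indexed grammar can read off its index string.
\<close>

section \<open>Smooth reparametrisations\<close>

text \<open>The order of the factors \<open>h a c\<close> is forced by right multiplication. If
  \<open>c x = d c'\<close> with \<open>d = h0 a0\<close>, then
  \<open>h a d = (h h0) (inv h0 a h0) a0\<close>, so \<open>a\<close> undergoes one of finitely many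
  linear maps; were \<open>a\<close> in front of \<open>h\<close>, its correction would be
  conjugated by the unbounded \<open>h\<close>. The linear maps change the lengths of words, so two
  straight words are traversed at proportional speeds, which makes the travelling asynchronous.
  Closeness is recorded by letting the offset \<open>inv g k\<close> of two positions range over a
  finite set; the generating set and the constant can then be fixed at the very end. Fellow
  travelling demands a strictly increasing differentiable reparametrisation of the whole line, so
  each block carries one that is flat at both ends, and a block may be empty only if its partner is
  empty too. A complement of \<open>A\<close> need not exist, whence the factor \<open>M\<close>.
  Similarly the chosen elements of \<open>A\<close> span only a subgroup of finite index, measured
  by \<open>N\<close>; in rank two a true basis is taken, because Christoffel words reach only the
  span of their letters.\<close>

definition warp :: "real \<Rightarrow> real \<Rightarrow> (real \<Rightarrow> real) \<Rightarrow> bool" where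
  "warp m n h \<longleftrightarrow> h 0 = 0 \<and> h m = n \<and> strict_mono h \<and> (\<forall>t. h differentiable (at t)) \<and>
     DERIV h 0 :> 0 \<and> DERIV h m :> 0"

text \<open>Away from \<open>c\<close> the glued function agrees with one piece near
  \<open>t\<close>; at \<open>c\<close> the two one-sided difference quotients have the same
  limit.\<close>

lemma DERIV_glue:
  fixes f g :: "real \<Rightarrow> real"
  assumes "f c = g c" "t \<le> c \<Longrightarrow> DERIV f t :> D" "t \<ge> c \<Longrightarrow> DERIV g t :> D"
  shows "DERIV (\<lambda>t. if t \<le> c then f t else g t) t :> D"
proof -
  consider "t < c" | "t > c" | "t = c" by linarith
  then show ?thesis
  proof cases
    case 1
    have ev: "\<forall>\<^sub>F x in nhds t. (if x \<le> c then f x else g x) = f x"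
      using eventually_nhds_in_open[of "{..<c}" t] 1 by (auto elim: eventually_mono)
    show ?thesis using DERIV_cong_ev[OF refl ev refl] assms(2) 1 by simp
  next
    case 2
    have ev: "\<forall>\<^sub>F x in nhds t. (if x \<le> c then f x else g x) = g x"
      using eventually_nhds_in_open[of "{c<..}" t] 2 by (auto elim: eventually_mono)
    show ?thesis using DERIV_cong_ev[OF refl ev refl] assms(3) 2 by simp
  next
    case 3
    have f: "DERIV f c :> D" and g: "DERIV g c :> D" using assms 3 by auto
    have 1: "((\<lambda>t. if t \<le> c then f t else g t) has_field_derivative D) (at c within {..c})"
      using has_field_derivative_at_within[OF f, of "{..c}"] unfolding has_field_derivative_def
      by (rule has_derivative_transform[rotated 2]) auto
    have 2: "((\<lambda>t. if t \<le> c then f t else g t) has_field_derivative D) (at c within {c..})"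
      using has_field_derivative_at_within[OF g, of "{c..}"] unfolding has_field_derivative_def
      by (rule has_derivative_transform[rotated 2]) (use assms(1) in auto)
    have "((\<lambda>t. if t \<le> c then f t else g t) has_field_derivative D) (at c within {..c} \<union> {c..})"
      using 1 2 unfolding has_field_derivative_iff unfolding at_within_union by (rule filterlim_sup)
    moreover have "{..c} \<union> {c..} = (UNIV :: real set)" by auto
    ultimately show ?thesis using 3 by simp
  qed
qed

lemma strict_mono_on_glue:
  fixes f g :: "real \<Rightarrow> real"
  assumes "f c = g c" "c \<in> X" "strict_mono_on (X \<inter> {..c}) f" "strict_mono_on (X \<inter> {c..}) g"
  shows "strict_mono_on X (\<lambda>t. if t \<le> c then f t else g t)"
proof (rule strict_mono_onI)
  fix r s assume rs: "r \<in> X" "s \<in> X" "r < s"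
  consider "s \<le> c" | "r > c" | "r \<le> c" "s > c" by linarith
  then show "(if r \<le> c then f r else g r) < (if s \<le> c then f s else g s)"
  proof cases
    case 3
    have "f r \<le> f c" using strict_mono_onD[OF assms(3), of r c] rs 3 assms(2) by fastforce
    moreover have "g c < g s" using strict_mono_onD[OF assms(4), of c s] rs 3 assms(2) by auto
    ultimately show ?thesis using 3 assms(1) by auto
  qed (use rs strict_mono_onD[OF assms(3), of r s] strict_mono_onD[OF assms(4), of r s] in auto)
qed

text \<open>The common slope \<open>0\<close> at the junction makes arbitrary pieces
  compatible.\<close>

lemma differentiable_glue:
  fixes f g :: "real \<Rightarrow> real"
  assumes "f c = g c" "\<And>t. f differentiable (at t)" "\<And>t. g differentiable (at t)"
    "DERIV f c :> 0" "DERIV g c :> 0"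
  shows "(\<lambda>t. if t \<le> c then f t else g t) differentiable (at t)"
proof -
  obtain D1 D2 where D: "DERIV f t :> D1" "DERIV g t :> D2"
    using assms(2,3) by (meson real_differentiable_def)
  define D where "D = (if t = c then 0 else if t < c then D1 else D2)"
  have "DERIV (\<lambda>t. if t \<le> c then f t else g t) t :> D"
    by (rule DERIV_glue) (use assms D in \<open>auto simp: D_def\<close>)
  then show ?thesis using real_differentiable_def by blast
qed

lemma warp_append:
  assumes "warp m n h" "warp m' n' h'" "0 \<le> m" "0 \<le> m'"
  shows "warp (m + m') (n + n') (\<lambda>t. if t \<le> m then h t else n + h' (t - m))"
proof -
  let ?g = "\<lambda>t. n + h' (t - m)"
  have h: "h 0 = 0" "h m = n" "strict_mono h" "\<And>t. h differentiable (at t)" "DERIV h 0 :> 0" "DERIV h m :> 0"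
    and h': "h' 0 = 0" "h' m' = n'" "strict_mono h'" "\<And>t. h' differentiable (at t)" "DERIV h' 0 :> 0" "DERIV h' m' :> 0"
    using assms unfolding warp_def by auto
  have Dg: "DERIV ?g t :> D" if "DERIV h' (t - m) :> D" for t D
    using that by (auto intro!: derivative_eq_intros DERIV_chain'[where g = h'])
  have gd: "?g differentiable (at t)" for t
    using h'(4)[of "t - m"] Dg unfolding real_differentiable_def by blast
  have eq: "h m = ?g m" using h h' by simp
  have "strict_mono (\<lambda>t. if t \<le> m then h t else ?g t)"
    by (rule strict_mono_on_glue[of _ _ _ UNIV])
      (use h(3) h'(3) eq in \<open>auto simp: strict_mono_def strict_mono_on_def\<close>)
  moreover have "(\<lambda>t. if t \<le> m then h t else ?g t) differentiable (at t)" for t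
    by (rule differentiable_glue)
      (use h(6) eq Dg[of 0 m] h' in \<open>auto intro: h(4) simp: gd\<close>)
  moreover have "DERIV (\<lambda>t. if t \<le> m then h t else ?g t) 0 :> 0"
    by (rule DERIV_glue) (use eq h h' assms Dg in auto)
  moreover have "DERIV (\<lambda>t. if t \<le> m then h t else ?g t) (m + m') :> 0"
    by (rule DERIV_glue) (use eq h h' assms Dg[of 0 "m + m'"] in auto)
  ultimately show ?thesis
    unfolding warp_def using h h' assms by (auto simp: le_less)
qed

lemma square_strict_antimono: "s\<^sup>2 < r\<^sup>2" if "r < s" "s \<le> 0" for r s :: real
  using power_strict_mono[of "- s" "- r" 2] that by simp

text \<open>This serves a pair of empty words. The identity has slope \<open>1\<close> at
  \<open>0\<close>; the signed square is flat there and still strictly increasing.\<close>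

lemma warp_zero: "warp 0 0 (\<lambda>t. if t \<le> 0 then - (t\<^sup>2) else t\<^sup>2)"
proof -
  let ?h = "\<lambda>t::real. if t \<le> 0 then - (t\<^sup>2) else t\<^sup>2"
  have "strict_mono ?h"
    by (rule strict_mono_on_glue[of _ _ _ UNIV])
      (auto simp: strict_mono_on_def power_strict_mono square_strict_antimono)
  moreover have "?h differentiable (at t)" for t
    by (rule differentiable_glue) (auto intro!: derivative_eq_intros)
  moreover have "DERIV ?h 0 :> 0"
    by (rule DERIV_glue) (auto intro!: derivative_eq_intros)
  ultimately show ?thesis unfolding warp_def by auto
qed

text \<open>The identity of \<open>[0,1]\<close> is perturbed by less than \<open>1/K\<close> to have derivative \<open>0\<close> at both ends;
  the reparametrisations of consecutive blocks can then be glued differentiably.\<close>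

definition flat_id :: "nat \<Rightarrow> real \<Rightarrow> real" where
  "flat_id K s = s - s * (1 - s) ^ K + (1 - s) * s ^ K"

text \<open>For \<open>2 \<le> K\<close>, the correction \<open>- s * (1 - s) ^ K\<close> has slope
  \<open>-1\<close> at \<open>0\<close> and slope \<open>0\<close> at \<open>1\<close>, and
  \<open>(1 - s) * s ^ K\<close> the other way round; each cancels the slope of the identity at one
  end.\<close>

lemma DERIV_flat_id:
  "DERIV (flat_id K) s :> 1 - (1 - s) ^ K + s * (K * (1 - s) ^ (K - 1)) - s ^ K + (1 - s) * (K * s ^ (K - 1))"
  unfolding flat_id_def[abs_def]
  by (auto intro!: derivative_eq_intros simp: algebra_simps)

lemma flat_id_error:
  assumes "0 \<le> s" "s \<le> 1" "0 < K"
  shows "\<bar>flat_id K s - s\<bar> \<le> 1 / K"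
proof -
  have *: "r * (1 - r) ^ K \<le> 1 / K" if r: "0 \<le> r" "r \<le> 1" for r :: real
  proof -
    \<comment> \<open>Bernoulli's inequality spares locating the maximum:
      \<open>1 + K * r \<le> (1 + r) ^ K\<close>, and
      \<open>(1 + r) * (1 - r) \<le> 1\<close>.\<close>
    have "K * (r * (1 - r) ^ K) \<le> (1 + K * r) * (1 - r) ^ K"
      using r by (simp add: algebra_simps)
    also have "\<dots> \<le> (1 + r) ^ K * (1 - r) ^ K"
      using Bernoulli_inequality[of r K] r by (intro mult_right_mono) auto
    also have "\<dots> = (1 - r * r) ^ K"
      by (simp add: power_mult_distrib[symmetric] algebra_simps)
    also have "\<dots> \<le> 1"
      using r by (intro power_le_one) (auto simp: mult_le_one)
    finally show ?thesis using assms(3) by (simp add: field_simps)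
  qed
  have "0 \<le> s * (1 - s) ^ K" "0 \<le> (1 - s) * s ^ K" using assms by auto
  moreover have "(1 - s) * s ^ K \<le> 1 / K" "s * (1 - s) ^ K \<le> 1 / K"
    using *[of s] *[of "1 - s"] assms by auto
  ultimately show ?thesis
    unfolding flat_id_def by linarith
qed

text \<open>The derivative is positive inside the interval, since
  \<open>x ^ K + (1 - x) ^ K < x + (1 - x) = 1\<close> and the other two terms are
  nonnegative.\<close>

lemma flat_id_strict_mono:
  assumes "2 \<le> K"
  shows "strict_mono_on {0..1} (flat_id K)"
proof (rule strict_mono_onI)
  fix r s :: real assume rs: "r \<in> {0..1}" "s \<in> {0..1}" "r < s"
  show "flat_id K r < flat_id K s"
  proof (rule DERIV_pos_imp_increasing_open[OF rs(3)])
    fix x assume x: "r < x" "x < s"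
    have 0: "0 < x" "x < 1" using x rs by auto
    have *: "y ^ K < y" if "0 < y" "y < 1" for y :: real
      using power_strict_decreasing[of 1 K y] that assms by simp
    have "0 \<le> x * (K * (1 - x) ^ (K - 1))" "0 \<le> (1 - x) * (K * x ^ (K - 1))" using 0 by auto
    then have "0 < 1 - (1 - x) ^ K + x * (K * (1 - x) ^ (K - 1)) - x ^ K + (1 - x) * (K * x ^ (K - 1))"
      using *[of x] *[of "1 - x"] 0 by linarith
    then show "\<exists>y. DERIV (flat_id K) x :> y \<and> 0 < y" using DERIV_flat_id by blast
  qed (meson DERIV_flat_id DERIV_isCont continuous_at_imp_continuous_on)
qed

lemma warp_block:
  fixes m n :: nat
  assumes "0 < m" "0 < n"
  obtains h :: "real \<Rightarrow> real" where "warp m n h"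
    "\<And>t::real. 0 \<le> t \<Longrightarrow> t \<le> m \<Longrightarrow> \<bar>h t / n - t / m\<bar> \<le> 1 / m \<and> \<bar>h t / n - t / m\<bar> \<le> 1 / n \<and> 0 \<le> h t \<and> h t \<le> n"
proof -
  \<comment> \<open>Large enough for the perturbation \<open>1 / K\<close> to be at most
    \<open>1 / m\<close> and \<open>1 / n\<close>; the summand \<open>1\<close> yields
    \<open>2 \<le> K\<close>.\<close>
  define K where "K = max m n + 1"
  have K: "2 \<le> K" "m \<le> K" "n \<le> K" using assms by (auto simp: K_def)
  define p where "p t = n * flat_id K (t / m)" for t :: real
  \<comment> \<open>The squares here and in \<open>h\<close> extend the block to the whole line;
    they are flat where they meet it.\<close>
  define h1 where "h1 = (\<lambda>t::real. if t \<le> m then p t else n + (t - m)\<^sup>2)"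
  define h where "h = (\<lambda>t::real. if t \<le> 0 then - (t\<^sup>2) else h1 t)"
  have Dp: "DERIV p t :> n * (E / m)" if "DERIV (flat_id K) (t / m) :> E" for t E
  proof -
    have "DERIV (\<lambda>t. t / real m) t :> 1 / m" using assms by (auto intro!: derivative_eq_intros)
    from DERIV_chain2[OF that this] have "DERIV (\<lambda>t. flat_id K (t / m)) t :> E * (1 / m)" .
    from DERIV_cmult[OF this, of "real n"] show ?thesis unfolding p_def[abs_def] by simp
  qed
  have flat0: "DERIV (flat_id K) 0 :> 0" "DERIV (flat_id K) 1 :> 0"
    using DERIV_flat_id[of K 0] DERIV_flat_id[of K 1] K by (auto simp: zero_power)
  have p0: "DERIV p 0 :> 0" "DERIV p m :> 0" using Dp[of 0 0] Dp[of 0 m] flat0 assms by auto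
  have pv: "p 0 = 0" "p m = n" using K assms by (auto simp: p_def flat_id_def)
  have pd: "p differentiable (at t)" for t
    using Dp DERIV_flat_id by (meson real_differentiable_def)
  have pm: "strict_mono_on {0..real m} p"
  proof (rule strict_mono_onI)
    fix r s assume "r \<in> {0..real m}" "s \<in> {0..real m}" "r < s"
    then have "flat_id K (r / m) < flat_id K (s / m)"
      using assms by (intro strict_mono_onD[OF flat_id_strict_mono[OF K(1)]]) (auto simp: divide_strict_right_mono)
    then show "p r < p s" using assms by (simp add: p_def)
  qed
  have h1m: "strict_mono_on {0..} h1" unfolding h1_def
  proof (rule strict_mono_on_glue)
    show "strict_mono_on ({0..} \<inter> {..real m}) p"
      using pm by (auto simp: strict_mono_on_def)
    show "strict_mono_on ({0..} \<inter> {real m..}) (\<lambda>t. n + (t - m)\<^sup>2)"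
      by (auto simp: strict_mono_on_def intro!: power_strict_mono)
  qed (use pv in auto)
  have h1d: "h1 differentiable (at t)" for t
    unfolding h1_def by (rule differentiable_glue) (use pv pd p0 in \<open>auto intro!: derivative_eq_intros\<close>)
  have h10: "DERIV h1 0 :> 0"
    unfolding h1_def by (rule DERIV_glue) (use pv p0 assms in auto)
  have h1M: "DERIV h1 m :> 0"
    unfolding h1_def by (rule DERIV_glue) (use pv p0 assms in \<open>auto intro!: derivative_eq_intros\<close>)
  have h1v: "h1 0 = 0" "h1 m = n" using pv by (auto simp: h1_def)
  have hm: "strict_mono h" unfolding h_def
  proof (rule strict_mono_on_glue[of _ _ _ UNIV])
    show "strict_mono_on (UNIV \<inter> {..0}) (\<lambda>t::real. - (t\<^sup>2))"
      by (auto simp: strict_mono_on_def square_strict_antimono)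
  qed (use h1m h1v in auto)
  have hd: "h differentiable (at t)" for t
    unfolding h_def by (rule differentiable_glue) (use h1v h1d h10 in \<open>auto intro!: derivative_eq_intros\<close>)
  have h0: "DERIV h 0 :> 0"
    unfolding h_def by (rule DERIV_glue) (use h1v h10 in \<open>auto intro!: derivative_eq_intros\<close>)
  have hM: "DERIV h m :> 0"
    unfolding h_def by (rule DERIV_glue) (use h1v h1M assms in auto)
  have hv: "h 0 = 0" "h m = n" using h1v assms by (auto simp: h_def)
  have w: "warp m n h" unfolding warp_def using hv hm hd h0 hM by auto
  show thesis
  proof (rule that[OF w])
    fix t :: real assume t: "0 \<le> t" "t \<le> real m"
    have hp: "h t = p t" using t pv by (auto simp: h_def h1_def)
    then have "h t / n = flat_id K (t / m)" using assms by (simp add: p_def)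
    moreover have "\<bar>flat_id K (t / m) - t / m\<bar> \<le> 1 / K"
      by (rule flat_id_error) (use t assms K in auto)
    moreover have "1 / real K \<le> 1 / m" "1 / real K \<le> 1 / n" using K assms by (auto simp: field_simps)
    moreover have "0 \<le> h t" "h t \<le> n"
      using hm t hv by (metis strict_mono_less_eq)+
    ultimately show "\<bar>h t / n - t / m\<bar> \<le> 1 / m \<and> \<bar>h t / n - t / m\<bar> \<le> 1 / n \<and> 0 \<le> h t \<and> h t \<le> n"
      by auto
  qed
qed

section \<open>Words and fellow travelling\<close>

context group
begin

abbreviation val :: "'a list \<Rightarrow> 'a" where "val \<equiv> word_val G"

text \<open>Past the end of \<open>w\<close>, \<open>take\<close> returns the whole word, in
  agreement with the constant tail of \<open>word_path\<close>.\<close>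

abbreviation vertex_at :: "'a list \<Rightarrow> real \<Rightarrow> 'a" where
  "vertex_at w t \<equiv> val (take (nat \<lfloor>t\<rfloor>) w)"

lemma val_Nil [simp]: "val [] = \<one>"
  by (simp add: word_val_def)

lemma val_Cons [simp]: "val (x # w) = x \<otimes> val w"
  by (simp add: word_val_def)

lemma val_closed [simp, intro]: "set w \<subseteq> carrier G \<Longrightarrow> val w \<in> carrier G"
  by (induction w) auto

lemma val_append:
  "\<lbrakk>set u \<subseteq> carrier G; set v \<subseteq> carrier G\<rbrakk> \<Longrightarrow> val (u @ v) = val u \<otimes> val v"
  by (induction u) (auto simp: m_assoc)

lemma val_replicate: "x \<in> carrier G \<Longrightarrow> val (replicate n x) = x [^] n"
  by (induction n) (auto simp flip: nat_pow_Suc2)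

lemma set_take_carrier [simp, intro]: "set w \<subseteq> carrier G \<Longrightarrow> set (take k w) \<subseteq> carrier G"
  using set_take_subset by fastforce

text \<open>\<open>d\<close> is the offset between the starting points of the two paths.\<close>

definition fellow_travel :: "'a set \<Rightarrow> 'a \<Rightarrow> 'a list \<Rightarrow> 'a list \<Rightarrow> bool" where
  "fellow_travel F d v w \<longleftrightarrow> (\<exists>h. warp (real (length v)) (real (length w)) h \<and>
     (\<forall>t. 0 \<le> t \<longrightarrow> t \<le> real (length v) \<longrightarrow>
        inv (vertex_at v t) \<otimes> d \<otimes> vertex_at w (h t) \<in> F))"

lemma fellow_travelE:
  assumes "fellow_travel F d v w"
  obtains h where "warp (real (length v)) (real (length w)) h"
    "\<And>t. 0 \<le> t \<Longrightarrow> t \<le> real (length v) \<Longrightarrow>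
        inv (vertex_at v t) \<otimes> d \<otimes> vertex_at w (h t) \<in> F"
proof -
  from assms obtain h where "warp (real (length v)) (real (length w)) h \<and>
     (\<forall>t. 0 \<le> t \<longrightarrow> t \<le> real (length v) \<longrightarrow>
        inv (vertex_at v t) \<otimes> d \<otimes> vertex_at w (h t) \<in> F)"
    unfolding fellow_travel_def ..
  then show thesis by (intro that[of h]) simp_all
qed

lemma fellow_travel_mono: "fellow_travel F d v w \<Longrightarrow> F \<subseteq> F' \<Longrightarrow> fellow_travel F' d v w"
  unfolding fellow_travel_def by blast

lemma fellow_travel_Nil: "d \<in> carrier G \<Longrightarrow> d \<in> F \<Longrightarrow> fellow_travel F d [] []"
  unfolding fellow_travel_def using warp_zero by (intro exI[of _ "\<lambda>t. if t \<le> 0 then - (t\<^sup>2) else t\<^sup>2"]) auto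

text \<open>When the first blocks have been read, the offset has become
  \<open>inv (val v1) \<otimes> d \<otimes> val w1\<close>, which is the starting offset of the
  second blocks.\<close>

lemma fellow_travel_append:
  assumes "fellow_travel F d v1 w1" "fellow_travel F (inv (val v1) \<otimes> d \<otimes> val w1) v2 w2" "d \<in> carrier G"
    and c: "set v1 \<subseteq> carrier G" "set w1 \<subseteq> carrier G" "set v2 \<subseteq> carrier G" "set w2 \<subseteq> carrier G"
  shows "fellow_travel F d (v1 @ v2) (w1 @ w2)"
proof -
  let ?m = "length v1" and ?n = "length w1"
  obtain h1 where h1: "warp ?m ?n h1"
    and F1: "\<And>t::real. 0 \<le> t \<Longrightarrow> t \<le> ?m \<Longrightarrow> inv (vertex_at v1 t) \<otimes> d \<otimes> vertex_at w1 (h1 t) \<in> F"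
    by (rule fellow_travelE[OF assms(1)], rule that, assumption, simp)
  obtain h2 where h2: "warp (length v2) (length w2) h2"
    and F2: "\<And>t::real. 0 \<le> t \<Longrightarrow> t \<le> length v2 \<Longrightarrow>
      inv (vertex_at v2 t) \<otimes> (inv (val v1) \<otimes> d \<otimes> val w1) \<otimes> vertex_at w2 (h2 t) \<in> F"
    by (rule fellow_travelE[OF assms(2)], rule that, assumption, simp)
  let ?h = "\<lambda>t::real. if t \<le> ?m then h1 t else ?n + h2 (t - ?m)"
  have "warp (length (v1 @ v2)) (length (w1 @ w2)) ?h"
    using warp_append[OF h1 h2] by simp
  moreover have "inv (vertex_at (v1 @ v2) t) \<otimes> d \<otimes> vertex_at (w1 @ w2) (?h t) \<in> F"
    if t: "0 \<le> t" "t \<le> length (v1 @ v2)" for t :: real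
  proof (cases "t \<le> ?m")
    case True
    have "strict_mono h1" using h1 by (simp add: warp_def)
    then have "h1 t \<le> h1 (real ?m)" using True strict_mono_less_eq by blast
    then have "h1 t \<le> ?n" using h1 unfolding warp_def by simp
    then have "nat \<lfloor>h1 t\<rfloor> \<le> ?n" "nat \<lfloor>t\<rfloor> \<le> ?m"
      using True by linarith+
    then show ?thesis using F1[OF t(1) True] True by simp
  next
    case False
    define s where "s = t - ?m"
    have s: "0 \<le> s" "s \<le> length v2" using False t by (auto simp: s_def)
    have "strict_mono h2" using h2 by (simp add: warp_def)
    then have "h2 0 \<le> h2 s" using s strict_mono_less_eq by blast
    then have h2s: "0 \<le> h2 s" using h2 unfolding warp_def by simp
    have "\<lfloor>t\<rfloor> = \<lfloor>s\<rfloor> + int ?m" unfolding s_def by (simp add: floor_diff_of_int[of _ "int ?m", simplified])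
    then have 1: "nat \<lfloor>t\<rfloor> = ?m + nat \<lfloor>s\<rfloor>" using s by (simp add: nat_add_distrib)
    have "\<lfloor>real ?n + h2 s\<rfloor> = \<lfloor>h2 s\<rfloor> + int ?n" by (simp add: floor_add_int[of _ "int ?n", simplified] add.commute)
    then have 2: "nat \<lfloor>real ?n + h2 s\<rfloor> = ?n + nat \<lfloor>h2 s\<rfloor>" using h2s by (simp add: nat_add_distrib)
    have "inv (vertex_at (v1 @ v2) t) \<otimes> d \<otimes> vertex_at (w1 @ w2) (?h t)
      = inv (val v1 \<otimes> vertex_at v2 s) \<otimes> d \<otimes> (val w1 \<otimes> vertex_at w2 (h2 s))"
      using False 1 2 c by (simp add: val_append s_def)
    also have "\<dots> = inv (vertex_at v2 s) \<otimes> (inv (val v1) \<otimes> d \<otimes> val w1) \<otimes> vertex_at w2 (h2 s)"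
      using c assms(3) by (simp add: inv_mult_group m_assoc)
    finally show ?thesis using F2[OF s] by simp
  qed
  ultimately show ?thesis unfolding fellow_travel_def by (intro exI[of _ ?h]) simp
qed

section \<open>Routes in the Cayley graph and the passage from offsets to distances\<close>

lemma cayley_route_nonneg: "cayley_route G S p q r \<Longrightarrow> 0 \<le> r"
  by (induction rule: cayley_route.induct) auto

lemma cayley_route_trans:
  assumes "cayley_route G S q r b" "cayley_route G S p q a"
  shows "cayley_route G S p r (a + b)"
  using assms
proof (induction rule: cayley_route.induct)
  case (segment p' g x s r' t)
  then show ?case using cayley_route.segment[of G S p g x s "a + r'" t] by (simp add: add.assoc)
qed simp

lemma cayley_dist_le: "cayley_route G S p q r \<Longrightarrow> r \<le> K \<Longrightarrow> cayley_dist G S p q \<le> K"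
  unfolding cayley_dist_def
  using cInf_lower[of r "{r. cayley_route G S p q r}"] cayley_route_nonneg
  by (force simp: bdd_below_def)

lemma cayley_route_edge:
  assumes "g \<in> carrier G" "x \<in> S" "s \<in> {0..1}" "t \<in> {0..1}"
  shows "cayley_route G S (edge_point G g x s) (edge_point G g x t) \<bar>s - t\<bar>"
  using cayley_route.segment[OF cayley_route.stay assms] by simp

lemma cayley_route_word:
  assumes "g \<in> carrier G" "set u \<subseteq> S" "S \<subseteq> carrier G"
  shows "cayley_route G S (Vertex g) (Vertex (g \<otimes> val u)) (length u)"
  using assms
proof (induction u arbitrary: g)
  case (Cons x u)
  have x: "x \<in> carrier G" "set u \<subseteq> carrier G" using Cons.prems by auto
  have "cayley_route G S (Vertex g) (Vertex (g \<otimes> x)) 1"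
    using cayley_route_edge[of g x S 0 1] Cons.prems by (simp add: edge_point_def)
  moreover have "cayley_route G S (Vertex (g \<otimes> x)) (Vertex (g \<otimes> x \<otimes> val u)) (length u)"
    using Cons x by auto
  ultimately show ?case using x Cons.prems cayley_route_trans by (force simp: m_assoc)
qed (use cayley_route.stay in auto)

text \<open>Rounding a position down to a vertex costs at most one edge. Both directions are
  recorded: a route leaves the first path at its point and enters the second path at its
  vertex.\<close>

lemma word_path_vertex:
  assumes "set w \<subseteq> S" "S \<subseteq> carrier G" "0 \<le> t"
  obtains a b where "a \<le> 1" "b \<le> 1"
    "cayley_route G S (word_path G w t) (Vertex (vertex_at w t)) a"
    "cayley_route G S (Vertex (vertex_at w t)) (word_path G w t) b"
proof (cases "t < length w")
  case True
  let ?g = "vertex_at w t" and ?x = "w ! nat \<lfloor>t\<rfloor>" and ?s = "t - of_int \<lfloor>t\<rfloor>"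
  have "nat \<lfloor>t\<rfloor> < length w" using True assms(3) by linarith
  then have x: "?x \<in> S" using assms(1) nth_mem by blast
  have g: "?g \<in> carrier G" using assms by (intro val_closed set_take_carrier) auto
  have s: "?s \<in> {0..1}" by (auto; linarith)
  have e: "edge_point G ?g ?x 0 = Vertex ?g" "word_path G w t = edge_point G ?g ?x ?s"
    using True by (auto simp: edge_point_def word_path_def)
  have b: "\<bar>?s - 0\<bar> \<le> 1" "\<bar>0 - ?s\<bar> \<le> 1" using s by auto
  have "cayley_route G S (word_path G w t) (Vertex ?g) \<bar>?s - 0\<bar>"
    unfolding e(2) e(1)[symmetric] by (rule cayley_route_edge[OF g x s]) simp
  moreover have "cayley_route G S (Vertex ?g) (word_path G w t) \<bar>0 - ?s\<bar>"
    unfolding e(2) e(1)[symmetric] by (rule cayley_route_edge[OF g x _ s]) simp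
  ultimately show ?thesis by (rule that[OF b])
next
  case False
  then have "length w \<le> nat \<lfloor>t\<rfloor>" by linarith
  then show ?thesis
    by (intro that[of 0 0]) (use False cayley_route.stay[of G S "Vertex (val w)"] in \<open>auto simp: word_path_def\<close>)
qed

text \<open>A word for the offset of the two vertices costs \<open>K\<close>, and rounding either
  point to its vertex costs one more each.\<close>

lemma fellow_travel_imp_async_fellow_travel:
  assumes "fellow_travel F \<one> v w" "set v \<subseteq> S" "set w \<subseteq> S" "S \<subseteq> carrier G"
    and F: "\<And>f. f \<in> F \<Longrightarrow> \<exists>u. set u \<subseteq> S \<and> real (length u) \<le> K \<and> val u = f"
  shows "async_fellow_travel G S (K + 2) v w"
proof -
  obtain h where h: "warp (length v) (length w) h"
    and hF: "\<And>t::real. 0 \<le> t \<Longrightarrow> t \<le> length v \<Longrightarrow> inv (vertex_at v t) \<otimes> \<one> \<otimes> vertex_at w (h t) \<in> F"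
    by (rule fellow_travelE[OF assms(1)], rule that, assumption, simp)
  have hm: "strict_mono h" and hd: "\<And>t. h differentiable (at t)" and h0: "h 0 = 0" "h (length v) = length w"
    using h unfolding warp_def by auto
  have cont: "continuous_on X h" for X
    using hd by (meson continuous_at_imp_continuous_on real_differentiable_def DERIV_isCont)
  have "h ` {0..real (length v)} = {0..real (length w)}"
  proof
    show "h ` {0..real (length v)} \<subseteq> {0..real (length w)}"
      using hm h0 by (auto simp: strict_mono_less_eq) (metis strict_mono_less_eq)+
    show "{0..real (length w)} \<subseteq> h ` {0..real (length v)}"
    proof
      fix y assume "y \<in> {0..real (length w)}"
      then obtain x where "0 \<le> x" "x \<le> real (length v)" "h x = y"
        using IVT'[of h 0 y "length v"] h0 cont by auto
      then show "y \<in> h ` {0..real (length v)}" by auto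
    qed
  qed
  moreover have "cayley_dist G S (word_path G v t) (word_path G w (h t)) \<le> K + 2" if t: "t > 0" for t
  proof -
    have vc: "set v \<subseteq> carrier G" "set w \<subseteq> carrier G" using assms by auto
    have ht: "0 \<le> h t" using hm h0 t by (metis less_le strict_mono_less)
    have mem: "inv (vertex_at v t) \<otimes> \<one> \<otimes> vertex_at w (h t) \<in> F"
    proof (cases "t \<le> length v")
      \<comment> \<open>Beyond \<open>length v\<close> both paths rest at their end points, so the
        condition at \<open>t = length v\<close> applies.\<close>
      case False
      then have "h (length v) < h t" using hm by (simp add: strict_mono_less)
      then have "length w \<le> nat \<lfloor>h t\<rfloor>" "length v \<le> nat \<lfloor>t\<rfloor>" using h0 False by linarith+
      then show ?thesis using hF[of "length v"] h0 by simp
    qed (use hF t in auto)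
    then obtain u where u: "set u \<subseteq> S" "real (length u) \<le> K"
      "val u = inv (vertex_at v t) \<otimes> vertex_at w (h t)"
      using F[OF mem] vc by auto
    let ?a = "vertex_at v t" and ?b = "vertex_at w (h t)"
    have c: "?a \<in> carrier G" "?b \<in> carrier G" using vc by auto
    have "?a \<otimes> val u = ?b" unfolding u(3) using c by (simp flip: m_assoc)
    then have r: "cayley_route G S (Vertex ?a) (Vertex ?b) (length u)"
      using cayley_route_word[OF c(1) u(1) assms(4)] by simp
    obtain a where a: "a \<le> 1" "cayley_route G S (word_path G v t) (Vertex ?a) a"
      using word_path_vertex[OF assms(2,4), of t] t by auto
    obtain b where b: "b \<le> 1" "cayley_route G S (Vertex ?b) (word_path G w (h t)) b"
      using word_path_vertex[OF assms(3,4) ht] by auto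
    show ?thesis
      using cayley_dist_le[OF cayley_route_trans[OF b(2) cayley_route_trans[OF r a(2)]], of "K + 2"] a b u by simp
  qed
  ultimately show ?thesis unfolding async_fellow_travel_def using hm hd by blast
qed

text \<open>Here finiteness of the set of offsets is converted into a metric bound.\<close>

lemma finite_bounded_words:
  assumes "finite F" "F \<subseteq> carrier G" "generating_set G S"
  obtains K where "\<And>f. f \<in> F \<Longrightarrow> \<exists>u. set u \<subseteq> S \<and> real (length u) \<le> K \<and> val u = f"
proof -
  have S: "S \<subseteq> carrier G" "\<And>x. x \<in> S \<Longrightarrow> inv x \<in> S" "generate G S = carrier G"
    using assms(3) unfolding generating_set_def by auto
  have ex: "\<exists>u. set u \<subseteq> S \<and> val u = f" if "f \<in> generate G S" for f
    using that
  proof (induction rule: generate.induct)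
    case one
    then show ?case by (intro exI[of _ "[]"]) auto
  next
    case (incl h)
    then show ?case using S by (intro exI[of _ "[h]"]) auto
  next
    case (inv h)
    then show ?case using S by (intro exI[of _ "[inv h]"]) auto
  next
    case (eng h1 h2)
    then obtain u1 u2 where "set u1 \<subseteq> S" "val u1 = h1" "set u2 \<subseteq> S" "val u2 = h2" by auto
    then show ?case using S by (intro exI[of _ "u1 @ u2"]) (subst val_append; auto)
  qed
  define u where "u f = (SOME u. set u \<subseteq> S \<and> val u = f)" for f
  have u: "set (u f) \<subseteq> S \<and> val (u f) = f" if "f \<in> F" for f
    unfolding u_def by (rule someI_ex[OF ex]) (use that assms S in auto)
  let ?K = "Max (insert 0 ((\<lambda>f. length (u f)) ` F))"
  have "length (u f) \<le> ?K" if "f \<in> F" for f using assms(1) that by (intro Max_ge) auto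
  then have "\<exists>w. set w \<subseteq> S \<and> real (length w) \<le> real ?K \<and> val w = f" if "f \<in> F" for f
    using u[OF that] that by (intro exI[of _ "u f"]) simp
  then show thesis by (rule that)
qed

end

section \<open>Abelian subgroups of polycyclic groups\<close>

context group
begin

lemma mult_inv_cancel [simp]:
  assumes "x \<in> carrier G" "y \<in> carrier G"
  shows "x \<otimes> (inv x \<otimes> y) = y" "inv x \<otimes> (x \<otimes> y) = y"
  using assms by (simp_all flip: m_assoc)

lemma int_pow_commute:
  assumes "x \<otimes> y = y \<otimes> x" "x \<in> carrier G" "y \<in> carrier G"
  shows "x [^] (i::int) \<otimes> y = y \<otimes> x [^] i"
proof -
  have nat: "x [^] (n::nat) \<otimes> y = y \<otimes> x [^] n" for n
    using group_commutes_pow assms by simp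
  have neg: "inv (x [^] n) \<otimes> y = y \<otimes> inv (x [^] n)" for n :: nat
  proof -
    let ?p = "x [^] n"
    have p: "?p \<in> carrier G" using assms by simp
    have "y = inv ?p \<otimes> (?p \<otimes> y)" using p assms by (simp flip: m_assoc)
    also have "\<dots> = inv ?p \<otimes> y \<otimes> ?p" using nat[of n] p assms by (simp add: m_assoc)
    finally show ?thesis using p assms by (subst inv_solve_right) auto
  qed
  show ?thesis
    by (cases "i < 0") (simp_all only: int_pow_def2 if_True if_False nat neg)
qed

definition abelian_sub :: "'a set \<Rightarrow> bool" where
  "abelian_sub B \<longleftrightarrow> subgroup B G \<and> (\<forall>x\<in>B. \<forall>y\<in>B. x \<otimes> y = y \<otimes> x)"

fun zprod :: "'a list \<Rightarrow> int list \<Rightarrow> 'a" where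
  "zprod (t # ts) (e # es) = t [^] e \<otimes> zprod ts es"
| "zprod _ _ = \<one>"

lemma zprod_closed_subgroup: "subgroup B G \<Longrightarrow> set ts \<subseteq> B \<Longrightarrow> zprod ts es \<in> B"
  by (induction ts es rule: zprod.induct)
    (auto simp: subgroup.one_closed intro!: subgroup.m_closed subgroup_int_pow_closed)

lemma zprod_closed [simp, intro]: "set ts \<subseteq> carrier G \<Longrightarrow> zprod ts es \<in> carrier G"
  using zprod_closed_subgroup[OF subgroup_self] .

lemma zprod_add:
  assumes B: "abelian_sub B" and "set ts \<subseteq> B" "length es = length fs"
  shows "zprod ts es \<otimes> zprod ts fs = zprod ts (map2 (+) es fs)"
  using assms(2,3)
proof (induction ts es arbitrary: fs rule: zprod.induct)
  case (1 t ts e es)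
  then obtain f fs' where fs: "fs = f # fs'" "length es = length fs'" using 1(3) by (cases fs) simp_all
  have sub: "subgroup B G" and com: "\<And>x y. x \<in> B \<Longrightarrow> y \<in> B \<Longrightarrow> x \<otimes> y = y \<otimes> x"
    using B by (auto simp: abelian_sub_def)
  have t: "t \<in> B" "set ts \<subseteq> B" using 1(2) by simp_all
  have Bc: "\<And>x. x \<in> B \<Longrightarrow> x \<in> carrier G" by (rule subgroup.mem_carrier[OF sub])
  let ?p = "zprod ts es" and ?q = "zprod ts fs'"
  have B': "?p \<in> B" "?q \<in> B" "t [^] e \<in> B" "t [^] f \<in> B"
    using sub t by (simp_all add: zprod_closed_subgroup subgroup_int_pow_closed)
  have "(t [^] e \<otimes> ?p) \<otimes> (t [^] f \<otimes> ?q) = t [^] e \<otimes> (?p \<otimes> t [^] f) \<otimes> ?q"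
    using B' Bc by (simp add: m_assoc)
  also have "\<dots> = t [^] e \<otimes> (t [^] f \<otimes> ?p) \<otimes> ?q" using com[of ?p "t [^] f"] B' by simp
  also have "\<dots> = (t [^] e \<otimes> t [^] f) \<otimes> (?p \<otimes> ?q)" using B' Bc by (simp add: m_assoc)
  also have "\<dots> = t [^] (e + f) \<otimes> zprod ts (map2 (+) es fs')"
    using 1(1)[of fs'] fs t Bc by (simp add: int_pow_mult)
  finally show ?case using fs by simp
qed auto

lemma zprod_zeros: "set ts \<subseteq> carrier G \<Longrightarrow> zprod ts (replicate n 0) = \<one>"
proof (induction ts arbitrary: n)
  case (Cons t ts)
  then show ?case by (cases n) auto
qed simp

lemma zprod_uminus:
  assumes "abelian_sub B" "set ts \<subseteq> B"
  shows "zprod ts (map uminus es) = inv (zprod ts es)"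
proof -
  have c: "set ts \<subseteq> carrier G" using assms subgroup.subset[of B G] unfolding abelian_sub_def by simp
  have "map2 (+) (map uminus es) es = replicate (length es) 0"
    by (induction es) auto
  then have "zprod ts (map uminus es) \<otimes> zprod ts es = \<one>"
    using zprod_add[OF assms, of "map uminus es" es] zprod_zeros[OF c] by simp
  then show ?thesis using c inv_equality by simp
qed

definition independent :: "'a list \<Rightarrow> bool" where
  "independent ts \<longleftrightarrow> (\<forall>es. length es = length ts \<longrightarrow> zprod ts es = \<one> \<longrightarrow> set es \<subseteq> {0})"

text \<open>The element \<open>z\<close> lifts a generator of the cyclic factor, and
  \<open>inv (z [^] i) \<otimes> x \<in> K\<close> places \<open>x\<close> in the coset of
  \<open>z [^] i\<close>.\<close>

lemma polycyclic_step:
  assumes "K \<lhd> (G\<lparr>carrier := L\<rparr>)" "subgroup L G" "cyclic_group ((G\<lparr>carrier := L\<rparr>) Mod K)"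
  obtains z where "subgroup K G" "K \<subseteq> L" "z \<in> L"
    "\<forall>k\<in>K. \<forall>i::int. inv (z [^] i) \<otimes> k \<otimes> z [^] i \<in> K"
    "\<forall>x\<in>L. \<exists>i::int. inv (z [^] i) \<otimes> x \<in> K"
proof -
  let ?L = "G\<lparr>carrier := L\<rparr>"
  interpret L: group ?L using assms(2) by (rule subgroup_imp_group)
  interpret K: normal K ?L by (rule assms(1))
  interpret Q: group "?L Mod K" by (rule K.factorgroup_is_group)
  obtain X where X: "X \<in> carrier (?L Mod K)" "carrier (?L Mod K) = range (\<lambda>n::int. X [^]\<^bsub>?L Mod K\<^esub> n)"
    using assms(3) Q.cyclic_group by blast
  then obtain z where z: "z \<in> L" "X = K #>\<^bsub>?L\<^esub> z"
    by (auto simp: FactGroup_def RCOSETS_def)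
  have pow: "z [^]\<^bsub>?L\<^esub> i = z [^] i" for i :: int
    using int_pow_consistent[OF assms(2) z(1)] by simp
  have zL: "z [^] i \<in> L" for i :: int using subgroup_int_pow_closed[OF assms(2) z(1)] .
  have KL: "K \<subseteq> L" using K.subset by simp
  have inv: "inv\<^bsub>?L\<^esub> x = inv x" if "x \<in> L" for x using assms(2) that by simp
  have conj: "inv (z [^] i) \<otimes> k \<otimes> z [^] i \<in> K" if "k \<in> K" for k and i :: int
    using K.inv_op_closed1[of "z [^] i" k] zL that inv by simp
  show thesis
  proof (rule that[OF _ KL z(1)])
    show "subgroup K G"
      using K.subgroup_axioms assms(2) incl_subgroup by blast
    show "\<forall>k\<in>K. \<forall>i::int. inv (z [^] i) \<otimes> k \<otimes> z [^] i \<in> K" using conj by simp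
    show "\<forall>x\<in>L. \<exists>i::int. inv (z [^] i) \<otimes> x \<in> K"
    proof
      fix x assume x: "x \<in> L"
      then have "K #>\<^bsub>?L\<^esub> x \<in> carrier (?L Mod K)" by (auto simp: FactGroup_def RCOSETS_def)
      then obtain i :: int where "K #>\<^bsub>?L\<^esub> x = X [^]\<^bsub>?L Mod K\<^esub> i" using X by auto
      then have "K #>\<^bsub>?L\<^esub> x = K #>\<^bsub>?L\<^esub> (z [^] i)"
        using K.FactGroup_int_pow[of z i] z pow by simp
      moreover have "x \<in> K #>\<^bsub>?L\<^esub> x" using x L.rcos_self K.subgroup_axioms by simp
      ultimately obtain k where k: "k \<in> K" "x = k \<otimes> z [^] i"
        by (auto simp: r_coset_def)
      have "inv (z [^] i) \<otimes> x \<in> K"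
        using conj[OF k(1), of i] k KL zL subgroup.mem_carrier[OF assms(2)] by (simp add: m_assoc subset_iff)
      then show "\<exists>i::int. inv (z [^] i) \<otimes> x \<in> K" by blast
    qed
  qed
qed

lemma polycyclic_finitely_gen:
  "polycyclic_seq G L \<Longrightarrow> \<exists>X. finite X \<and> X \<subseteq> L \<and> L \<subseteq> generate G X"
proof (induction rule: polycyclic_seq.induct)
  case unity
  show ?case by (intro exI[of _ "{}"]) (auto simp: generate_empty)
next
  case (extension K L)
  obtain z where z: "subgroup K G" "K \<subseteq> L" "z \<in> L" "\<forall>x\<in>L. \<exists>i::int. inv (z [^] i) \<otimes> x \<in> K"
    by (rule polycyclic_step[OF extension(2-4)])
  obtain X where X: "finite X" "X \<subseteq> K" "K \<subseteq> generate G X" using extension by blast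
  have c: "insert z X \<subseteq> carrier G" "L \<subseteq> carrier G" using z X subgroup.subset[OF extension(3)] by auto
  have sub: "subgroup (generate G (insert z X)) G" using generate_is_subgroup c by simp
  have "x \<in> generate G (insert z X)" if x: "x \<in> L" for x
  proof -
    obtain i :: int where i: "inv (z [^] i) \<otimes> x \<in> K" using z(4) x by blast
    have "z \<in> generate G (insert z X)" by (simp add: generate.incl)
    then have 1: "z [^] i \<in> generate G (insert z X)" using subgroup_int_pow_closed[OF sub] by blast
    have 2: "inv (z [^] i) \<otimes> x \<in> generate G (insert z X)"
      using i X(3) mono_generate[of X "insert z X"] by blast
    have "z [^] i \<otimes> (inv (z [^] i) \<otimes> x) = x" using c x by (simp add: subset_iff flip: m_assoc)
    then show ?thesis using subgroup.m_closed[OF sub 1 2] by simp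
  qed
  then show ?case using X z by (intro exI[of _ "insert z X"]) auto
qed

text \<open>Induction along the series, applied to the intersections of its members with
  \<open>B\<close>. A cyclic factor contributes one element \<open>s\<close>: if no positive power
  of \<open>s\<close> lies in \<open>K\<close>, then \<open>s\<close> joins the basis; otherwise
  finitely many powers of \<open>s\<close> are absorbed into \<open>T\<close>.\<close>

lemma abelian_virtual_basis:
  assumes "polycyclic_seq G L" and B: "abelian_sub B"
  shows "\<exists>ts T. set ts \<subseteq> B \<inter> L \<and> independent ts \<and> finite T \<and> T \<subseteq> B \<inter> L \<and>
    (\<forall>x \<in> B \<inter> L. \<exists>es. \<exists>t\<in>T. length es = length ts \<and> x = zprod ts es \<otimes> t)"
  using assms(1)
proof (induction rule: polycyclic_seq.induct)
  case unity
  have "\<one> \<in> B" using B by (auto simp: abelian_sub_def subgroup.one_closed)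
  then show ?case by (intro exI[of _ "[]"] exI[of _ "{\<one>}"]) (auto simp: independent_def)
next
  case (extension K L)
  have sub: "subgroup B G" and com: "\<And>x y. x \<in> B \<Longrightarrow> y \<in> B \<Longrightarrow> x \<otimes> y = y \<otimes> x"
    using B by (auto simp: abelian_sub_def)
  have Bc: "\<And>x. x \<in> B \<Longrightarrow> x \<in> carrier G" by (rule subgroup.mem_carrier[OF sub])
  obtain z where K: "subgroup K G" "K \<subseteq> L" and z: "z \<in> L"
    and norm0: "\<forall>k\<in>K. \<forall>i::int. inv (z [^] i) \<otimes> k \<otimes> z [^] i \<in> K"
    and lev: "\<forall>x\<in>L. \<exists>i::int. inv (z [^] i) \<otimes> x \<in> K"
    by (rule polycyclic_step[OF extension(2-4)])
  have norm: "inv (z [^] i) \<otimes> k \<otimes> z [^] i \<in> K" if "k \<in> K" for k and i :: int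
    using norm0 that by blast
  have Lc: "\<And>x. x \<in> L \<Longrightarrow> x \<in> carrier G" by (rule subgroup.mem_carrier[OF extension(3)])
  have zc: "z \<in> carrier G" using z Lc by blast
  obtain ts T where IH: "set ts \<subseteq> B \<inter> K" "independent ts" "finite T" "T \<subseteq> B \<inter> K"
    and cov: "\<forall>x \<in> B \<inter> K. \<exists>es. \<exists>t\<in>T. length es = length ts \<and> x = zprod ts es \<otimes> t"
    using extension.IH by (elim exE conjE)
  \<comment> \<open>The level of \<open>x\<close> in the cyclic factor. If the factor is finite, an
    element has many levels, so \<open>lv\<close> is a relation and not a function.\<close>
  define lv where "lv i x \<longleftrightarrow> inv (z [^] i) \<otimes> x \<in> K" for i :: int and x
  have lv0: "lv 0 x \<longleftrightarrow> x \<in> K" if "x \<in> carrier G" for x using that by (simp add: lv_def)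
  have lv_mult: "lv (i + j) (x \<otimes> y)" if "lv i x" "lv j y" "x \<in> carrier G" "y \<in> carrier G" for i j x y
  proof -
    have "inv (z [^] (i + j)) \<otimes> (x \<otimes> y) =
      (inv (z [^] j) \<otimes> (inv (z [^] i) \<otimes> x) \<otimes> z [^] j) \<otimes> (inv (z [^] j) \<otimes> y)"
      using zc that by (simp add: int_pow_mult inv_mult_group m_assoc)
    then show ?thesis
      using subgroup.m_closed[OF K(1) norm[of "inv (z [^] i) \<otimes> x" j]] that by (simp add: lv_def)
  qed
  have lv_inv: "lv (- i) (inv x)" if "lv i x" "x \<in> carrier G" for i x
  proof -
    have "inv (inv (z [^] (- i)) \<otimes> (inv (z [^] i) \<otimes> x) \<otimes> z [^] (- i)) = inv (z [^] (- i)) \<otimes> inv x"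
      using zc that by (simp add: int_pow_neg inv_mult_group m_assoc)
    then show ?thesis
      using subgroup.m_inv_closed[OF K(1) norm[of "inv (z [^] i) \<otimes> x" "- i"]] that by (simp add: lv_def)
  qed
  have lv_nat: "lv (i * int n) (x [^] n)" if "lv i x" "x \<in> carrier G" for i x and n :: nat
  proof (induction n)
    case 0
    then show ?case using subgroup.one_closed[OF K(1)] by (simp add: lv_def)
  next
    case (Suc n)
    then show ?case using lv_mult[OF Suc that(1)] that by (simp add: algebra_simps)
  qed
  have lv_int: "lv (i * j) (x [^] j)" if "lv i x" "x \<in> carrier G" for i x and j :: int
  proof (cases "j \<ge> 0")
    case True
    then have "i * j = i * int (nat j)" "x [^] j = x [^] nat j" by (simp_all only: pow_nat int_nat_eq if_True)
    then show ?thesis using lv_nat[OF that, of "nat j"] by (simp only:)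
  next
    case False
    then have "i * j = - (i * int (nat (- j)))" by simp
    moreover have "x [^] j = inv (x [^] nat (- j))"
      using False int_pow_def2[of G x j] by (simp only: not_le if_True)
    ultimately show ?thesis using lv_inv[OF lv_nat[OF that, of "nat (- j)"] nat_pow_closed[OF that(2)]] by (simp only:)
  qed
  show ?case
  proof (cases "\<forall>x \<in> B \<inter> L. \<forall>i. lv i x \<longrightarrow> i = 0")
    case True
    have "B \<inter> L = B \<inter> K"
      using True lev lv0 K(2) Lc unfolding lv_def by blast
    then show ?thesis using extension.IH by simp
  next
    case False
    then obtain x i where x: "x \<in> B \<inter> L" "lv i x" "i \<noteq> 0" by blast
    \<comment> \<open>Division with remainder by the least positive level \<open>m\<close> works as
      in a subgroup of the integers; for a finite factor \<open>s\<close> may even lie in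
      \<open>K\<close>.\<close>
    define P where "P n \<longleftrightarrow> 0 < n \<and> (\<exists>s \<in> B \<inter> L. lv (int n) s)" for n :: nat
    have "P (nat \<bar>i\<bar>)"
    proof (cases "i > 0")
      case False
      have "inv x \<in> B \<inter> L" using x sub extension(3) by (auto intro: subgroup.m_inv_closed)
      then show ?thesis using x False lv_inv[OF x(2)] Lc unfolding P_def by auto
    qed (use x in \<open>auto simp: P_def\<close>)
    define m where "m = (LEAST n. P n)"
    have "P m" unfolding m_def using \<open>P (nat \<bar>i\<bar>)\<close> by (rule LeastI)
    then obtain s where s: "s \<in> B \<inter> L" "lv (int m) s" and m: "0 < m" unfolding P_def by blast
    have sc: "s \<in> carrier G" using s Lc by blast
    have sBL: "s [^] j \<in> B \<inter> L" for j :: int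
      using s subgroup_int_pow_closed[OF sub] subgroup_int_pow_closed[OF extension(3)] by blast
    have BK: "subgroup (B \<inter> K) G" using subgroups_Inter_pair[OF sub K(1)] .
    have div: "\<exists>q::int. \<exists>y \<in> B \<inter> K. x = s [^] q \<otimes> y" if x: "x \<in> B \<inter> L" for x
    proof -
      obtain i where i: "lv i x" using lev x unfolding lv_def by blast
      define q where "q = i div int m"
      define y where "y = s [^] (- q) \<otimes> x"
      have "y \<in> B \<inter> L" unfolding y_def using sBL x subgroup.m_closed[OF sub] subgroup.m_closed[OF extension(3)] by blast
      moreover have "lv (int m * (- q) + i) y"
        unfolding y_def by (intro lv_mult lv_int) (use s x i sc Lc in auto)
      then have r: "lv (i mod int m) y" unfolding q_def by (simp add: algebra_simps minus_div_mult_eq_mod[symmetric])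
      have "i mod int m = 0"
      proof (rule ccontr)
        assume "i mod int m \<noteq> 0"
        moreover have "0 \<le> i mod int m" "i mod int m < int m" using m by auto
        ultimately have "P (nat (i mod int m))" "nat (i mod int m) < m"
          unfolding P_def using r \<open>y \<in> B \<inter> L\<close> by auto
        then show False unfolding m_def using not_less_Least by blast
      qed
      then have "y \<in> K" using r lv0[of y] \<open>y \<in> B \<inter> L\<close> Lc by auto
      moreover have "x = s [^] q \<otimes> y"
        unfolding y_def using sc x Lc by (simp add: int_pow_neg flip: m_assoc)
      ultimately show ?thesis using \<open>y \<in> B \<inter> L\<close> by blast
    qed
    show ?thesis
    proof (cases "\<exists>j::nat. 0 < j \<and> s [^] j \<in> K")
      case True
      then obtain j :: nat where j: "0 < j" "s [^] j \<in> K" by blast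
      let ?T = "(\<lambda>(r::nat, t). s [^] r \<otimes> t) ` ({..<j} \<times> T)"
      have sn: "s [^] (r::nat) \<in> B \<inter> L" for r using sBL[of "int r"] by (simp add: int_pow_int)
      have "s [^] r \<otimes> t \<in> B \<inter> L" if "t \<in> T" for r :: nat and t
      proof -
        have "t \<in> B" "t \<in> L" "s [^] r \<in> B" "s [^] r \<in> L" using sn[of r] that IH(4) K(2) by auto
        then show ?thesis using subgroup.m_closed[OF sub] subgroup.m_closed[OF extension(3)] by simp
      qed
      then have TBL: "?T \<subseteq> B \<inter> L" by auto
      have "\<exists>es. \<exists>t\<in>?T. length es = length ts \<and> x = zprod ts es \<otimes> t" if x: "x \<in> B \<inter> L" for x
      proof -
        obtain q :: int and y where q: "y \<in> B \<inter> K" "x = s [^] q \<otimes> y" using div[OF x] by blast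
        \<comment> \<open>The exponent of \<open>s\<close> is split as
          \<open>r + j * (q div j)\<close>. The multiple of \<open>j\<close> is moved into
          \<open>B \<inter> K\<close>, and \<open>s [^] r\<close> is left for the finite
          set.\<close>
        define r where "r = nat (q mod int j)"
        have r: "r < j" "int r = q mod int j" using j by (auto simp: r_def nat_less_iff)
        have "(s [^] j) [^] (q div int j) \<in> B \<inter> K"
          by (rule subgroup_int_pow_closed[OF BK]) (use j sn in auto)
        then have y': "(s [^] j) [^] (q div int j) \<otimes> y \<in> B \<inter> K" (is "?y \<in> _")
          using subgroup.m_closed[OF BK] q by blast
        have "s [^] r \<otimes> (s [^] j) [^] (q div int j) = s [^] (int r + int j * (q div int j))"
          using sc by (simp add: int_pow_mult int_pow_int int_pow_pow flip: int_pow_int)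
        also have "\<dots> = s [^] q" using r by simp
        finally have "s [^] r \<otimes> (s [^] j) [^] (q div int j) = s [^] q" .
        moreover have "s [^] r \<otimes> ?y = s [^] r \<otimes> (s [^] j) [^] (q div int j) \<otimes> y"
          using q sc Bc by (simp add: m_assoc)
        ultimately have "x = s [^] r \<otimes> ?y" using q by simp
        moreover obtain es t where t: "t \<in> T" "length es = length ts" "?y = zprod ts es \<otimes> t"
          using bspec[OF cov y'] by blast
        moreover have zB: "zprod ts es \<in> B" using zprod_closed_subgroup[OF sub] IH by simp
        ultimately have "x = s [^] r \<otimes> zprod ts es \<otimes> t" using sc Bc IH(4) by (simp add: m_assoc subset_iff)
        also have "\<dots> = zprod ts es \<otimes> (s [^] r \<otimes> t)"
          using com[OF _ zB, of "s [^] r"] sn sc Bc zB t IH(4) by (simp add: m_assoc subset_iff)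
        finally show ?thesis using t r by force
      qed
      then show ?thesis using IH TBL K(2) by (intro exI[of _ ts] exI[of _ ?T]) auto
    next
      case False
      \<comment> \<open>Now \<open>s\<close> has infinite order modulo \<open>K\<close>, so its
        exponent vanishes in every relation.\<close>
      have inf: "e = 0" if "s [^] e \<in> K" for e :: int
      proof (rule ccontr)
        assume "e \<noteq> 0"
        have "s [^] nat \<bar>e\<bar> \<in> K"
        proof (cases "e < 0")
          case True
          then have "s [^] e = inv (s [^] nat \<bar>e\<bar>)" using int_pow_def2[of G s e] by simp
          then show ?thesis using subgroup.m_inv_closed[OF K(1) that] sc by simp
        next
          case False
          then have e: "e \<ge> 0" by simp
          show ?thesis using that pow_nat[OF e, of G s] unfolding abs_of_nonneg[OF e] by (simp only:)
        qed
        moreover have "0 < nat \<bar>e\<bar>" using \<open>e \<noteq> 0\<close> by simp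
        ultimately show False using False by blast
      qed
      have "independent (s # ts)"
        unfolding independent_def
      proof (intro allI impI)
        fix es assume es: "length es = length (s # ts)" "zprod (s # ts) es = \<one>"
        then obtain e es' where e: "es = e # es'" "length es' = length ts" by (cases es) auto
        have zK: "zprod ts es' \<in> K" using zprod_closed_subgroup[OF K(1)] IH by simp
        then have zc: "zprod ts es' \<in> carrier G" using K Lc by blast
        have "s [^] e = inv (zprod ts es')" using es e sc zc by (metis inv_equality int_pow_closed inv_closed inv_inv zprod.simps(1))
        then have "e = 0" using inf subgroup.m_inv_closed[OF K(1) zK] by simp
        then have "zprod ts es' = \<one>" using es e sc zc by simp
        then show "set es \<subseteq> {0}" using IH(2) e \<open>e = 0\<close> unfolding independent_def by simp
      qed
      moreover have "\<exists>es. \<exists>t\<in>T. length es = length (s # ts) \<and> x = zprod (s # ts) es \<otimes> t" if x: "x \<in> B \<inter> L" for x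
      proof -
        obtain q :: int and y where q: "y \<in> B \<inter> K" "x = s [^] q \<otimes> y" using div[OF x] by blast
        then obtain es t where t: "t \<in> T" "length es = length ts" "y = zprod ts es \<otimes> t" using cov by blast
        have "zprod ts es \<in> carrier G" "t \<in> carrier G" using t IH Bc by (auto simp: subset_iff)
        then show ?thesis using t q sc by (intro exI[of _ "q # es"] bexI[of _ t]) (simp_all add: m_assoc)
      qed
      ultimately show ?thesis using IH K(2) s by (intro exI[of _ "s # ts"] exI[of _ T]) auto
    qed
  qed
qed

end

section \<open>Coordinates on an abelian subgroup\<close>

context group
begin

definition int_span :: "'a list \<Rightarrow> 'a set" where
  "int_span ts = {zprod ts es | es. length es = length ts}"

lemma int_spanI: "length es = length ts \<Longrightarrow> zprod ts es \<in> int_span ts"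
  unfolding int_span_def by blast

lemma int_spanE:
  assumes "a \<in> int_span ts"
  obtains es where "length es = length ts" "a = zprod ts es"
  using assms unfolding int_span_def by blast

lemma int_span_subgroup:
  assumes "abelian_sub B" "set ts \<subseteq> B"
  shows "subgroup (int_span ts) G"
proof -
  have c: "set ts \<subseteq> carrier G" using assms subgroup.subset[of B G] unfolding abelian_sub_def by simp
  show ?thesis
  proof (rule subgroupI)
    show "int_span ts \<subseteq> carrier G" using c by (auto simp: int_span_def)
    show "int_span ts \<noteq> {}" unfolding int_span_def using int_spanI[of "replicate (length ts) 0" ts] unfolding int_span_def by force
  next
    fix a assume "a \<in> int_span ts"
    then obtain es where es: "length es = length ts" "a = zprod ts es" by (rule int_spanE)
    show "inv a \<in> int_span ts"
      unfolding es(2) zprod_uminus[OF assms, symmetric] by (rule int_spanI) (simp add: es(1))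
  next
    fix a b assume ab: "a \<in> int_span ts" "b \<in> int_span ts"
    obtain es where es: "length es = length ts" "a = zprod ts es" using ab(1) by (rule int_spanE)
    obtain fs where fs: "length fs = length ts" "b = zprod ts fs" using ab(2) by (rule int_spanE)
    have "a \<otimes> b = zprod ts (map2 (+) es fs)"
      unfolding es(2) fs(2) by (rule zprod_add[OF assms]) (simp add: es(1) fs(1))
    then show "a \<otimes> b \<in> int_span ts" using int_spanI[of "map2 (+) es fs" ts] es(1) fs(1) by simp
  qed
qed

lemma zprod_unit:
  assumes "set ts \<subseteq> carrier G" "j < length ts"
  shows "zprod ts ((replicate (length ts) 0)[j := m]) = (ts ! j) [^] m"
  using assms
proof (induction ts arbitrary: j)
  case (Cons t ts)
  then show ?case by (cases j) (auto simp: zprod_zeros subset_iff)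
qed simp

lemma independent_unique:
  assumes "abelian_sub B" "set ts \<subseteq> B" "independent ts" "length es = length ts" "length fs = length ts"
    "zprod ts es = zprod ts fs"
  shows "es = fs"
proof -
  have c: "set ts \<subseteq> carrier G" using assms subgroup.subset[of B G] unfolding abelian_sub_def by simp
  have "zprod ts (map2 (+) es (map uminus fs)) = \<one>"
    using zprod_add[OF assms(1,2), of es "map uminus fs"] zprod_uminus[OF assms(1,2), of fs] assms c by simp
  then have "set (map2 (+) es (map uminus fs)) \<subseteq> {0}"
    using assms(4,5) assms(3)[unfolded independent_def, rule_format, of "map2 (+) es (map uminus fs)"] by simp
  then have 0: "map2 (+) es (map uminus fs) ! i = 0" if "i < length ts" for i
    using that assms(4,5) nth_mem[of i "map2 (+) es (map uminus fs)"] by auto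
  show ?thesis
    by (rule nth_equalityI) (use 0 assms(4,5) in auto)
qed

end

text \<open>The map \<open>\<phi>\<close> embeds \<open>A\<close> into \<open>Z^n\<close> with an
  image that contains \<open>N Z^n\<close>; the elements of \<open>bs\<close> correspond to the
  vectors \<open>N e_j\<close> and span a subgroup of finite index.\<close>

locale lattice = group G for G (structure) +
  fixes A :: "'a set" and n :: nat and N :: int and bs :: "'a list" and \<phi> :: "'a \<Rightarrow> nat \<Rightarrow> int"
  assumes A: "abelian_sub A"
    and bs: "set bs \<subseteq> A" "length bs = n"
    and N: "0 < N"
    and \<phi>_mult: "\<lbrakk>a \<in> A; b \<in> A\<rbrakk> \<Longrightarrow> \<phi> (a \<otimes> b) i = \<phi> a i + \<phi> b i"
    and \<phi>_bs: "\<lbrakk>j < n; i < n\<rbrakk> \<Longrightarrow> \<phi> (bs ! j) i = (if i = j then N else 0)"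
    and \<phi>_inj: "\<lbrakk>a \<in> A; \<forall>i<n. \<phi> a i = 0\<rbrakk> \<Longrightarrow> a = \<one>"

text \<open>Some power \<open>M\<close> carries all of \<open>B\<close> into the span of the virtual
  basis, and the exponents of \<open>x [^] M\<close> serve as coordinates of \<open>x\<close>, which
  gives \<open>N = M\<close>. They determine \<open>x\<close> because \<open>B\<close> is torsion
  free.\<close>

lemma (in group) lattice_exists:
  assumes B: "abelian_sub B" and pc: "polycyclic_seq G L" "B \<subseteq> L" and tf: "torsion_free G"
  shows "\<exists>n N bs \<phi>. lattice G B n N bs \<phi>"
proof -
  have sub: "subgroup B G" and com: "\<And>x y. x \<in> B \<Longrightarrow> y \<in> B \<Longrightarrow> x \<otimes> y = y \<otimes> x"
    using B by (auto simp: abelian_sub_def)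
  have Bc: "\<And>x. x \<in> B \<Longrightarrow> x \<in> carrier G" by (rule subgroup.mem_carrier[OF sub])
  have BL: "B \<inter> L = B" using pc(2) by blast
  obtain ts T where ts: "set ts \<subseteq> B" "independent ts" "finite T" "T \<subseteq> B"
    and cov: "\<forall>x\<in>B. \<exists>es. \<exists>t\<in>T. length es = length ts \<and> x = zprod ts es \<otimes> t"
    using abelian_virtual_basis[OF pc(1) B] unfolding BL by (elim exE conjE)
  note int_span = int_span_subgroup[OF B ts(1)]
  have ex: "\<exists>m::nat. 0 < m \<and> t [^] m \<in> int_span ts" if t: "t \<in> T" for t
  proof -
    have tB: "t [^] i \<in> B" for i :: nat using t ts(4) subgroup_int_pow_closed[OF sub, of t "int i"] by (auto simp: int_pow_int)
    have "\<exists>\<tau> \<in> T. \<exists>es. length es = length ts \<and> t [^] i = zprod ts es \<otimes> \<tau>" for i :: nat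
      using bspec[OF cov tB[of i]] by blast
    then obtain \<tau> where \<tau>: "\<And>i::nat. \<tau> i \<in> T" "\<And>i::nat. \<exists>es. length es = length ts \<and> t [^] i = zprod ts es \<otimes> \<tau> i"
      by metis
    \<comment> \<open>Pigeonhole: two powers of \<open>t\<close> share a representative in
      \<open>T\<close>, so their quotient lies in the span.\<close>
    have "\<not> inj \<tau>" using \<tau>(1) ts(3) by (metis finite_subset image_subsetI infinite_UNIV_nat finite_imageD)
    then obtain i j where ij: "i < j" "\<tau> i = \<tau> j" by (metis injI linorder_neqE_nat)
    obtain es fs where ef: "length es = length ts" "t [^] i = zprod ts es \<otimes> \<tau> i" "length fs = length ts" "t [^] j = zprod ts fs \<otimes> \<tau> i"
      using \<tau>(2)[of i] \<tau>(2)[of j] ij by metis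
    have c: "zprod ts es \<in> carrier G" "zprod ts fs \<in> carrier G" "\<tau> i \<in> carrier G" "t \<in> carrier G"
      using ts Bc \<tau>(1)[of i] t by (auto simp: subset_iff)
    have "t [^] j \<otimes> inv (t [^] i) = zprod ts fs \<otimes> inv (zprod ts es)"
      unfolding ef using c by (simp add: inv_mult_group m_assoc)
    moreover have "t [^] j = t [^] (j - i) \<otimes> t [^] i" using ij c by (simp add: nat_pow_mult)
    ultimately have "t [^] (j - i) = zprod ts fs \<otimes> inv (zprod ts es)"
      using c by (simp add: m_assoc)
    moreover have "zprod ts fs \<in> int_span ts" "zprod ts es \<in> int_span ts" using ef by (simp_all add: int_spanI)
    ultimately have "t [^] (j - i) \<in> int_span ts"
      using subgroup.m_closed[OF int_span] subgroup.m_inv_closed[OF int_span] by simp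
    then show ?thesis using ij by (intro exI[of _ "j - i"]) simp
  qed
  then obtain m where m: "\<And>t. t \<in> T \<Longrightarrow> 0 < m t" "\<And>t. t \<in> T \<Longrightarrow> t [^] (m t :: nat) \<in> int_span ts" by metis
  define M where "M = (\<Prod>t\<in>T. m t)"
  have M0: "0 < M" unfolding M_def using m(1) by (simp add: prod_pos)
  have TM: "t [^] M \<in> int_span ts" if "t \<in> T" for t
  proof -
    have "m t dvd M" unfolding M_def using ts(3) that by (rule dvd_prodI)
    then obtain k where k: "M = m t * k" by blast
    have "(t [^] m t) [^] (int k) \<in> int_span ts" by (rule subgroup_int_pow_closed[OF int_span m(2)[OF that]])
    then show ?thesis using that ts(4) Bc unfolding k by (simp add: int_pow_int nat_pow_pow subset_iff)
  qed
  have BM: "\<exists>es. length es = length ts \<and> x [^] int M = zprod ts es" if xB: "x \<in> B" for x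
  proof -
    obtain es t where t: "t \<in> T" "length es = length ts" "x = zprod ts es \<otimes> t" using bspec[OF cov xB] by blast
    have z: "zprod ts es \<in> B" "t \<in> B" using zprod_closed_subgroup[OF sub ts(1)] t ts(4) by auto
    have "x [^] int M = zprod ts es [^] int M \<otimes> t [^] int M"
      unfolding t(3) by (rule int_pow_mult_distrib[OF com]) (use z Bc in auto)
    moreover have "zprod ts es [^] int M \<in> int_span ts"
      by (rule subgroup_int_pow_closed[OF int_span]) (use t in \<open>simp add: int_spanI\<close>)
    ultimately have "x [^] int M \<in> int_span ts" using TM[OF t(1)] subgroup.m_closed[OF int_span] by (simp add: int_pow_int)
    then show ?thesis by (rule int_spanE) blast
  qed
  then obtain c where c: "\<And>x. x \<in> B \<Longrightarrow> length (c x) = length ts \<and> x [^] int M = zprod ts (c x)" by metis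
  have uniq: "c x = es" if "x \<in> B" "length es = length ts" "x [^] int M = zprod ts es" for x es
    using independent_unique[OF B ts(1,2), of "c x" es] c[OF that(1)] that by simp
  define \<phi> where "\<phi> x i = (if i < length ts then c x ! i else 0)" for x i
  have "lattice G B (length ts) (int M) ts \<phi>"
  proof (unfold_locales)
    fix a b i assume ab: "a \<in> B" "b \<in> B"
    have "c (a \<otimes> b) = map2 (+) (c a) (c b)"
    proof (rule uniq)
      show "a \<otimes> b \<in> B" using ab subgroup.m_closed[OF sub] by blast
      show "(a \<otimes> b) [^] int M = zprod ts (map2 (+) (c a) (c b))"
        using zprod_add[OF B ts(1), of "c a" "c b"] c ab int_pow_mult_distrib[OF com[OF ab]] Bc by simp
    qed (use c ab in simp)
    then show "\<phi> (a \<otimes> b) i = \<phi> a i + \<phi> b i" using c ab by (simp add: \<phi>_def)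
  next
    fix j i assume ji: "j < length ts" "i < length ts"
    have "c (ts ! j) = (replicate (length ts) 0)[j := int M]"
      by (rule uniq) (use ji ts(1) zprod_unit[of ts j "int M"] Bc in \<open>auto simp: subset_iff\<close>)
    then show "\<phi> (ts ! j) i = (if i = j then int M else 0)" using ji by (simp add: \<phi>_def)
  next
    fix a assume a: "a \<in> B" "\<forall>i<length ts. \<phi> a i = 0"
    then have "c a = replicate (length ts) 0" using c[OF a(1)] by (intro nth_equalityI) (auto simp: \<phi>_def)
    then have "a [^] M = \<one>" using c[OF a(1)] zprod_zeros ts(1) Bc by (auto simp: int_pow_int subset_iff)
    then show "a = \<one>" using tf M0 Bc[OF a(1)] unfolding torsion_free_def by blast
  qed (use B ts M0 in auto)
  then show ?thesis by blast
qed

context lattice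
begin

lemma A_sub: "subgroup A G" and A_comm: "\<lbrakk>x \<in> A; y \<in> A\<rbrakk> \<Longrightarrow> x \<otimes> y = y \<otimes> x"
  using A by (auto simp: abelian_sub_def)

lemma A_carrier [simp]: "x \<in> A \<Longrightarrow> x \<in> carrier G"
  by (rule subgroup.mem_carrier[OF A_sub])

lemma A_one [simp]: "\<one> \<in> A"
  and A_mult [simp]: "\<lbrakk>x \<in> A; y \<in> A\<rbrakk> \<Longrightarrow> x \<otimes> y \<in> A"
  and A_inv [simp]: "x \<in> A \<Longrightarrow> inv x \<in> A"
  and A_pow [simp]: "x \<in> A \<Longrightarrow> x [^] (i::int) \<in> A"
  using A_sub subgroup.one_closed subgroup.m_closed subgroup.m_inv_closed subgroup_int_pow_closed by metis+

lemma A_pow_mult: "\<lbrakk>x \<in> A; y \<in> A\<rbrakk> \<Longrightarrow> (x \<otimes> y) [^] (i::int) = x [^] i \<otimes> y [^] i"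
  by (rule int_pow_mult_distrib[OF A_comm]) auto

lemma A_mult_swap:
  "\<lbrakk>a \<in> A; b \<in> A; c \<in> A; d \<in> A\<rbrakk> \<Longrightarrow> (a \<otimes> b) \<otimes> (c \<otimes> d) = (a \<otimes> c) \<otimes> (b \<otimes> d)"
  by (metis A_carrier A_comm A_mult m_assoc)

lemma \<phi>_one [simp]: "\<phi> \<one> i = 0"
  using \<phi>_mult[of \<one> \<one> i] by simp

lemma \<phi>_inv [simp]: "a \<in> A \<Longrightarrow> \<phi> (inv a) i = - \<phi> a i"
  using \<phi>_mult[of a "inv a" i] by simp

lemma \<phi>_pow [simp]: "a \<in> A \<Longrightarrow> \<phi> (a [^] k) i = k * \<phi> a i" for k :: int
proof -
  assume a: "a \<in> A"
  have nat: "\<phi> (a [^] int m) i = int m * \<phi> a i" for m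
    by (induction m) (use a in \<open>auto simp: int_pow_mult \<phi>_mult algebra_simps\<close>)
  show ?thesis
  proof (cases k rule: int_cases2)
    case (nonpos m)
    then show ?thesis using nat[of m] a by (simp add: int_pow_neg)
  qed (use nat in simp)
qed

lemma \<phi>_eqI: "\<lbrakk>a \<in> A; b \<in> A; \<And>i. i < n \<Longrightarrow> \<phi> a i = \<phi> b i\<rbrakk> \<Longrightarrow> a = b"
  using \<phi>_inj[of "a \<otimes> inv b"] by (simp add: \<phi>_mult) (metis A_carrier A_inv inv_equality inv_inv)

lemma \<phi>_zprod:
  assumes "set ts \<subseteq> A" "length es = length ts"
  shows "\<phi> (zprod ts es) i = (\<Sum>j<length ts. es ! j * \<phi> (ts ! j) i)"
  using assms
proof (induction ts es rule: zprod.induct)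
  case (1 t ts e es)
  then have "zprod ts es \<in> A" "t \<in> A" using zprod_closed_subgroup[OF A_sub] by auto
  then show ?case using 1 by (simp add: \<phi>_mult sum.lessThan_Suc_shift del: sum.lessThan_Suc)
qed auto

lemma \<phi>_zprod_bs:
  assumes "length es = n" "i < n"
  shows "\<phi> (zprod bs es) i = N * es ! i"
proof -
  have "\<phi> (zprod bs es) i = (\<Sum>j<n. es ! j * (if i = j then N else 0))"
    using \<phi>_zprod[of bs es i] bs assms \<phi>_bs by simp
  also have "\<dots> = (\<Sum>j<n. if i = j then es ! j * N else 0)" by (intro sum.cong) auto
  also have "\<dots> = N * es ! i" using assms by (simp add: mult.commute)
  finally show ?thesis .
qed

lemma zprod_bs_A [simp]: "zprod bs es \<in> A"
  using zprod_closed_subgroup[OF A_sub bs(1)] .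

lemma pow_N: "a \<in> A \<Longrightarrow> a [^] N = zprod bs (map (\<phi> a) [0..<n])"
  by (rule \<phi>_eqI) (simp_all add: \<phi>_zprod_bs)

lemma torsion_A: "\<lbrakk>a \<in> A; a [^] k = \<one>; k \<noteq> 0\<rbrakk> \<Longrightarrow> a = \<one>" for k :: int
  using \<phi>_inj[of a] \<phi>_pow[of a k] by simp

text \<open>This turns coordinate estimates into finite sets of letters and of offsets.\<close>

lemma finite_box: "finite {a \<in> A. \<forall>i<n. \<bar>\<phi> a i\<bar> \<le> R}"
proof (rule finite_imageD)
  show "finite ((\<lambda>a. map (\<phi> a) [0..<n]) ` {a \<in> A. \<forall>i<n. \<bar>\<phi> a i\<bar> \<le> R})"
    by (rule finite_subset[OF _ finite_lists_length_eq[of "{- R..R}" n]])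
      (auto simp: abs_le_iff minus_le_iff)
  show "inj_on (\<lambda>a. map (\<phi> a) [0..<n]) {a \<in> A. \<forall>i<n. \<bar>\<phi> a i\<bar> \<le> R}"
    by (rule inj_onI) (auto intro: \<phi>_eqI)
qed

definition endo :: "('a \<Rightarrow> 'a) \<Rightarrow> bool" where
  "endo f \<longleftrightarrow> (\<forall>a\<in>A. f a \<in> A) \<and> (\<forall>a\<in>A. \<forall>b\<in>A. f (a \<otimes> b) = f a \<otimes> f b)"

lemma endo_closed: "endo f \<Longrightarrow> a \<in> A \<Longrightarrow> f a \<in> A"
  and endo_mult: "\<lbrakk>endo f; a \<in> A; b \<in> A\<rbrakk> \<Longrightarrow> f (a \<otimes> b) = f a \<otimes> f b"
  by (auto simp: endo_def)

lemma endo_one: "endo f \<Longrightarrow> f \<one> = \<one>"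
  by (metis A_carrier A_one endo_closed endo_mult l_cancel_one' r_one)

lemma endo_inv: "endo f \<Longrightarrow> a \<in> A \<Longrightarrow> f (inv a) = inv (f a)"
  by (metis A_carrier A_inv endo_closed endo_mult endo_one inv_equality l_inv)

lemma endo_pow: "endo f \<Longrightarrow> a \<in> A \<Longrightarrow> f (a [^] k) = f a [^] k" for k :: int
proof -
  assume f: "endo f" and a: "a \<in> A"
  have nat: "f (a [^] int m) = f a [^] int m" for m
    by (induction m) (use f a in \<open>auto simp: int_pow_mult endo_mult endo_one endo_closed\<close>)
  show ?thesis
  proof (cases k rule: int_cases2)
    case (nonpos m)
    then show ?thesis using nat[of m] f a by (simp add: int_pow_neg endo_inv endo_closed)
  qed (use nat in simp)
qed

lemma endo_zprod:
  "endo f \<Longrightarrow> set ts \<subseteq> A \<Longrightarrow> f (zprod ts es) = zprod (map f ts) es"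
proof (induction ts es rule: zprod.induct)
  case (1 t ts e es)
  then have "zprod ts es \<in> A" "t \<in> A" using zprod_closed_subgroup[OF A_sub] by auto
  then show ?case using 1 by (simp add: endo_mult endo_pow)
qed (auto simp: endo_one)

text \<open>The factor \<open>N\<close> replaces \<open>a\<close> by \<open>a [^] N\<close>, which
  is a product of powers of \<open>bs\<close>; so \<open>f\<close> acts by an integer matrix divided
  by \<open>N\<close>.\<close>

lemma \<phi>_endo:
  assumes "endo f" "a \<in> A"
  shows "N * \<phi> (f a) i = (\<Sum>j<n. \<phi> a j * \<phi> (f (bs ! j)) i)"
proof -
  have "N * \<phi> (f a) i = \<phi> (f (a [^] N)) i" using assms by (simp add: endo_pow endo_closed)
  also have "f (a [^] N) = zprod (map f bs) (map (\<phi> a) [0..<n])"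
    using assms bs by (simp add: pow_N endo_zprod)
  also have "\<phi> \<dots> i = (\<Sum>j<n. \<phi> a j * \<phi> (f (bs ! j)) i)"
    using \<phi>_zprod[of "map f bs" "map (\<phi> a) [0..<n]" i] bs endo_closed[OF assms(1)] by (auto simp: subset_iff)
  finally show ?thesis .
qed

end

text \<open>Elimination without division: the pivot \<open>f k x\<close> removes the equation
  \<open>x\<close> together with the unknown \<open>k\<close>, and an equation whose coefficients
  all vanish is dropped.\<close>

lemma int_relation:
  fixes f :: "'j \<Rightarrow> 'x \<Rightarrow> int"
  assumes "finite X" "finite J" "card X < card J"
  shows "\<exists>c. (\<exists>j\<in>J. c j \<noteq> 0) \<and> (\<forall>x\<in>X. (\<Sum>j\<in>J. c j * f j x) = 0)"
  using assms
proof (induction X arbitrary: f J rule: finite_induct)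
  case empty
  then have "J \<noteq> {}" by auto
  then show ?case by (intro exI[of _ "\<lambda>_. 1"]) auto
next
  case (insert x X)
  show ?case
  proof (cases "\<forall>j\<in>J. f j x = 0")
    case True
    obtain c where "\<exists>j\<in>J. c j \<noteq> 0" "\<forall>y\<in>X. (\<Sum>j\<in>J. c j * f j y) = 0"
      using insert.IH[of J f] insert.prems insert.hyps by (metis Suc_lessD card_insert_disjoint)
    then show ?thesis using True by (intro exI[of _ c]) auto
  next
    case False
    then obtain k where k: "k \<in> J" "f k x \<noteq> 0" by blast
    let ?J = "J - {k}"
    obtain c where c: "\<exists>j\<in>?J. c j \<noteq> 0" "\<forall>y\<in>X. (\<Sum>j\<in>?J. c j * (f k x * f j y - f j x * f k y)) = 0"
    proof -
      have "finite ?J" "card X < card ?J" using insert.prems insert.hyps k by (auto simp: card_Diff_singleton)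
      from insert.IH[OF this, of "\<lambda>j y. f k x * f j y - f j x * f k y"] show thesis using that by blast
    qed
    \<comment> \<open>The reduced solution is scaled by the pivot, so that the equation
      \<open>x\<close> can be solved for the unknown \<open>k\<close> in integers.\<close>
    define d where "d j = (if j = k then - (\<Sum>j\<in>?J. c j * f j x) else f k x * c j)" for j
    have "(\<Sum>j\<in>J. d j * f j y) = (\<Sum>j\<in>?J. c j * (f k x * f j y - f j x * f k y))" for y
    proof -
      have "(\<Sum>j\<in>J. d j * f j y) = d k * f k y + (\<Sum>j\<in>?J. d j * f j y)"
        using insert k by (subst sum.remove[of J k]) auto
      also have "(\<Sum>j\<in>?J. d j * f j y) = (\<Sum>j\<in>?J. f k x * c j * f j y)"
        by (intro sum.cong) (auto simp: d_def)
      also have "d k * f k y = - (\<Sum>j\<in>?J. c j * f j x * f k y)" by (simp add: d_def sum_distrib_right)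
      finally show ?thesis by (simp add: algebra_simps sum_subtractf)
    qed
    moreover have "\<exists>j\<in>J. d j \<noteq> 0" using c(1) k by (auto simp: d_def)
    ultimately show ?thesis using c(2) by (intro exI[of _ d]) (auto simp: algebra_simps)
  qed
qed

section \<open>Crossed homomorphisms\<close>

locale acted_lattice = lattice +
  assumes normal: "\<lbrakk>g \<in> carrier G; a \<in> A\<rbrakk> \<Longrightarrow> g \<otimes> a \<otimes> inv g \<in> A"
    and commutator: "\<lbrakk>g \<in> carrier G; h \<in> carrier G\<rbrakk> \<Longrightarrow> g \<otimes> h \<otimes> inv g \<otimes> inv h \<in> A"
begin

definition conj_by :: "'a \<Rightarrow> 'a \<Rightarrow> 'a" where
  "conj_by g a = g \<otimes> a \<otimes> inv g"

lemma conj_by_carrier [simp]: "\<lbrakk>g \<in> carrier G; a \<in> carrier G\<rbrakk> \<Longrightarrow> conj_by g a \<in> carrier G"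
  by (simp add: conj_by_def)

lemma conj_by_A [simp]: "\<lbrakk>g \<in> carrier G; a \<in> A\<rbrakk> \<Longrightarrow> conj_by g a \<in> A"
  by (simp add: conj_by_def normal)

lemma conj_by_mult:
  "\<lbrakk>g \<in> carrier G; a \<in> carrier G; b \<in> carrier G\<rbrakk> \<Longrightarrow> conj_by g (a \<otimes> b) = conj_by g a \<otimes> conj_by g b"
  by (simp add: conj_by_def m_assoc)

lemma conj_by_inv: "\<lbrakk>g \<in> carrier G; a \<in> carrier G\<rbrakk> \<Longrightarrow> conj_by g (inv a) = inv (conj_by g a)"
  by (simp add: conj_by_def m_assoc inv_mult_group)

lemma conj_by_conj_by:
  "\<lbrakk>g \<in> carrier G; h \<in> carrier G; a \<in> carrier G\<rbrakk> \<Longrightarrow> conj_by g (conj_by h a) = conj_by (g \<otimes> h) a"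
  by (simp add: conj_by_def m_assoc inv_mult_group)

lemma conj_by_one [simp]: "g \<in> carrier G \<Longrightarrow> conj_by g \<one> = \<one>" "a \<in> carrier G \<Longrightarrow> conj_by \<one> a = a"
  by (simp_all add: conj_by_def)

lemma conj_by_trivial: "\<lbrakk>a \<in> A; b \<in> A\<rbrakk> \<Longrightarrow> conj_by a b = b"
  unfolding conj_by_def using A_comm[of a b] by (simp add: m_assoc)

lemma endo_conj_by: "g \<in> carrier G \<Longrightarrow> endo (conj_by g)"
  by (simp add: endo_def conj_by_mult)

lemma conj_by_pow: "\<lbrakk>g \<in> carrier G; a \<in> A\<rbrakk> \<Longrightarrow> conj_by g (a [^] k) = conj_by g a [^] k" for k :: int
  by (rule endo_pow[OF endo_conj_by])

definition crossed :: "('a \<Rightarrow> 'a) \<Rightarrow> bool" where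
  "crossed \<delta> \<longleftrightarrow> (\<forall>g\<in>carrier G. \<delta> g \<in> A) \<and>
     (\<forall>g\<in>carrier G. \<forall>h\<in>carrier G. \<delta> (g \<otimes> h) = \<delta> g \<otimes> conj_by g (\<delta> h))"

definition equivariant :: "('a \<Rightarrow> 'a) \<Rightarrow> bool" where
  "equivariant f \<longleftrightarrow> endo f \<and> (\<forall>g\<in>carrier G. \<forall>a\<in>A. f (conj_by g a) = conj_by g (f a))"

lemma crossed_A [simp]: "\<lbrakk>crossed \<delta>; g \<in> carrier G\<rbrakk> \<Longrightarrow> \<delta> g \<in> A"
  and crossed_mult: "\<lbrakk>crossed \<delta>; g \<in> carrier G; h \<in> carrier G\<rbrakk> \<Longrightarrow> \<delta> (g \<otimes> h) = \<delta> g \<otimes> conj_by g (\<delta> h)"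
  by (auto simp: crossed_def)

lemma crossed_one: "crossed \<delta> \<Longrightarrow> \<delta> \<one> = \<one>"
  using crossed_mult[of \<delta> \<one> \<one>] crossed_A[of \<delta> \<one>] by (simp add: l_cancel_one')

lemma crossed_inv:
  assumes "crossed \<delta>" "g \<in> carrier G"
  shows "\<delta> (inv g) = conj_by (inv g) (inv (\<delta> g))"
proof -
  have c: "\<delta> g \<in> carrier G" "\<delta> (inv g) \<in> carrier G" using assms by simp_all
  have "\<delta> (inv g) \<otimes> conj_by (inv g) (\<delta> g) = \<one>"
    using crossed_mult[OF assms(1), of "inv g" g] crossed_one[OF assms(1)] assms by simp
  from inv_equality[OF this] show ?thesis using assms c by (simp add: conj_by_inv)
qed

lemma equivariant_endo: "equivariant f \<Longrightarrow> endo f"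
  and equivariant_conj_by: "\<lbrakk>equivariant f; g \<in> carrier G; a \<in> A\<rbrakk> \<Longrightarrow> f (conj_by g a) = conj_by g (f a)"
  by (auto simp: equivariant_def)

lemma equivariant_A [simp]: "\<lbrakk>equivariant f; a \<in> A\<rbrakk> \<Longrightarrow> f a \<in> A"
  using endo_closed equivariant_endo by blast

text \<open>As \<open>A\<close> is abelian, \<open>\<delta> (g a g\<inverse>) = \<delta> g \<cdot> g (\<delta> a) \<cdot> g (\<delta> (g\<inverse>))\<close>, where the outer factors cancel.\<close>

lemma equivariant_crossed:
  assumes \<delta>: "crossed \<delta>"
  shows "equivariant \<delta>"
  unfolding equivariant_def endo_def
proof (intro conjI ballI)
  fix a b assume "a \<in> A" "b \<in> A"
  then show "\<delta> (a \<otimes> b) = \<delta> a \<otimes> \<delta> b" using \<delta> by (simp add: crossed_mult conj_by_trivial)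
next
  fix g a assume g: "g \<in> carrier G" and a: "a \<in> A"
  have "\<delta> (conj_by g a) = \<delta> g \<otimes> conj_by g (\<delta> a) \<otimes> conj_by g (conj_by a (\<delta> (inv g)))"
    unfolding conj_by_def[of g a] using \<delta> g a by (simp add: crossed_mult conj_by_conj_by)
  also have "\<dots> = \<delta> g \<otimes> conj_by g (\<delta> a) \<otimes> inv (\<delta> g)"
    using \<delta> g a by (simp add: conj_by_trivial crossed_inv conj_by_conj_by)
  also have "\<dots> = conj_by g (\<delta> a)"
    using A_comm[of "\<delta> g" "conj_by g (\<delta> a)"] \<delta> g a by (simp add: m_assoc)
  finally show "\<delta> (conj_by g a) = conj_by g (\<delta> a)" .
qed (use \<delta> in simp)

lemma crossed_comp: "\<lbrakk>crossed \<delta>; equivariant f\<rbrakk> \<Longrightarrow> crossed (\<lambda>g. f (\<delta> g))"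
  by (simp add: crossed_def endo_mult equivariant_endo equivariant_conj_by)

lemma crossed_times:
  assumes "crossed \<delta>" "crossed \<delta>'"
  shows "crossed (\<lambda>g. \<delta> g \<otimes> \<delta>' g)"
  unfolding crossed_def
  using assms by (auto simp: crossed_mult conj_by_mult A_mult_swap)

lemma crossed_trivial: "crossed (\<lambda>g. \<one>)"
  by (simp add: crossed_def)

lemma equivariant_id: "equivariant (\<lambda>a. a)"
  by (simp add: equivariant_def endo_def)

lemma equivariant_trivial: "equivariant (\<lambda>a. \<one>)"
  by (simp add: equivariant_def endo_def)

lemma equivariant_comp: "\<lbrakk>equivariant f; equivariant f'\<rbrakk> \<Longrightarrow> equivariant (\<lambda>a. f (f' a))"
  by (simp add: equivariant_def endo_def)

lemma equivariant_times: "\<lbrakk>equivariant f; equivariant f'\<rbrakk> \<Longrightarrow> equivariant (\<lambda>a. f a \<otimes> f' a)"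
  by (simp add: equivariant_def endo_def conj_by_mult A_mult_swap)

lemma equivariant_pow: "equivariant (\<lambda>a. a [^] (k::int))"
  by (simp add: equivariant_def endo_def A_pow_mult conj_by_pow)

section \<open>Commutator maps and their integer polynomials\<close>

definition comm :: "'a \<Rightarrow> 'a \<Rightarrow> 'a" where
  "comm t g = g \<otimes> t \<otimes> inv g \<otimes> inv t"

lemma crossed_comm: "t \<in> carrier G \<Longrightarrow> crossed (comm t)"
proof -
  assume t: "t \<in> carrier G"
  have A: "comm t g \<in> A" if "g \<in> carrier G" for g using commutator t that by (simp add: comm_def)
  have "comm t (g \<otimes> h) = comm t g \<otimes> conj_by g (comm t h)" if "g \<in> carrier G" "h \<in> carrier G" for g h
  proof -
    have "comm t (g \<otimes> h) = conj_by g (comm t h) \<otimes> comm t g"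
      using t that by (simp add: comm_def conj_by_def m_assoc inv_mult_group)
    also have "\<dots> = comm t g \<otimes> conj_by g (comm t h)" using A that by (intro A_comm) auto
    finally show ?thesis .
  qed
  then show ?thesis using A by (simp add: crossed_def)
qed

lemma equivariant_comm: "t \<in> carrier G \<Longrightarrow> equivariant (comm t)"
  using crossed_comm equivariant_crossed by blast

text \<open>On \<open>A\<close>, written additively, \<open>comm t\<close> is the operator
  \<open>1 - t\<close>.\<close>

lemma comm_alt: "\<lbrakk>t \<in> carrier G; a \<in> A\<rbrakk> \<Longrightarrow> comm t a = a \<otimes> conj_by t (inv a)"
  by (simp add: comm_def conj_by_def m_assoc)

lemma comm_equivariant:
  assumes "equivariant f" "t \<in> carrier G" "a \<in> A"
  shows "f (comm t a) = comm t (f a)"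
  using assms by (simp add: comm_alt endo_mult equivariant_endo equivariant_conj_by endo_inv)

lemma comm_equivariant_funpow:
  assumes "equivariant f" "t \<in> carrier G" "a \<in> A"
  shows "f ((comm t ^^ k) a) = (comm t ^^ k) (f a)" and "(comm t ^^ k) a \<in> A"
proof (induction k)
  case (Suc k)
  have "(comm t ^^ k) a \<in> A" using Suc by simp
  then show "f ((comm t ^^ Suc k) a) = (comm t ^^ Suc k) (f a)" "(comm t ^^ Suc k) a \<in> A"
    using Suc assms comm_equivariant[OF assms(1,2)] equivariant_comm[OF assms(2)] by simp_all
qed (use assms in auto)

text \<open>Additively this is \<open>p(u)\<close>, with the coefficients of \<open>p\<close> listed
  by increasing degree. The recursion exhibits \<open>p(u)\<close> as its constant term plus a
  polynomial applied after \<open>u\<close>.\<close>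

fun int_poly :: "('a \<Rightarrow> 'a) \<Rightarrow> int list \<Rightarrow> 'a \<Rightarrow> 'a" where
  "int_poly u [] a = \<one>"
| "int_poly u (c # cs) a = a [^] c \<otimes> int_poly u cs (u a)"

lemma equivariant_int_poly: "equivariant u \<Longrightarrow> equivariant (int_poly u cs)"
proof (induction cs)
  case Nil
  then show ?case using equivariant_trivial by simp
next
  case (Cons c cs)
  then show ?case using equivariant_times[OF equivariant_pow[of c] equivariant_comp[of "int_poly u cs" u]] by simp
qed

lemma \<phi>_int_poly:
  assumes "equivariant u" "a \<in> A"
  shows "\<phi> (int_poly u cs a) i = (\<Sum>j<length cs. cs ! j * \<phi> ((u ^^ j) a) i)"
  using assms(2)
proof (induction cs arbitrary: a)
  case (Cons c cs)
  have "u a \<in> A" "int_poly u cs (u a) \<in> A" using assms(1) Cons.prems equivariant_int_poly[of u cs] by simp_all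
  then show ?case using Cons assms(1)
    by (simp add: \<phi>_mult sum.lessThan_Suc_shift funpow_swap1 del: sum.lessThan_Suc)
qed simp

text \<open>Linear dependence of powers replaces Cayley-Hamilton. The vanishing low coefficients of
  the relation are moved into \<open>u ^^ k\<close>, which leaves a nonzero constant
  coefficient.\<close>

lemma int_poly_annihilates:
  assumes "equivariant u"
  shows "\<exists>k c cs. c \<noteq> 0 \<and> (\<forall>a\<in>A. int_poly u (c # cs) ((u ^^ k) a) = \<one>)"
proof -
  \<comment> \<open>One power more than there are matrix entries, each entry being one
    equation.\<close>
  let ?m = "Suc (n * n)"
  obtain c where c: "\<exists>j\<in>{..<?m}. c j \<noteq> 0"
    "\<forall>x\<in>{..<n} \<times> {..<n}. (\<Sum>j<?m. c j * (case x of (l, i) \<Rightarrow> \<phi> ((u ^^ j) (bs ! l)) i)) = 0"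
    using int_relation[of "{..<n} \<times> {..<n}" "{..<?m}" "\<lambda>j (l, i). \<phi> ((u ^^ j) (bs ! l)) i"] by auto
  let ?cs = "map c [0..<?m]"
  have e: "equivariant (int_poly u cs)" for cs using equivariant_int_poly[OF assms] .
  have bsA: "bs ! l \<in> A" if "l < n" for l using bs that nth_mem by blast
  have "\<phi> (int_poly u ?cs (bs ! l)) i = 0" if "l < n" "i < n" for l i
  proof -
    have "\<phi> (int_poly u ?cs (bs ! l)) i = (\<Sum>j<?m. c j * \<phi> ((u ^^ j) (bs ! l)) i)"
      unfolding \<phi>_int_poly[OF assms bsA[OF that(1)]] by (intro sum.cong) (auto simp del: upt_Suc)
    then show ?thesis using c(2) that by simp
  qed
  \<comment> \<open>Vanishing on \<open>bs\<close> suffices, since \<open>\<phi>_endo\<close>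
    determines an endomorphism by its values there.\<close>
  then have "N * \<phi> (int_poly u ?cs a) i = 0" if "a \<in> A" "i < n" for a i
    using \<phi>_endo[OF equivariant_endo[OF e], of a ?cs i] that by simp
  then have z: "int_poly u ?cs a = \<one>" if "a \<in> A" for a
    using \<phi>_inj[of "int_poly u ?cs a"] that e N by simp
  have strip: "\<exists>k c cs'. c \<noteq> 0 \<and> (\<forall>a\<in>A. int_poly u (c # cs') ((u ^^ k) a) = int_poly u cs a)" if "\<not> set cs \<subseteq> {0}" for cs
    using that
  proof (induction cs)
    case (Cons d cs)
    show ?case
    proof (cases "d = 0")
      case True
      then obtain k c cs' where IH: "c \<noteq> 0" "\<forall>a\<in>A. int_poly u (c # cs') ((u ^^ k) a) = int_poly u cs a"
        using Cons by auto
      have "int_poly u (c # cs') ((u ^^ Suc k) a) = int_poly u (d # cs) a" if "a \<in> A" for a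
      proof -
        have "u a \<in> A" using assms that by simp
        then have "int_poly u (c # cs') ((u ^^ k) (u a)) = int_poly u cs (u a)" using IH(2) by blast
        moreover have "int_poly u cs (u a) \<in> A" using \<open>u a \<in> A\<close> e by simp
        ultimately show ?thesis using True by (simp add: funpow_swap1)
      qed
      then show ?thesis using IH(1) by blast
    next
      case False
      then show ?thesis by (intro exI[of _ 0] exI[of _ d] exI[of _ cs]) simp
    qed
  qed simp
  have "\<not> set ?cs \<subseteq> {0}" using c(1) by (force simp del: upt_Suc)
  from strip[OF this] obtain k c' cs' where s: "c' \<noteq> 0" "\<forall>a\<in>A. int_poly u (c' # cs') ((u ^^ k) a) = int_poly u ?cs a"
    by (elim exE conjE)
  have "int_poly u (c' # cs') ((u ^^ k) a) = \<one>" if "a \<in> A" for a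
    using bspec[OF s(2) that] z[OF that] by (simp only:)
  then show ?thesis using s(1) by blast
qed

text \<open>The endomorphisms of the form \<open>c + \<delta>\<close> with \<open>c \<noteq> 0\<close> an integer and \<open>\<delta>\<close> the restriction of a
  crossed homomorphism are closed under composition.\<close>

definition scalar_plus_crossed :: "('a \<Rightarrow> 'a) \<Rightarrow> bool" where
  "scalar_plus_crossed q \<longleftrightarrow> equivariant q \<and> (\<exists>c \<delta>. c \<noteq> (0::int) \<and> crossed \<delta> \<and> (\<forall>a\<in>A. q a = a [^] c \<otimes> \<delta> a))"

lemma scalar_plus_crossed_comp:
  assumes "scalar_plus_crossed q" "scalar_plus_crossed q'"
  shows "scalar_plus_crossed (\<lambda>a. q (q' a))"
proof -
  obtain c \<delta> c' \<delta>' where c: "c \<noteq> (0::int)" "crossed \<delta>" "\<forall>a\<in>A. q a = a [^] c \<otimes> \<delta> a"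
    and c': "c' \<noteq> (0::int)" "crossed \<delta>'" "\<forall>a\<in>A. q' a = a [^] c' \<otimes> \<delta>' a"
    using assms unfolding scalar_plus_crossed_def by (elim exE conjE)
  have e: "equivariant q" "equivariant q'" using assms by (auto simp: scalar_plus_crossed_def)
  \<comment> \<open>Additively, \<open>q (c' + \<delta>') = c' (c + \<delta>) + q \<delta>' = c c' +
    (c' \<delta> + q \<delta>')\<close>, and the bracket is again crossed.\<close>
  let ?d = "\<lambda>g. \<delta> g [^] c' \<otimes> q (\<delta>' g)"
  have d: "crossed ?d"
    by (intro crossed_times crossed_comp[OF _ equivariant_pow] crossed_comp[OF _ e(1)] c c')
  have "q (q' a) = a [^] (c * c') \<otimes> ?d a" if a: "a \<in> A" for a
  proof -
    have A: "\<delta> a \<in> A" "\<delta>' a \<in> A" "q (\<delta>' a) \<in> A" using c c' a e by simp_all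
    have "q (q' a) = q a [^] c' \<otimes> q (\<delta>' a)"
      using c' a A e by (simp add: endo_mult endo_pow equivariant_endo)
    also have "q a [^] c' = a [^] (c * c') \<otimes> \<delta> a [^] c'"
      using c a A by (simp add: A_pow_mult int_pow_pow)
    finally show ?thesis using a A by (simp add: m_assoc)
  qed
  then show ?thesis
    unfolding scalar_plus_crossed_def using equivariant_comp[OF e] c(1) c'(1) d by (intro conjI exI[of _ "c * c'"] exI[of _ ?d]) auto
qed

lemma scalar_plus_crossed_id: "scalar_plus_crossed (\<lambda>a. a)"
  unfolding scalar_plus_crossed_def using equivariant_id crossed_trivial
  by (intro conjI exI[of _ 1] exI[of _ "\<lambda>g. \<one>"]) auto

text \<open>With \<open>u = comm t\<close>, separating the constant term gives
  \<open>q(u) = c + r(u) u\<close>. The last summand is the restriction of \<open>r(u)\<close>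
  composed with \<open>comm t\<close>, which is defined on all of \<open>G\<close>.\<close>

lemma scalar_plus_crossed_comm:
  assumes "t \<in> carrier G"
  shows "\<exists>q k. scalar_plus_crossed q \<and> (\<forall>a\<in>A. (comm t ^^ k) (q a) = \<one>)"
proof -
  obtain k c cs where c: "c \<noteq> 0" "\<forall>a\<in>A. int_poly (comm t) (c # cs) ((comm t ^^ k) a) = \<one>"
    using int_poly_annihilates[OF equivariant_comm[OF assms]] by (elim exE conjE)
  let ?q = "int_poly (comm t) (c # cs)"
  have e: "equivariant ?q" "equivariant (int_poly (comm t) cs)" using equivariant_int_poly[OF equivariant_comm[OF assms]] by blast+
  have cr: "crossed (\<lambda>g. int_poly (comm t) cs (comm t g))"
    by (rule crossed_comp[OF crossed_comm[OF assms] e(2)])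
  have "scalar_plus_crossed ?q"
    unfolding scalar_plus_crossed_def using e(1) c(1) cr
    by (intro conjI exI[of _ c] exI[of _ "\<lambda>g. int_poly (comm t) cs (comm t g)"]) auto
  moreover have "(comm t ^^ k) (?q a) = \<one>" if "a \<in> A" for a
    using comm_equivariant_funpow(1)[OF e(1) assms that, of k] bspec[OF c(2) that] by (simp only:)
  ultimately show ?thesis by blast
qed

text \<open>Composing with a further \<open>q'\<close> keeps what \<open>q\<close> achieves, because
  equivariant maps commute with every \<open>comm s\<close> on \<open>A\<close>.\<close>

lemma scalar_plus_crossed_comm_finite:
  assumes "finite X" "X \<subseteq> carrier G"
  shows "\<exists>q. scalar_plus_crossed q \<and> (\<forall>t\<in>X. \<exists>k. \<forall>a\<in>A. (comm t ^^ k) (q a) = \<one>)"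
  using assms
proof (induction X rule: finite_induct)
  case empty
  show ?case using scalar_plus_crossed_id by blast
next
  case (insert t X)
  then obtain q where q: "scalar_plus_crossed q" "\<forall>t\<in>X. \<exists>k. \<forall>a\<in>A. (comm t ^^ k) (q a) = \<one>" by auto
  have t: "t \<in> carrier G" using insert.prems by simp
  obtain q' k' where q': "scalar_plus_crossed q'" "\<forall>a\<in>A. (comm t ^^ k') (q' a) = \<one>"
    using scalar_plus_crossed_comm[OF t] by (elim exE conjE)
  have e: "equivariant q" "equivariant q'" using q(1) q'(1) by (auto simp: scalar_plus_crossed_def)
  have "\<exists>k. \<forall>a\<in>A. (comm s ^^ k) (q' (q a)) = \<one>" if s: "s \<in> insert t X" for s
  proof (cases "s = t")
    case True
    then show ?thesis using q'(2) e by (intro exI[of _ k']) simp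
  next
    case False
    then obtain k where k: "\<forall>a\<in>A. (comm s ^^ k) (q a) = \<one>" using q(2) s by blast
    have sc: "s \<in> carrier G" using s insert.prems by blast
    have "(comm s ^^ k) (q' (q a)) = \<one>" if "a \<in> A" for a
      using comm_equivariant_funpow(1)[OF e(2) sc, of "q a" k] bspec[OF k that] e that
      by (simp add: endo_one equivariant_endo)
    then show ?thesis by blast
  qed
  then show ?case using scalar_plus_crossed_comp[OF q'(1) q(1)] by blast
qed

text \<open>For one \<open>t\<close> at a time, \<open>b\<close> is replaced by its last nontrivial
  iterate under \<open>comm t\<close>. The iterate map is equivariant, so it preserves the
  conditions already obtained for the other elements.\<close>

lemma common_fixed_point:
  assumes "finite Y" "Y \<subseteq> X" "X \<subseteq> carrier G" "b \<in> A" "b \<noteq> \<one>" "\<forall>t\<in>X. \<exists>k. (comm t ^^ k) b = \<one>"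
  shows "\<exists>b\<in>A. b \<noteq> \<one> \<and> (\<forall>t\<in>X. \<exists>k. (comm t ^^ k) b = \<one>) \<and> (\<forall>t\<in>Y. comm t b = \<one>)"
  using assms(1,2)
proof (induction Y rule: finite_induct)
  case empty
  then show ?case using assms by blast
next
  case (insert t Y)
  then obtain b where b: "b \<in> A" "b \<noteq> \<one>" "\<forall>t\<in>X. \<exists>k. (comm t ^^ k) b = \<one>" "\<forall>t\<in>Y. comm t b = \<one>" by auto
  have t: "t \<in> carrier G" "t \<in> X" using insert.prems assms(3) by auto
  obtain k where "(comm t ^^ k) b = \<one>" using b(3) t(2) by blast
  define m where "m = (LEAST k. (comm t ^^ k) b = \<one>)"
  have m: "(comm t ^^ m) b = \<one>" unfolding m_def by (rule LeastI) fact
  then have "m \<noteq> 0" using b(2) by (metis funpow_0)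
  then obtain l where l: "m = Suc l" using not0_implies_Suc by blast
  let ?b = "(comm t ^^ l) b"
  have e: "equivariant (comm t ^^ l)"
  proof (induction l)
    case 0
    then show ?case using equivariant_id by (simp add: id_def)
  next
    case (Suc l)
    then show ?case using equivariant_comp[OF equivariant_comm[OF t(1)]] by (simp add: comp_def)
  qed
  have "?b \<noteq> \<one>" using not_less_Least[of l "\<lambda>k. (comm t ^^ k) b = \<one>"] l unfolding m_def by auto
  moreover have "?b \<in> A" using e b(1) by simp
  moreover have "\<exists>k. (comm s ^^ k) ?b = \<one>" if s: "s \<in> X" for s
  proof -
    have sc: "s \<in> carrier G" using s assms(3) by blast
    obtain j where "(comm s ^^ j) b = \<one>" using b(3) s by blast
    then have "(comm s ^^ j) ?b = \<one>"
      using comm_equivariant_funpow(1)[OF e sc b(1), of j] endo_one[OF equivariant_endo[OF e]] by simp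
    then show ?thesis by blast
  qed
  moreover have "comm s ?b = \<one>" if s: "s \<in> insert t Y" for s
  proof (cases "s = t")
    case True
    then show ?thesis using m l by simp
  next
    case False
    then have "s \<in> carrier G" "comm s b = \<one>" using s insert.prems assms(3) b(4) by auto
    then show ?thesis using comm_equivariant[OF e _ b(1), of s] endo_one[OF equivariant_endo[OF e]] by simp
  qed
  ultimately show ?case by blast
qed

lemma comm_one_iff: "\<lbrakk>t \<in> carrier G; a \<in> carrier G\<rbrakk> \<Longrightarrow> comm t a = \<one> \<longleftrightarrow> a \<otimes> t = t \<otimes> a"
proof -
  assume c: "t \<in> carrier G" "a \<in> carrier G"
  have "a \<otimes> t = comm t a \<otimes> (t \<otimes> a)" using c by (simp add: comm_def m_assoc)
  moreover have "comm t a \<in> carrier G" using c by (simp add: comm_def)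
  ultimately show ?thesis using c right_cancel[of "t \<otimes> a" "comm t a" \<one>] by auto
qed

lemma crossed_hom_exists:
  assumes X: "finite X" "X \<subseteq> carrier G" "carrier G \<subseteq> generate G X"
    and Z: "centre G \<inter> A = {\<one>}"
  shows "\<exists>M \<delta>. (0::int) < M \<and> crossed \<delta> \<and> (\<forall>a\<in>A. \<delta> a = a [^] M)"
proof -
  have fixed: "b = \<one>" if b: "b \<in> A" "\<forall>t\<in>X. comm t b = \<one>" for b
  proof -
    have "g \<otimes> b = b \<otimes> g" if "g \<in> generate G X" for g
      using that
    proof (induction rule: generate.induct)
      case (incl h)
      then show ?case using b comm_one_iff[of h b] X by auto
    next
      case (inv h)
      then have "h \<in> carrier G" "h [^] (-1::int) \<otimes> b = b \<otimes> h [^] (-1::int)"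
        using b comm_one_iff[of h b] X by (auto intro!: int_pow_commute)
      then show ?case by (simp add: int_pow_neg)
    next
      case (eng h1 h2)
      have "h1 \<in> carrier G" "h2 \<in> carrier G" using eng.hyps generate_in_carrier[OF X(2)] by auto
      then show ?case using eng.IH b by (metis A_carrier m_assoc)
    qed (use b in simp)
    then have "b \<in> centre G" using X(3) b by (auto simp: centre_def subset_iff)
    then show ?thesis using Z b by blast
  qed
  obtain q where q: "scalar_plus_crossed q" "\<forall>t\<in>X. \<exists>k. \<forall>a\<in>A. (comm t ^^ k) (q a) = \<one>"
    using scalar_plus_crossed_comm_finite[OF X(1,2)] by (elim exE conjE)
  have qA: "q a \<in> A" if "a \<in> A" for a using q(1) that by (simp add: scalar_plus_crossed_def)
  have "q a = \<one>" if a: "a \<in> A" for a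
  proof (rule ccontr)
    assume "q a \<noteq> \<one>"
    moreover have "\<forall>t\<in>X. \<exists>k. (comm t ^^ k) (q a) = \<one>" using q(2) a by blast
    ultimately obtain b where "b \<in> A" "b \<noteq> \<one>" "\<forall>t\<in>X. comm t b = \<one>"
      using common_fixed_point[OF X(1) order_refl X(2) qA[OF a]] by blast
    then show False using fixed by blast
  qed
  then obtain c \<delta> where c: "c \<noteq> (0::int)" "crossed \<delta>" "\<forall>a\<in>A. \<one> = a [^] c \<otimes> \<delta> a"
    using q(1) unfolding scalar_plus_crossed_def by metis
  have \<delta>: "\<delta> a = a [^] (- c)" if "a \<in> A" for a
  proof -
    have "inv (\<delta> a) = a [^] c" using bspec[OF c(3) that] c(2) that by (intro inv_equality) auto
    then have "inv (inv (\<delta> a)) = inv (a [^] c)" by (simp only:)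
    then show ?thesis using that c(2) by (simp add: int_pow_neg)
  qed
  show ?thesis
  proof (cases "c < 0")
    case True
    then show ?thesis using c \<delta> by (intro exI[of _ "- c"] exI[of _ \<delta>]) auto
  next
    case False
    \<comment> \<open>The sign of \<open>c\<close> is not known; composing with inversion makes the
      multiplier positive.\<close>
    have "crossed (\<lambda>g. \<delta> g [^] (-1::int))" by (rule crossed_comp[OF c(2) equivariant_pow])
    moreover have "\<delta> a [^] (-1::int) = a [^] c" if "a \<in> A" for a
      using \<delta>[OF that] that by (simp add: int_pow_pow)
    ultimately show ?thesis using False c(1) by (intro exI[of _ c] exI[of _ "\<lambda>g. \<delta> g [^] (-1::int)"]) auto
  qed
qed

end

section \<open>The virtual splitting\<close>

locale virtually_split = acted_lattice +
  fixes H :: "'a set" and ts :: "'a list" and T :: "'a set"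
  assumes H: "abelian_sub H" "H \<inter> A = {\<one>}"
    and ts: "set ts \<subseteq> H" "independent ts"
    and T: "finite T" "T \<subseteq> carrier G"
    and cover: "g \<in> carrier G \<Longrightarrow> \<exists>es a c. length es = length ts \<and> a \<in> A \<and> c \<in> T \<and> g = zprod ts es \<otimes> a \<otimes> c"

lemma (in acted_lattice) virtual_splitting:
  assumes pc: "polycyclic_seq G (carrier G)" and Z: "centre G \<inter> A = {\<one>}"
  shows "\<exists>H ts T. virtually_split G A n N bs \<phi> H ts T"
proof -
  obtain X where X: "finite X" "X \<subseteq> carrier G" "carrier G \<subseteq> generate G X"
    using polycyclic_finitely_gen[OF pc] by (elim exE conjE)
  obtain M \<delta> where M: "(0::int) < M" and \<delta>: "crossed \<delta>" "\<forall>a\<in>A. \<delta> a = a [^] M"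
    using crossed_hom_exists[OF X Z] by (elim exE conjE)
  define H where "H = {g \<in> carrier G. \<delta> g = \<one>}"
  have Hc: "h \<in> carrier G" if "h \<in> H" for h using that by (simp add: H_def)
  have H_sub: "subgroup H G"
  proof (rule subgroupI)
    show "H \<subseteq> carrier G" by (auto simp: H_def)
    show "H \<noteq> {}" using crossed_one[OF \<delta>(1)] by (auto simp: H_def)
  qed (use \<delta>(1) in \<open>auto simp: H_def crossed_inv crossed_mult\<close>)
  have HA: "H \<inter> A = {\<one>}"
  proof -
    have "a = \<one>" if "a \<in> H \<inter> A" for a
      using that torsion_A[of a M] M \<delta>(2) by (auto simp: H_def)
    then show ?thesis using subgroup.one_closed[OF H_sub] by auto
  qed
  have H_comm: "h \<otimes> k = k \<otimes> h" if hk: "h \<in> H" "k \<in> H" for h k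
  proof -
    have c: "h \<in> carrier G" "k \<in> carrier G" using hk Hc by auto
    have "h \<otimes> k \<otimes> inv h \<otimes> inv k \<in> H"
      using hk by (intro subgroup.m_closed[OF H_sub] subgroup.m_inv_closed[OF H_sub])
    then have "h \<otimes> k \<otimes> inv h \<otimes> inv k = \<one>" using HA commutator[OF c] by blast
    then have "comm k h = \<one>" by (simp add: comm_def)
    then show ?thesis using comm_one_iff[OF c(2,1)] by simp
  qed
  have H_ab: "abelian_sub H" unfolding abelian_sub_def using H_sub H_comm by blast
  obtain ts T0 where ts: "set ts \<subseteq> H" "independent ts" and T0: "finite T0" "T0 \<subseteq> H"
    and cov: "\<forall>x\<in>H. \<exists>es. \<exists>t\<in>T0. length es = length ts \<and> x = zprod ts es \<otimes> t"
  proof -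
    have "H \<inter> carrier G = H" using Hc by blast
    then show thesis
      using abelian_virtual_basis[OF pc H_ab] that by (simp only:) blast
  qed
  \<comment> \<open>Divisibility of the coordinates by \<open>N\<close> places an element in the
    span of \<open>bs\<close>; the additional factor \<open>M\<close> makes it an
    \<open>M\<close>-th power. Hence equal residues modulo \<open>M * N\<close> put two elements in
    the same left coset of the product of \<open>H\<close> and \<open>A\<close>.\<close>
  define r where "r g = map (\<lambda>i. \<phi> (\<delta> g) i mod (M * N)) [0..<n]" for g
  have "r ` carrier G \<subseteq> {xs. set xs \<subseteq> {0..<M * N} \<and> length xs = n}"
    using M N by (auto simp: r_def)
  then have fin: "finite (r ` carrier G)"
    by (rule finite_subset) (rule finite_lists_length_eq, simp)
  define rep where "rep = inv_into (carrier G) r"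
  have rep: "rep (r g) \<in> carrier G" "r (rep (r g)) = r g" if "g \<in> carrier G" for g
    using that unfolding rep_def by (auto simp: inv_into_into f_inv_into_f)
  have coset: "\<exists>h\<in>H. \<exists>b\<in>A. g = rep (r g) \<otimes> h \<otimes> b" if g: "g \<in> carrier G" for g
  proof -
    let ?c = "rep (r g)"
    have c: "?c \<in> carrier G" "r ?c = r g" using rep[OF g] by auto
    define e where "e = inv (\<delta> ?c) \<otimes> \<delta> g"
    have eA: "e \<in> A" using \<delta>(1) c g by (simp add: e_def)
    have "M * N dvd \<phi> e i" if "i < n" for i
    proof -
      have "r ?c ! i = r g ! i" using c(2) by simp
      then have "\<phi> (\<delta> ?c) i mod (M * N) = \<phi> (\<delta> g) i mod (M * N)" using that by (simp add: r_def)
      then have "M * N dvd \<phi> (\<delta> g) i - \<phi> (\<delta> ?c) i" by (metis mod_eq_dvd_iff)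
      then show ?thesis using \<delta>(1) c g by (simp add: e_def \<phi>_mult)
    qed
    then have z: "\<phi> e i = M * (N * (\<phi> e i div (M * N)))" if "i < n" for i
      using that by (metis dvd_mult_div_cancel mult.assoc)
    define b where "b = zprod bs (map (\<lambda>i. \<phi> e i div (M * N)) [0..<n])"
    have bA: "b \<in> A" by (simp add: b_def)
    have "e = b [^] M"
      by (rule \<phi>_eqI) (use eA bA z in \<open>simp_all add: b_def \<phi>_zprod_bs\<close>)
    define x where "x = inv ?c \<otimes> g"
    have xc: "x \<in> carrier G" using c g by (simp add: x_def)
    define b' where "b' = conj_by (inv ?c) b"
    have b'A: "b' \<in> A" using bA c by (simp add: b'_def)
    have "\<delta> x = conj_by (inv ?c) e"
      unfolding x_def e_def using \<delta>(1) c g by (simp add: crossed_mult crossed_inv conj_by_mult)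
    also have "\<dots> = b' [^] M" unfolding b'_def \<open>e = b [^] M\<close> using c bA by (simp add: conj_by_pow)
    finally have \<delta>x: "\<delta> x = b' [^] M" .
    \<comment> \<open>Conjugation by \<open>x\<close> sends \<open>\<delta> b1 = b1 [^] M\<close> to
      the inverse of \<open>\<delta> x\<close>, so \<open>x\<close> is corrected into the
      kernel.\<close>
    define b1 where "b1 = conj_by (inv x) (inv b')"
    have b1A: "b1 \<in> A" using b'A xc by (simp add: b1_def)
    have "conj_by x (\<delta> b1) = conj_by x (b1 [^] M)" using \<delta>(2) b1A by simp
    also have "\<dots> = inv b' [^] M" using xc b'A b1A unfolding b1_def by (simp add: conj_by_pow conj_by_conj_by)
    finally have "\<delta> (x \<otimes> b1) = b' [^] M \<otimes> inv b' [^] M"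
      using \<delta>(1) xc b1A \<delta>x by (simp add: crossed_mult)
    also have "\<dots> = \<one>" using b'A by (simp add: int_pow_inv)
    finally have "x \<otimes> b1 \<in> H" using xc b1A by (simp add: H_def)
    moreover have "g = ?c \<otimes> (x \<otimes> b1) \<otimes> inv b1" using c g b1A by (simp add: x_def m_assoc)
    ultimately show ?thesis using b1A A_inv by blast
  qed
  \<comment> \<open>The coset representatives found above stand on the left, those of the splitting
    on the right. They are therefore applied to \<open>inv g\<close>, and \<open>\<tau>\<close> is
    moved past the factor in \<open>A\<close> by conjugation.\<close>
  define T where "T = (\<lambda>(\<tau>, c). \<tau> \<otimes> inv c) ` (T0 \<times> rep ` r ` carrier G)"
  have "finite T" unfolding T_def using T0(1) fin by simp
  moreover have "T \<subseteq> carrier G" unfolding T_def using T0(2) Hc rep by (auto simp: subset_iff)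
  moreover have "\<exists>es a c. length es = length ts \<and> a \<in> A \<and> c \<in> T \<and> g = zprod ts es \<otimes> a \<otimes> c"
    if g: "g \<in> carrier G" for g
  proof -
    let ?c = "rep (r (inv g))"
    have c: "?c \<in> carrier G" using rep g by simp
    obtain h b where hb: "h \<in> H" "b \<in> A" "inv g = ?c \<otimes> h \<otimes> b" using coset[of "inv g"] g by auto
    have hc: "h \<in> carrier G" using hb Hc by simp
    obtain es \<tau> where \<tau>: "\<tau> \<in> T0" "length es = length ts" "inv h = zprod ts es \<otimes> \<tau>"
      using bspec[OF cov subgroup.m_inv_closed[OF H_sub hb(1)]] by blast
    have zc: "zprod ts es \<in> carrier G" "\<tau> \<in> carrier G" using zprod_closed_subgroup[OF H_sub ts(1)] Hc \<tau>(1) T0(2) by auto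
    have "g = inv (?c \<otimes> h \<otimes> b)" using hb(3) g by (metis inv_inv)
    also have "\<dots> = inv h \<otimes> conj_by h (inv b) \<otimes> inv ?c"
      using c hc hb(2) by (simp add: inv_mult_group m_assoc conj_by_def)
    also have "\<dots> = zprod ts es \<otimes> conj_by (\<tau> \<otimes> h) (inv b) \<otimes> (\<tau> \<otimes> inv ?c)"
      unfolding \<tau>(3) using c hc hb(2) zc by (simp add: conj_by_def m_assoc inv_mult_group)
    finally have "g = zprod ts es \<otimes> conj_by (\<tau> \<otimes> h) (inv b) \<otimes> (\<tau> \<otimes> inv ?c)" .
    moreover have "conj_by (\<tau> \<otimes> h) (inv b) \<in> A" using zc hc hb(2) by simp
    moreover have "\<tau> \<otimes> inv ?c \<in> T" unfolding T_def using \<tau>(1) g by force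
    ultimately show ?thesis using \<tau>(2) by blast
  qed
  ultimately have "virtually_split G A n N bs \<phi> H ts T"
    using H_ab HA ts by unfold_locales
  then show ?thesis by blast
qed

section \<open>The combing\<close>

context group
begin

text \<open>The leading letter \<open>\<one>\<close> keeps the block nonempty. Blocks for the
  exponents \<open>0\<close> and \<open>1\<close> have to travel together, and no warp takes an
  interval of length \<open>0\<close> onto one of positive length.\<close>

definition power_word :: "'a \<Rightarrow> int \<Rightarrow> 'a list" where
  "power_word t e = \<one> # replicate (nat \<bar>e\<bar>) (if 0 \<le> e then t else inv t)"

fun normal_word :: "'a list \<Rightarrow> int list \<Rightarrow> 'a list" where
  "normal_word (t # ts) (e # es) = power_word t e @ normal_word ts es"
| "normal_word _ _ = []"

lemma set_power_word [simp]: "t \<in> carrier G \<Longrightarrow> set (power_word t e) \<subseteq> carrier G"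
  by (auto simp: power_word_def)

lemma set_normal_word [simp]: "set ts \<subseteq> carrier G \<Longrightarrow> set (normal_word ts es) \<subseteq> carrier G"
  by (induction ts es rule: normal_word.induct) (auto simp: power_word_def)

text \<open>The truncated \<open>k - 1\<close> discounts the padding letter.\<close>

lemma val_take_power_word:
  assumes "t \<in> carrier G"
  shows "val (take k (power_word t e)) = t [^] (sgn e * int (min (k - 1) (nat \<bar>e\<bar>)))"
proof -
  let ?m = "min (k - 1) (nat \<bar>e\<bar>)"
  have "val (take k (power_word t e)) = (if 0 \<le> e then t else inv t) [^] ?m"
    using assms by (cases k) (auto simp: power_word_def min.commute val_replicate)
  also have "\<dots> = t [^] (sgn e * int ?m)"
    using assms by (auto simp: sgn_if int_pow_neg int_pow_inv simp flip: int_pow_int)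
  finally show ?thesis .
qed

lemma val_power_word [simp]: "t \<in> carrier G \<Longrightarrow> val (power_word t e) = t [^] e"
  using val_take_power_word[of t "length (power_word t e)" e] by (simp add: power_word_def abs_mult_sgn mult.commute)

lemma val_normal_word [simp]: "set ts \<subseteq> carrier G \<Longrightarrow> val (normal_word ts es) = zprod ts es"
  by (induction ts es rule: normal_word.induct) (auto simp: val_append)

text \<open>The reparametrisation is eliminated here: \<open>warp_block\<close> is proportional up
  to one letter of \<open>w\<close>, so it is enough to examine all pairs of positions whose
  relative parameters are that close.\<close>

lemma fellow_travel_linear:
  assumes "v \<noteq> []" "w \<noteq> []"
    and F: "\<And>x y. \<lbrakk>0 \<le> x; x \<le> real (length v); 0 \<le> y; y \<le> real (length w);
      \<bar>y / real (length w) - x / real (length v)\<bar> \<le> 1 / real (length w)\<rbrakk> \<Longrightarrow>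
        inv (vertex_at v x) \<otimes> d \<otimes> vertex_at w y \<in> F"
  shows "fellow_travel F d v w"
proof -
  obtain h :: "real \<Rightarrow> real" where h: "warp (length v) (length w) h"
    "\<And>t::real. 0 \<le> t \<Longrightarrow> t \<le> length v \<Longrightarrow> \<bar>h t / length w - t / length v\<bar> \<le> 1 / length v \<and>
      \<bar>h t / length w - t / length v\<bar> \<le> 1 / length w \<and> 0 \<le> h t \<and> h t \<le> length w"
  proof -
    have "0 < length v" "0 < length w" using assms(1,2) by simp_all
    from warp_block[OF this] show thesis using that by blast
  qed
  show ?thesis unfolding fellow_travel_def
    by (intro exI[of _ h] conjI h(1) allI impI F) (use h(2) in auto)
qed

text \<open>Rounding down and the padding letter together displace the exponent by at most
  \<open>2\<close>.\<close>

lemma power_word_position: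
  fixes x :: real
  assumes "0 \<le> x" "x \<le> nat \<bar>e\<bar> + 1"
  shows "\<bar>of_int (sgn e * int (min (nat \<lfloor>x\<rfloor> - 1) (nat \<bar>e\<bar>))) - x / (nat \<bar>e\<bar> + 1) * of_int e\<bar> \<le> 2"
proof -
  let ?m = "nat \<bar>e\<bar>" and ?q = "min (nat \<lfloor>x\<rfloor> - 1) (nat \<bar>e\<bar>)"
  have q: "real ?q \<le> x" "x - 2 \<le> real ?q" using assms by linarith+
  have "x / (?m + 1) * ?m = x - x / (?m + 1)" by (simp add: field_simps)
  moreover have "0 \<le> x / (?m + 1)" "x / (?m + 1) \<le> 1" using assms by auto
  ultimately have *: "\<bar>real ?q - x / (?m + 1) * ?m\<bar> \<le> 2" using q by linarith
  have e: "of_int e = of_int (sgn e) * real ?m" by (simp add: sgn_if)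
  have "of_int (sgn e * int ?q) - x / (?m + 1) * of_int e = of_int (sgn e) * (real ?q - x / (?m + 1) * ?m)"
    by (subst e) (simp add: algebra_simps)
  also have "\<bar>\<dots>\<bar> \<le> \<bar>real ?q - x / (?m + 1) * ?m\<bar>"
    by (simp add: abs_mult sgn_if)
  finally show ?thesis using * by linarith
qed

lemma commuting_powers:
  fixes p q :: int
  assumes "t \<in> carrier G" "d \<in> carrier G" "t \<otimes> d = d \<otimes> t"
  shows "inv (t [^] p) \<otimes> d \<otimes> t [^] q = d \<otimes> t [^] (q - p)"
proof -
  have "inv (t [^] p) \<otimes> d = d \<otimes> inv (t [^] p)"
    using int_pow_commute[OF assms(3,1,2), of "- p"] assms(1) by (simp add: int_pow_neg)
  then have "inv (t [^] p) \<otimes> d \<otimes> t [^] q = d \<otimes> (t [^] (- p) \<otimes> t [^] q)"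
    using assms(1,2) by (simp add: m_assoc int_pow_neg)
  also have "t [^] (- p) \<otimes> t [^] q = t [^] (q - p)" using assms(1) by (simp flip: int_pow_mult)
  finally show ?thesis .
qed

text \<open>The constant is \<open>E + 2 + 2 + 1\<close>: the difference of the exponents, one
  position error for each word, and the deviation of the parameters.\<close>

lemma fellow_travel_power_word:
  assumes "t \<in> carrier G" "d \<in> carrier G" "t \<otimes> d = d \<otimes> t" "\<bar>e' - e\<bar> \<le> E"
  shows "fellow_travel ((\<lambda>j. d \<otimes> t [^] j) ` {- (E + 5)..E + 5}) d (power_word t e) (power_word t e')"
proof (rule fellow_travel_linear)
  fix x y :: real
  let ?m = "nat \<bar>e\<bar>" and ?m' = "nat \<bar>e'\<bar>"
  assume "0 \<le> x" "x \<le> length (power_word t e)" "0 \<le> y" "y \<le> length (power_word t e')"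
    and xy: "\<bar>y / length (power_word t e') - x / length (power_word t e)\<bar> \<le> 1 / length (power_word t e')"
  then have b: "0 \<le> x" "x \<le> ?m + 1" "0 \<le> y" "y \<le> ?m' + 1" "\<bar>y / (?m' + 1) - x / (?m + 1)\<bar> \<le> 1 / (?m' + 1)"
    by (simp_all add: power_word_def add.commute)
  define p where "p = sgn e * int (min (nat \<lfloor>x\<rfloor> - 1) ?m)"
  define p' where "p' = sgn e' * int (min (nat \<lfloor>y\<rfloor> - 1) ?m')"
  define s where "s = x / (?m + 1)"
  define s' where "s' = y / (?m' + 1)"
  have 1: "\<bar>of_int p - s * of_int e\<bar> \<le> 2" "\<bar>of_int p' - s' * of_int e'\<bar> \<le> 2"
    unfolding p_def p'_def s_def s'_def using power_word_position b by auto
  have s: "0 \<le> s" "s \<le> 1" using b unfolding s_def by auto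
  have "\<bar>(s' - s) * of_int e'\<bar> \<le> 1 / (?m' + 1) * ?m'"
    unfolding abs_mult using b(5) unfolding s_def s'_def by (intro mult_mono) auto
  also have "\<dots> \<le> 1" by simp
  finally have 2: "\<bar>(s' - s) * of_int e'\<bar> \<le> 1" .
  have "\<bar>s * of_int (e' - e)\<bar> \<le> 1 * \<bar>of_int (e' - e)\<bar>" unfolding abs_mult using s by (intro mult_right_mono) auto
  also have "\<dots> \<le> of_int E"
    using assms(4) by (simp only: mult_1_left of_int_abs[symmetric] of_int_le_iff)
  finally have 3: "\<bar>s * of_int (e' - e)\<bar> \<le> of_int E" .
  have "of_int (p' - p) = (of_int p' - s' * of_int e') - (of_int p - s * of_int e) + (s' - s) * of_int e' + s * of_int (e' - e)"
    by (simp add: algebra_simps)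
  then have "\<bar>real_of_int (p' - p)\<bar> \<le> of_int (E + 5)" using 1 2 3 by (simp only: of_int_add)
  then have "p' - p \<in> {- (E + 5)..E + 5}" by (auto simp: abs_le_iff)
  moreover have "inv (vertex_at (power_word t e) x) \<otimes> d \<otimes> vertex_at (power_word t e') y = d \<otimes> t [^] (p' - p)"
  proof -
    note commuting_powers[OF assms(1-3), of p p']
    then show ?thesis unfolding val_take_power_word[OF assms(1)] p_def p'_def .
  qed
  ultimately show "inv (vertex_at (power_word t e) x) \<otimes> d \<otimes> vertex_at (power_word t e') y \<in> (\<lambda>j. d \<otimes> t [^] j) ` {- (E + 5)..E + 5}"
    by blast
qed (auto simp: power_word_def)

text \<open>The set \<open>D\<close> of starting offsets varies in the induction, since a block
  whose exponents differ by \<open>j\<close> multiplies the offset by \<open>t [^] j\<close>. As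
  \<open>H\<close> is abelian, only this bounded change occurs.\<close>

lemma fellow_travel_normal_word:
  assumes H: "abelian_sub H" and "set ts \<subseteq> H" "finite D" "D \<subseteq> H"
  shows "\<exists>F. finite F \<and> F \<subseteq> H \<and> (\<forall>d\<in>D. \<forall>es es'. length es = length ts \<longrightarrow>
    list_all2 (\<lambda>e e'. \<bar>e' - e\<bar> \<le> E) es es' \<longrightarrow> fellow_travel F d (normal_word ts es) (normal_word ts es'))"
  using assms(2-4)
proof (induction ts arbitrary: D)
  case Nil
  have "d \<in> carrier G" if "d \<in> D" for d
    using that Nil.prems(3) H unfolding abelian_sub_def using subgroup.subset by fastforce
  then show ?case using Nil.prems by (intro exI[of _ D]) (auto intro: fellow_travel_Nil)
next
  case (Cons t ts)
  have sub: "subgroup H G" and com: "\<And>x y. x \<in> H \<Longrightarrow> y \<in> H \<Longrightarrow> x \<otimes> y = y \<otimes> x"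
    using H by (auto simp: abelian_sub_def)
  have Hc: "\<And>x. x \<in> H \<Longrightarrow> x \<in> carrier G" by (rule subgroup.mem_carrier[OF sub])
  have tH: "t \<in> H" "set ts \<subseteq> H" using Cons.prems by simp_all
  have tsc: "set ts \<subseteq> carrier G" using tH Hc by blast
  define D' where "D' = (\<lambda>(d, j::int). d \<otimes> t [^] j) ` (D \<times> {- (E + 5)..E + 5})"
  have finD': "finite D'" unfolding D'_def using Cons.prems(2) by simp
  have D'H: "D' \<subseteq> H"
    unfolding D'_def using subgroup.m_closed[OF sub] subgroup_int_pow_closed[OF sub tH(1)] Cons.prems(3) by auto
  from Cons.IH[OF tH(2) finD' D'H] obtain F where F: "finite F" "F \<subseteq> H"
    "\<forall>d\<in>D'. \<forall>es es'. length es = length ts \<longrightarrow>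
      list_all2 (\<lambda>e e'. \<bar>e' - e\<bar> \<le> E) es es' \<longrightarrow> fellow_travel F d (normal_word ts es) (normal_word ts es')"
    by (elim exE conjE)
  have "fellow_travel (D' \<union> F) d (normal_word (t # ts) es) (normal_word (t # ts) es')"
    if d: "d \<in> D" and es: "length es = length (t # ts)" "list_all2 (\<lambda>e e'. \<bar>e' - e\<bar> \<le> E) es es'" for d es es'
  proof -
    obtain e fs where e: "es = e # fs" "length fs = length ts" using es(1) by (cases es) auto
    then obtain e' fs' where e': "es' = e' # fs'" "\<bar>e' - e\<bar> \<le> E" "list_all2 (\<lambda>e e'. \<bar>e' - e\<bar> \<le> E) fs fs'"
      using es(2) by (auto simp: list_all2_Cons1)
    have dH: "d \<in> H" using d Cons.prems(3) by blast
    have c: "t \<in> carrier G" "d \<in> carrier G" using tH dH Hc by auto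
    have "(\<lambda>j. d \<otimes> t [^] j) ` {- (E + 5)..E + 5} \<subseteq> D' \<union> F" unfolding D'_def using d by auto
    then have 1: "fellow_travel (D' \<union> F) d (power_word t e) (power_word t e')"
      using fellow_travel_mono[OF fellow_travel_power_word[OF c com[OF tH(1) dH] e'(2)]] by blast
    have "inv (t [^] e) \<otimes> d \<otimes> t [^] e' = d \<otimes> t [^] (e' - e)"
      by (rule commuting_powers[OF c com[OF tH(1) dH]])
    then have "inv (val (power_word t e)) \<otimes> d \<otimes> val (power_word t e') \<in> D'"
      unfolding D'_def using c d e'(2) by (auto intro!: image_eqI[of _ _ "(d, e' - e)"])
    then have "fellow_travel F (inv (val (power_word t e)) \<otimes> d \<otimes> val (power_word t e')) (normal_word ts fs) (normal_word ts fs')"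
      using F(3) e(2) e'(3) by blast
    then have 2: "fellow_travel (D' \<union> F) (inv (val (power_word t e)) \<otimes> d \<otimes> val (power_word t e')) (normal_word ts fs) (normal_word ts fs')"
      by (rule fellow_travel_mono) simp
    show ?thesis unfolding e(1) e'(1) normal_word.simps
      by (rule fellow_travel_append[OF 1 2]) (use c tsc in auto)
  qed
  then show ?case using F(1,2) finD' D'H by (intro exI[of _ "D' \<union> F"]) simp
qed

end

section \<open>Words in \<open>A\<close> that stay close to a straight line\<close>

lemma abs_diff_trans:
  fixes a b c :: real
  assumes "\<bar>a - b\<bar> \<le> C" "\<bar>d\<bar> \<le> C" "d = b - c"
  shows "\<bar>a - c\<bar> \<le> 2 * C"
  using assms by linarith

lemma abs_diff_four:
  fixes p q x y z C :: real
  assumes "\<bar>p - x\<bar> \<le> C" "\<bar>q - y\<bar> \<le> C" "x - y = z" "\<bar>z\<bar> \<le> 1"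
  shows "\<bar>p - q\<bar> \<le> 2 * C + 1"
  using assms by linarith

lemma floor_scale:
  fixes N y :: real
  assumes "0 < N"
  shows "\<bar>N * of_int \<lfloor>y / N\<rfloor> - y\<bar> \<le> N"
proof -
  have "\<bar>of_int \<lfloor>y / N\<rfloor> - y / N\<bar> \<le> 1" by linarith
  then have "N * \<bar>of_int \<lfloor>y / N\<rfloor> - y / N\<bar> \<le> N * 1" using assms by (intro mult_left_mono) auto
  moreover have "N * \<bar>of_int \<lfloor>y / N\<rfloor> - y / N\<bar> = \<bar>N * (of_int \<lfloor>y / N\<rfloor> - y / N)\<bar>"
    using assms by (simp add: abs_mult)
  moreover have "N * (of_int \<lfloor>y / N\<rfloor> - y / N) = N * of_int \<lfloor>y / N\<rfloor> - y"
    using assms by (simp add: right_diff_distrib)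
  ultimately show ?thesis by simp
qed

context acted_lattice
begin

text \<open>The bound by \<open>C * length w\<close> limits the speed, so a shift of the parameter
  by one letter moves the point on the line boundedly; the last condition keeps every prefix near
  the line.\<close>

definition straight :: "real \<Rightarrow> 'a list \<Rightarrow> bool" where
  "straight C w \<longleftrightarrow> 0 \<le> C \<and> w \<noteq> [] \<and> set w \<subseteq> A \<and>
     (\<forall>i<n. \<bar>of_int (\<phi> (val w) i)\<bar> \<le> C * real (length w)) \<and>
     (\<forall>k\<le>length w. \<forall>i<n.
        \<bar>of_int (\<phi> (val (take k w)) i) - real k / real (length w) * of_int (\<phi> (val w) i)\<bar> \<le> C)"

lemma val_A [simp]: "set w \<subseteq> A \<Longrightarrow> val w \<in> A"
  by (induction w) auto

lemma take_A: "set w \<subseteq> A \<Longrightarrow> set (take k w) \<subseteq> A"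
  using set_take_subset by fastforce

text \<open>One \<open>C\<close> is the deviation of the prefix; the other pays for rounding
  \<open>x\<close>, by the bound on the speed.\<close>

lemma straight_position:
  fixes x :: real
  assumes "straight C w" "0 \<le> x" "x \<le> real (length w)" "i < n"
  shows "\<bar>of_int (\<phi> (vertex_at w x) i) - x / real (length w) * of_int (\<phi> (val w) i)\<bar> \<le> 2 * C"
proof -
  let ?k = "nat \<lfloor>x\<rfloor>" and ?m = "real (length w)" and ?a = "of_int (\<phi> (val w) i) :: real"
  have m: "0 < ?m" using assms(1) by (simp add: straight_def)
  have k: "?k \<le> length w" using assms(2,3) by linarith
  have 1: "\<bar>of_int (\<phi> (val (take ?k w)) i) - real ?k / ?m * ?a\<bar> \<le> C"
    using assms(1,4) k unfolding straight_def by blast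
  have a: "\<bar>?a\<bar> \<le> C * ?m" using assms(1,4) unfolding straight_def by blast
  have "\<bar>real ?k - x\<bar> \<le> 1" using assms(2) by linarith
  then have "\<bar>(real ?k - x) / ?m\<bar> \<le> 1 / ?m" using m by (simp add: divide_right_mono)
  then have "\<bar>(real ?k - x) / ?m * ?a\<bar> \<le> 1 / ?m * (C * ?m)"
    unfolding abs_mult using a m by (intro mult_mono) auto
  also have "\<dots> = C" using m by simp
  finally have 2: "\<bar>(real ?k - x) / ?m * ?a\<bar> \<le> C" .
  have "(real ?k - x) / ?m * ?a = real ?k / ?m * ?a - x / ?m * ?a"
    by (simp add: left_diff_distrib diff_divide_distrib)
  with 1 2 show ?thesis by (rule abs_diff_trans)
qed

text \<open>The point \<open>s b\<close> exists only in the real span of the lattice, so the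
  Lipschitz estimate for the linear extension of \<open>f\<close> is expressed in
  coordinates.\<close>

lemma endo_lipschitz:
  assumes f: "endo f" and "0 \<le> P"
  shows "\<exists>R. \<forall>a\<in>A. \<forall>b\<in>A. \<forall>s::real. (\<forall>j<n. \<bar>of_int (\<phi> a j) - s * of_int (\<phi> b j)\<bar> \<le> P) \<longrightarrow>
    (\<forall>i<n. \<bar>of_int (\<phi> (f a) i) - s * of_int (\<phi> (f b) i)\<bar> \<le> R)"
proof -
  define \<mu> where "\<mu> i = (\<Sum>j<n. \<bar>real_of_int (\<phi> (f (bs ! j)) i)\<bar> * P)" for i
  have \<mu>0: "0 \<le> \<mu> i" for i unfolding \<mu>_def using assms(2) by (intro sum_nonneg) simp
  have "\<bar>of_int (\<phi> (f a) i) - s * of_int (\<phi> (f b) i)\<bar> \<le> (\<Sum>i<n. \<mu> i)"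
    if ab: "a \<in> A" "b \<in> A" and P: "\<forall>j<n. \<bar>of_int (\<phi> a j) - s * of_int (\<phi> b j)\<bar> \<le> P" and i: "i < n" for a b i and s :: real
  proof -
    have N1: "1 \<le> real_of_int N" using N by simp
    have e: "real_of_int N * of_int (\<phi> (f c) i) = (\<Sum>j<n. of_int (\<phi> c j) * of_int (\<phi> (f (bs ! j)) i))" if "c \<in> A" for c
      using arg_cong[OF \<phi>_endo[OF f that, of i], of real_of_int] by simp
    have "real_of_int N * (of_int (\<phi> (f a) i) - s * of_int (\<phi> (f b) i)) =
      real_of_int N * of_int (\<phi> (f a) i) - s * (real_of_int N * of_int (\<phi> (f b) i))" by (simp add: algebra_simps)
    also have "\<dots> = (\<Sum>j<n. of_int (\<phi> (f (bs ! j)) i) * (of_int (\<phi> a j) - s * of_int (\<phi> b j)))"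
      unfolding e[OF ab(1)] e[OF ab(2)] by (simp add: sum_distrib_left sum_subtractf algebra_simps)
    also have "\<bar>\<dots>\<bar> \<le> (\<Sum>j<n. \<bar>of_int (\<phi> (f (bs ! j)) i) * (of_int (\<phi> a j) - s * of_int (\<phi> b j))\<bar>)"
      by (rule sum_abs)
    also have "\<dots> \<le> \<mu> i" unfolding \<mu>_def abs_mult using P by (intro sum_mono mult_left_mono) auto
    finally have "real_of_int N * \<bar>of_int (\<phi> (f a) i) - s * of_int (\<phi> (f b) i)\<bar> \<le> \<mu> i"
      using N1 by (simp add: abs_mult)
    moreover have "1 * \<bar>of_int (\<phi> (f a) i) - s * of_int (\<phi> (f b) i)\<bar> \<le> real_of_int N * \<bar>of_int (\<phi> (f a) i) - s * of_int (\<phi> (f b) i)\<bar>"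
      using N1 by (intro mult_right_mono) auto
    moreover have "\<mu> i \<le> (\<Sum>i<n. \<mu> i)" using \<mu>0 i by (intro member_le_sum) auto
    ultimately show ?thesis by (simp only: mult_1_left)
  qed
  then show ?thesis by (intro exI[of _ "\<Sum>i<n. \<mu> i"]) blast
qed

text \<open>For positions \<open>p\<close>, \<open>p'\<close> the offset is
  \<open>h \<otimes> conj_by (inv h) (inv p) \<otimes> p'\<close>. It thus suffices to compare
  \<open>p'\<close> with the image of \<open>p\<close>: these lie near lines whose end points differ
  by \<open>a0\<close>.\<close>

lemma fellow_travel_straight:
  assumes h: "h \<in> carrier G" and a0: "a0 \<in> A" and C: "0 \<le> C"
  shows "\<exists>F. finite F \<and> F \<subseteq> carrier G \<and> (\<forall>w w'. straight C w \<longrightarrow> straight C w' \<longrightarrow>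
    val w' = conj_by (inv h) (val w) \<otimes> a0 \<longrightarrow> fellow_travel F h w w')"
proof -
  let ?f = "conj_by (inv h)"
  have f: "endo ?f" using h by (simp add: endo_conj_by)
  obtain P where P: "\<forall>a\<in>A. \<forall>b\<in>A. \<forall>s::real. (\<forall>j<n. \<bar>of_int (\<phi> a j) - s * of_int (\<phi> b j)\<bar> \<le> 2 * C) \<longrightarrow>
    (\<forall>i<n. \<bar>of_int (\<phi> (?f a) i) - s * of_int (\<phi> (?f b) i)\<bar> \<le> P)"
    using endo_lipschitz[OF f, of "2 * C"] C by auto
  \<comment> \<open>Here \<open>2 * C\<close> bounds the error of \<open>p'\<close>, another
    \<open>C\<close> the mismatch of the parameters, \<open>P\<close> the error of the image of
    \<open>p\<close>, and the sum the shift by \<open>a0\<close>.\<close>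
  define R where "R = 3 * C + P + (\<Sum>i<n. \<bar>real_of_int (\<phi> a0 i)\<bar>)"
  define F where "F = (\<lambda>b. h \<otimes> b) ` {b \<in> A. \<forall>i<n. \<bar>\<phi> b i\<bar> \<le> \<lfloor>R\<rfloor>}"
  have "fellow_travel F h w w'" if w: "straight C w" "straight C w'" and e: "val w' = ?f (val w) \<otimes> a0" for w w'
  proof (rule fellow_travel_linear)
    fix x y :: real
    assume x: "0 \<le> x" "x \<le> real (length w)" and y: "0 \<le> y" "y \<le> real (length w')"
      and xy: "\<bar>y / real (length w') - x / real (length w)\<bar> \<le> 1 / real (length w')"
    define p where "p = vertex_at w x"
    define p' where "p' = vertex_at w' y"
    define s where "s = x / real (length w)"
    define s' where "s' = y / real (length w')"
    have m: "0 < real (length w')" "0 < real (length w)" using w by (auto simp: straight_def)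
    have wA: "set w \<subseteq> A" "set w' \<subseteq> A" using w by (auto simp: straight_def)
    have A: "p \<in> A" "p' \<in> A" "val w \<in> A" "val w' \<in> A" using wA take_A by (auto simp: p_def p'_def)
    define b where "b = ?f (inv p) \<otimes> p'"
    have bA: "b \<in> A" unfolding b_def using A h by simp
    have "\<bar>\<phi> b i\<bar> \<le> \<lfloor>R\<rfloor>" if i: "i < n" for i
    proof -
      have 1: "\<bar>of_int (\<phi> (?f p) i) - s * of_int (\<phi> (?f (val w)) i)\<bar> \<le> P"
        using P A(1,3) straight_position[OF w(1) x] i unfolding p_def s_def by blast
      have 2: "\<bar>of_int (\<phi> p' i) - s' * of_int (\<phi> (val w') i)\<bar> \<le> 2 * C"
        using straight_position[OF w(2) y i] unfolding p'_def s'_def .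
      have "\<bar>(s' - s) * of_int (\<phi> (val w') i)\<bar> \<le> 1 / real (length w') * (C * real (length w'))"
        unfolding abs_mult using xy w(2) i unfolding s_def s'_def straight_def by (intro mult_mono) auto
      then have 3: "\<bar>(s' - s) * of_int (\<phi> (val w') i)\<bar> \<le> C" using m by simp
      have s: "0 \<le> s" "s \<le> 1" using x m unfolding s_def by auto
      have "\<bar>s * of_int (\<phi> a0 i)\<bar> \<le> 1 * \<bar>real_of_int (\<phi> a0 i)\<bar>"
        unfolding abs_mult using s by (intro mult_right_mono) auto
      also have "\<dots> \<le> (\<Sum>i<n. \<bar>real_of_int (\<phi> a0 i)\<bar>)" unfolding mult_1_left using i by (intro member_le_sum) auto
      finally have 4: "\<bar>s * of_int (\<phi> a0 i)\<bar> \<le> (\<Sum>i<n. \<bar>real_of_int (\<phi> a0 i)\<bar>)" .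
      have "\<phi> b i = \<phi> p' i - \<phi> (?f p) i" unfolding b_def using A h f by (simp add: \<phi>_mult endo_inv)
      moreover have "\<phi> (val w') i = \<phi> (?f (val w)) i + \<phi> a0 i" unfolding e using A h a0 by (simp add: \<phi>_mult)
      ultimately have "real_of_int (\<phi> b i) = (of_int (\<phi> p' i) - s' * of_int (\<phi> (val w') i))
        - (of_int (\<phi> (?f p) i) - s * of_int (\<phi> (?f (val w)) i)) + (s' - s) * of_int (\<phi> (val w') i) + s * of_int (\<phi> a0 i)"
        by (simp add: algebra_simps)
      then have "\<bar>real_of_int (\<phi> b i)\<bar> \<le> R" using 1 2 3 4 unfolding R_def by linarith
      then show ?thesis by (simp add: le_floor_iff)
    qed
    then have "h \<otimes> b \<in> F" unfolding F_def using bA by blast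
    moreover have "h \<otimes> b = inv p \<otimes> h \<otimes> p'" unfolding b_def conj_by_def using A h by (simp add: m_assoc)
    ultimately show "inv (vertex_at w x) \<otimes> h \<otimes> vertex_at w' y \<in> F"
      unfolding p_def p'_def by simp
  qed (use w in \<open>auto simp: straight_def\<close>)
  moreover have "finite F" unfolding F_def using finite_box by simp
  moreover have "F \<subseteq> carrier G" unfolding F_def using h by auto
  ultimately show ?thesis by blast
qed

text \<open>Points on the line are rounded down to multiples of \<open>N\<close>, which are
  coordinates of elements of the span of \<open>bs\<close>. The final point is \<open>a\<close>
  itself, which may lie outside that span.\<close>

definition grid_point :: "nat \<Rightarrow> 'a \<Rightarrow> nat \<Rightarrow> 'a" where
  "grid_point m a k = (if k < m then zprod bs (map (\<lambda>i. \<lfloor>real k / real m * of_int (\<phi> a i) / of_int N\<rfloor>) [0..<n]) else a)"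

lemma grid_point_A [simp]: "a \<in> A \<Longrightarrow> grid_point m a k \<in> A"
  by (simp add: grid_point_def)

lemma \<phi>_grid_point:
  assumes "i < n" "k \<le> m" "0 < m"
  shows "\<bar>of_int (\<phi> (grid_point m a k) i) - real k / real m * of_int (\<phi> a i)\<bar> \<le> of_int N"
proof (cases "k < m")
  case True
  let ?y = "real k / real m * of_int (\<phi> a i)"
  have "real_of_int (\<phi> (grid_point m a k) i) = of_int N * of_int \<lfloor>?y / of_int N\<rfloor>"
    using True assms by (simp add: grid_point_def \<phi>_zprod_bs)
  then show ?thesis using floor_scale[of "of_int N" ?y] N by simp
next
  case False
  then show ?thesis using assms N by (simp add: grid_point_def)
qed

lemma straight_exists:
  assumes "a \<in> A"
  shows "\<exists>w. straight N w \<and> (\<forall>x\<in>set w. \<forall>i<n. \<bar>\<phi> x i\<bar> \<le> 2 * N + 1) \<and> val w = a"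
proof -
  \<comment> \<open>With this many steps no coordinate of the line advances by more than
    \<open>1\<close> per step, so the successive differences come from a fixed box;
    \<open>Suc\<close> covers \<open>a = \<one>\<close>.\<close>
  define m where "m = Suc (nat (\<Sum>i<n. \<bar>\<phi> a i\<bar>))"
  have \<phi>m: "\<bar>real_of_int (\<phi> a i)\<bar> \<le> real m" if "i < n" for i
  proof -
    have "\<bar>\<phi> a i\<bar> \<le> (\<Sum>i<n. \<bar>\<phi> a i\<bar>)" using that by (intro member_le_sum) auto
    then have "\<bar>\<phi> a i\<bar> \<le> int m" unfolding m_def by linarith
    then show ?thesis by linarith
  qed
  let ?p = "grid_point m a"
  define w where "w = map (\<lambda>k. inv (?p k) \<otimes> ?p (Suc k)) [0..<m]"
  have len: "length w = m" by (simp add: w_def)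
  have p0: "?p 0 = \<one>"
  proof (rule \<phi>_eqI)
    fix i assume "i < n"
    then show "\<phi> (?p 0) i = \<phi> \<one> i" by (simp add: grid_point_def m_def \<phi>_zprod_bs)
  qed (use assms in simp_all)
  have wA: "set w \<subseteq> A" unfolding w_def using assms by auto
  have val: "val (take k w) = ?p k" if "k \<le> m" for k
    using that
  proof (induction k)
    case (Suc k)
    have "take (Suc k) w = take k w @ [inv (?p k) \<otimes> ?p (Suc k)]"
      using Suc.prems len by (simp add: take_Suc_conv_app_nth w_def)
    then show ?case using Suc assms wA take_A[OF wA, of k]
      by (subst \<open>take (Suc k) w = _\<close>, subst val_append) (auto simp: subset_iff)
  qed (use p0 in simp)
  have vw: "val w = a" using val[of m] len by (simp add: grid_point_def)
  have m0: "0 < m" by (simp add: m_def)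
  have N1: "1 \<le> real_of_int N" using N by simp
  have "straight N w"
    unfolding straight_def
  proof (intro conjI allI impI)
    show "0 \<le> real_of_int N" using N by simp
    show "w \<noteq> []" using len m0 by auto
    show "\<bar>of_int (\<phi> (val w) i)\<bar> \<le> real_of_int N * real (length w)" if "i < n" for i
    proof -
      have "1 * real m \<le> real_of_int N * real m" using N1 by (intro mult_right_mono) auto
      then show ?thesis using \<phi>m[OF that] unfolding vw len by linarith
    qed
    show "\<bar>of_int (\<phi> (val (take k w)) i) - real k / real (length w) * of_int (\<phi> (val w) i)\<bar> \<le> of_int N"
      if "k \<le> length w" "i < n" for k i
      using \<phi>_grid_point[OF that(2), of k m a] that(1) val[of k] m0 unfolding vw len by simp
  qed (rule wA)
  moreover have "\<bar>\<phi> x i\<bar> \<le> 2 * N + 1" if xi: "x \<in> set w" "i < n" for x i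
  proof -
    obtain k where k: "k < m" "x = inv (?p k) \<otimes> ?p (Suc k)" using xi(1) by (auto simp: w_def)
    have e: "\<phi> x i = \<phi> (?p (Suc k)) i - \<phi> (?p k) i" unfolding k(2) using assms by (simp add: \<phi>_mult)
    have 1: "\<bar>of_int (\<phi> (?p (Suc k)) i) - real (Suc k) / real m * of_int (\<phi> a i)\<bar> \<le> of_int N"
      "\<bar>of_int (\<phi> (?p k) i) - real k / real m * of_int (\<phi> a i)\<bar> \<le> of_int N"
      using \<phi>_grid_point[OF xi(2), of "Suc k" m a] \<phi>_grid_point[OF xi(2), of k m a] k(1) by simp_all
    have 2: "real (Suc k) / real m * of_int (\<phi> a i) - real k / real m * of_int (\<phi> a i) = of_int (\<phi> a i) / real m"
      by (simp add: distrib_right add_divide_distrib)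
    have "\<bar>of_int (\<phi> a i) / real m\<bar> \<le> 1" using \<phi>m[OF xi(2)] m0 by simp
    from abs_diff_four[OF 1 2 this] have "\<bar>real_of_int (\<phi> x i)\<bar> \<le> 2 * of_int N + 1" unfolding e by simp
    then show ?thesis by linarith
  qed
  ultimately show ?thesis using vw by blast
qed

end

section \<open>The normal forms of the group elements and their fellow travelling\<close>

context virtually_split
begin

definition comb :: "'a list set \<Rightarrow> 'a list set" where
  "comb W = {normal_word ts es @ w @ [c] | es w c. length es = length ts \<and> w \<in> W \<and> c \<in> T}"

lemma H_sub: "subgroup H G" and H_comm: "\<lbrakk>x \<in> H; y \<in> H\<rbrakk> \<Longrightarrow> x \<otimes> y = y \<otimes> x"
  using H by (auto simp: abelian_sub_def)

lemma H_carrier [simp]: "x \<in> H \<Longrightarrow> x \<in> carrier G"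
  by (rule subgroup.mem_carrier[OF H_sub])

lemma ts_carrier [simp]: "set ts \<subseteq> carrier G"
  using ts(1) by auto

lemma zprod_ts_H [simp]: "zprod ts es \<in> H"
  using zprod_closed_subgroup[OF H_sub ts(1)] .

lemma decomposition_unique:
  assumes "length es = length ts" "length fs = length ts" "a \<in> A" "b \<in> A"
    "zprod ts es \<otimes> a = zprod ts fs \<otimes> b"
  shows "es = fs \<and> a = b"
proof -
  let ?x = "zprod ts es" and ?y = "zprod ts fs"
  have c: "?x \<in> carrier G" "?y \<in> carrier G" by simp_all
  have "inv ?y \<otimes> ?x = inv ?y \<otimes> (?x \<otimes> a) \<otimes> inv a" using c assms(3) by (simp add: m_assoc)
  also have "\<dots> = b \<otimes> inv a" unfolding assms(5) using c assms(3,4) by simp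
  finally have e: "inv ?y \<otimes> ?x = b \<otimes> inv a" .
  have "inv ?y \<otimes> ?x \<in> H" by (intro subgroup.m_closed[OF H_sub] subgroup.m_inv_closed[OF H_sub]) simp_all
  moreover have "inv ?y \<otimes> ?x \<in> A" unfolding e using assms by simp
  ultimately have 1: "inv ?y \<otimes> ?x = \<one>" using H(2) by blast
  then have "?x = ?y" using c by (metis inv_closed inv_equality inv_inv)
  moreover have "a = b" using e[unfolded 1] assms(3,4) by (metis A_carrier inv_closed inv_equality inv_inv)
  ultimately show ?thesis
    using independent_unique[OF H(1) ts assms(1,2)] by simp
qed

text \<open>If \<open>h' a' c' = h a c x\<close>, then \<open>h' a' = h a d\<close> with
  \<open>d = c x (inv c')\<close> from a finite set. Writing \<open>d = h0 a0\<close>, where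
  \<open>h0 = inv h h'\<close>, gives \<open>a' = (inv h0 a h0) a0\<close>. The three blocks can
  then be compared one after the other, with starting offsets \<open>\<one>\<close>,
  \<open>h0\<close> and \<open>d\<close>.\<close>

theorem comb_async_combing:
  assumes SA: "finite SA" "SA \<subseteq> A" and W: "W \<subseteq> lists SA" "\<And>w. w \<in> W \<Longrightarrow> straight C w"
    "\<And>a. a \<in> A \<Longrightarrow> \<exists>w\<in>W. val w = a"
  shows "\<exists>S. generating_set G S \<and> async_combing G S (comb W)"
proof -
  \<comment> \<open>The letter \<open>\<one>\<close> is the padding of the power words, and
    \<open>T\<close> provides the last letters.\<close>
  define B where "B = insert \<one> (set ts \<union> SA \<union> T)"
  define S where "S = B \<union> (\<lambda>x. inv x) ` B"
  have B: "finite B" "B \<subseteq> carrier G" unfolding B_def using SA T by auto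
  have Sc: "S \<subseteq> carrier G" unfolding S_def using B(2) by auto
  have Sfin: "finite S" unfolding S_def using B(1) by simp
  have WA: "set w \<subseteq> A" "set w \<subseteq> SA" if "w \<in> W" for w using that W(1) SA(2) by auto
  have zwsS: "set (normal_word us es) \<subseteq> S" if "set us \<subseteq> set ts" for us es
    using that by (induction us es rule: normal_word.induct) (auto simp: power_word_def S_def B_def)
  have combS: "u \<in> lists S" if uW: "u \<in> comb W" for u
  proof -
    obtain es w c where u: "u = normal_word ts es @ w @ [c]" "w \<in> W" "c \<in> T" using uW unfolding comb_def by blast
    have "set w \<subseteq> S" "c \<in> S" using WA(2)[OF u(2)] u(3) by (auto simp: S_def B_def)
    then have "set u \<subseteq> S" using zwsS[of ts es] unfolding u(1) by auto
    then show ?thesis by auto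
  qed
  have val_comb: "val (normal_word ts es @ w @ [c]) = zprod ts es \<otimes> val w \<otimes> c" if "w \<in> W" "c \<in> T" for es w c
  proof -
    have "set w \<subseteq> carrier G" "c \<in> carrier G" using WA[OF that(1)] T(2) that(2) A_carrier by blast+
    then show ?thesis by (simp add: val_append m_assoc)
  qed
  have cov: "\<exists>w \<in> comb W. val w = g" if g: "g \<in> carrier G" for g
  proof -
    obtain es a c where g: "length es = length ts" "a \<in> A" "c \<in> T" "g = zprod ts es \<otimes> a \<otimes> c"
      using cover[OF g] by (elim exE conjE)
    obtain w where w: "w \<in> W" "val w = a" using W(3)[OF g(2)] by blast
    have "normal_word ts es @ w @ [c] \<in> comb W" unfolding comb_def using g w by blast
    then show ?thesis using val_comb[OF w(1) g(3)] g(4) w(2) by blast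
  qed
  have lang: "language_for G S (comb W)" unfolding language_for_def using combS cov by blast
  have gs: "generating_set G S"
  proof -
    have sub: "subgroup (generate G S) G" by (rule generate_is_subgroup[OF Sc])
    have "val u \<in> generate G S" if "set u \<subseteq> S" for u
      using that
    proof (induction u)
      case Nil
      show ?case using subgroup.one_closed[OF sub] by simp
    next
      case (Cons x u)
      then have "x \<in> generate G S" "val u \<in> generate G S" by (auto intro: generate.incl)
      then show ?case using subgroup.m_closed[OF sub] by simp
    qed
    then have "carrier G \<subseteq> generate G S" using cov combS by (metis in_listsD subsetI)
    then have "generate G S = carrier G" using generate_incl[OF Sc] by blast
    moreover have "inv x \<in> S" if "x \<in> S" for x using that B(2) unfolding S_def by auto
    ultimately show ?thesis unfolding generating_set_def using Sfin Sc by blast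
  qed
  define D where "D = (\<lambda>(c, x, c'). c \<otimes> x \<otimes> inv c') ` (T \<times> S \<times> T)"
  have Dfin: "finite D" unfolding D_def using T(1) Sfin by simp
  have Dc: "D \<subseteq> carrier G" unfolding D_def using T(2) Sc by auto
  \<comment> \<open>By \<open>decomposition_unique\<close> each element of \<open>D\<close>
    contributes at most one pair, so only finitely many exponent changes and finitely many linear
    maps occur.\<close>
  define P where "P = {(es, a). length es = length ts \<and> a \<in> A \<and> zprod ts es \<otimes> a \<in> D}"
  have Pfin: "finite P"
  proof (rule finite_imageD)
    show "finite ((\<lambda>(es, a). zprod ts es \<otimes> a) ` P)"
      by (rule finite_subset[OF _ Dfin]) (auto simp: P_def)
    show "inj_on (\<lambda>(es, a). zprod ts es \<otimes> a) P"
      by (rule inj_onI) (use decomposition_unique in \<open>fastforce simp: P_def\<close>)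
  qed
  define E where "E = Max (insert 0 (\<Union>(es, a)\<in>P. abs ` set es))"
  have E: "\<bar>e\<bar> \<le> E" if "(es, a) \<in> P" "e \<in> set es" for es a e
    unfolding E_def by (rule Max_ge) (use that Pfin in auto)
  obtain F1 where F1: "finite F1" "F1 \<subseteq> H" "\<forall>d\<in>{\<one>}. \<forall>es es'. length es = length ts \<longrightarrow>
    list_all2 (\<lambda>e e'. \<bar>e' - e\<bar> \<le> E) es es' \<longrightarrow> fellow_travel F1 d (normal_word ts es) (normal_word ts es')"
    using fellow_travel_normal_word[OF H(1) ts(1), of "{\<one>}" E] subgroup.one_closed[OF H_sub] by auto
  have "0 \<le> C" using W(3)[OF A_one] W(2) by (auto simp: straight_def)
  let ?R = "\<lambda>p F. finite F \<and> F \<subseteq> carrier G \<and> (\<forall>w w'. straight C w \<longrightarrow> straight C w' \<longrightarrow>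
    val w' = conj_by (inv (zprod ts (fst p))) (val w) \<otimes> snd p \<longrightarrow> fellow_travel F (zprod ts (fst p)) w w')"
  have "\<forall>p\<in>P. \<exists>F. ?R p F" using fellow_travel_straight \<open>0 \<le> C\<close> by (auto simp: P_def)
  then obtain F2 where F2: "\<forall>p\<in>P. ?R p (F2 p)"
    by (rule bchoice[THEN exE])
  \<comment> \<open>While the last letters are read, each path has read its letter or not, so
    \<open>\<one>\<close> is adjoined to \<open>T\<close> on both sides.\<close>
  define F3 where "F3 = (\<lambda>(u, d, u'). inv u \<otimes> d \<otimes> u') ` (insert \<one> T \<times> D \<times> insert \<one> T)"
  define F where "F = F1 \<union> (\<Union>p\<in>P. F2 p) \<union> F3"
  have "finite F3" unfolding F3_def using T(1) Dfin by simp
  then have Ffin: "finite F" unfolding F_def using F1(1) F2 Pfin by simp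
  have "F3 \<subseteq> carrier G" unfolding F3_def using T(2) Dc by auto
  then have Fc: "F \<subseteq> carrier G" unfolding F_def using F1(2) F2 by auto
  obtain K where K: "\<And>f. f \<in> F \<Longrightarrow> \<exists>u. set u \<subseteq> S \<and> real (length u) \<le> K \<and> val u = f"
    using finite_bounded_words[OF Ffin Fc gs] by blast
  have last: "fellow_travel F d [c] [c']" if d: "d \<in> D" "c \<in> T" "c' \<in> T" for d c c'
  proof (rule fellow_travel_linear)
    fix x y :: real
    have "val (take k [b]) \<in> insert \<one> T" if "b \<in> T" for k b
      using that T(2) by (cases k) auto
    then have "inv (vertex_at [c] x) \<otimes> d \<otimes> vertex_at [c'] y \<in> F3"
      unfolding F3_def using d by (intro image_eqI[of _ _ "(vertex_at [c] x, d, vertex_at [c'] y)"]) auto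
    then show "inv (vertex_at [c] x) \<otimes> d \<otimes> vertex_at [c'] y \<in> F" by (simp add: F_def)
  qed simp_all
  have "async_fellow_travel G S (K + 2) v v'"
    if v: "v \<in> comb W" "v' \<in> comb W" and x: "x \<in> S \<union> {\<one>}" and vv: "val v' = val v \<otimes> x" for v v' x
  proof -
    obtain es w c where v1: "v = normal_word ts es @ w @ [c]" "length es = length ts" "w \<in> W" "c \<in> T"
      using v(1) unfolding comb_def by blast
    obtain es' w' c' where v2: "v' = normal_word ts es' @ w' @ [c']" "length es' = length ts" "w' \<in> W" "c' \<in> T"
      using v(2) unfolding comb_def by blast
    define d where "d = c \<otimes> x \<otimes> inv c'"
    have xS: "x \<in> S" using x by (auto simp: S_def B_def)
    have dD: "d \<in> D" unfolding d_def D_def using v1(4) v2(4) xS by force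
    let ?h = "zprod ts es" and ?h' = "zprod ts es'" and ?a = "val w" and ?a' = "val w'"
    have aA: "?a \<in> A" "?a' \<in> A" using WA v1(3) v2(3) by simp_all
    have cc: "c \<in> carrier G" "c' \<in> carrier G" "x \<in> carrier G" "?h \<in> carrier G" "?h' \<in> carrier G" "?a \<in> carrier G" "?a' \<in> carrier G"
      using v1(4) v2(4) xS T(2) Sc aA by auto
    have eq: "?h' \<otimes> ?a' \<otimes> c' = ?h \<otimes> ?a \<otimes> c \<otimes> x"
      using vv unfolding v1(1) v2(1) val_comb[OF v1(3,4)] val_comb[OF v2(3,4)] .
    have "?h' \<otimes> ?a' = ?h' \<otimes> ?a' \<otimes> c' \<otimes> inv c'" using cc by (simp add: m_assoc)
    also have "\<dots> = ?h \<otimes> ?a \<otimes> d" unfolding eq d_def using cc by (simp add: m_assoc)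
    finally have hd: "?h' \<otimes> ?a' = ?h \<otimes> ?a \<otimes> d" .
    define fs where "fs = map2 (+) (map uminus es) es'"
    \<comment> \<open>Solved from \<open>a' = (inv h0 a h0) a0\<close> with
      \<open>h0 = zprod ts fs\<close>.\<close>
    define a0 where "a0 = conj_by (inv (zprod ts fs)) (inv ?a) \<otimes> ?a'"
    have fs: "length fs = length ts" "zprod ts fs = inv ?h \<otimes> ?h'"
      unfolding fs_def using v1(2) v2(2) zprod_add[OF H(1) ts(1), of "map uminus es" es'] zprod_uminus[OF H(1) ts(1), of es] by simp_all
    have a0A: "a0 \<in> A" unfolding a0_def using aA by simp
    have "zprod ts fs \<otimes> a0 = inv ?a \<otimes> (inv ?h \<otimes> (?h' \<otimes> ?a'))"
      unfolding a0_def conj_by_def fs(2) using cc by (simp add: m_assoc inv_mult_group)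
    also have "\<dots> = d" unfolding hd using cc Dc dD by (simp add: m_assoc subset_iff)
    finally have d: "zprod ts fs \<otimes> a0 = d" .
    have fP: "(fs, a0) \<in> P" unfolding P_def using fs(1) a0A d dD by simp
    have "list_all2 (\<lambda>e e'. \<bar>e' - e\<bar> \<le> E) es es'"
    proof (rule list_all2_all_nthI)
      fix i assume i: "i < length es"
      have "fs ! i = es' ! i - es ! i" "fs ! i \<in> set fs" using i v1(2) v2(2) fs(1) unfolding fs_def by (simp_all add: set_conv_nth) (auto intro!: exI[of _ i])
      then show "\<bar>es' ! i - es ! i\<bar> \<le> E" using E[OF fP] by metis
    qed (use v1(2) v2(2) in simp)
    then have b1: "fellow_travel F \<one> (normal_word ts es) (normal_word ts es')"
      using F1(3) v1(2) fellow_travel_mono[of F1 \<one> _ _ F] by (auto simp: F_def)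
    have o1: "inv (val (normal_word ts es)) \<otimes> \<one> \<otimes> val (normal_word ts es') = zprod ts fs" using fs(2) cc by simp
    have a': "?a' = conj_by (inv (zprod ts fs)) ?a \<otimes> a0"
      unfolding a0_def using aA by (simp add: conj_by_inv)
    have "fellow_travel (F2 (fs, a0)) (zprod ts fs) w w'"
      using bspec[OF F2 fP] W(2)[OF v1(3)] W(2)[OF v2(3)] a' by simp
    then have b2: "fellow_travel F (zprod ts fs) w w'" by (rule fellow_travel_mono) (use fP in \<open>auto simp: F_def\<close>)
    have o2: "inv ?a \<otimes> zprod ts fs \<otimes> ?a' = d" unfolding d[symmetric] a0_def conj_by_def using cc by (simp add: m_assoc)
    have sc: "set w \<subseteq> carrier G" "set w' \<subseteq> carrier G" using WA v1(3) v2(3) A_carrier by blast+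
    have b23: "fellow_travel F (zprod ts fs) (w @ [c]) (w' @ [c'])"
      by (rule fellow_travel_append[OF b2]) (use o2 last[OF dD v1(4) v2(4)] sc cc in auto)
    have "fellow_travel F \<one> v v'"
      unfolding v1(1) v2(1) by (rule fellow_travel_append[OF b1]) (use o1 b23 sc cc in auto)
    then show ?thesis
      using fellow_travel_imp_async_fellow_travel[of F v v' S K] combS[OF v(1)] combS[OF v(2)] Sc K by (auto simp: in_lists_conv_set)
  qed
  then have "async_combing G S (comb W)"
    unfolding async_combing_def using lang by blast
  then show ?thesis using gs by blast
qed

end

section \<open>Indexed languages\<close>

abbreviation derives :: "('n, 't, 'f) indexed_grammar \<Rightarrow> ('n \<times> 'f list, 't) gsym list \<Rightarrow>
    ('n \<times> 'f list, 't) gsym list \<Rightarrow> bool" where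
  "derives \<Gamma> \<equiv> (derives1 \<Gamma>)\<^sup>*\<^sup>*"

fun lang :: "('n \<Rightarrow> 'f list \<Rightarrow> 't list set) \<Rightarrow> ('n \<times> 'f list, 't) gsym list \<Rightarrow> 't list set" where
  "lang I [] = {[]}"
| "lang I (T a # u) = (#) a ` lang I u"
| "lang I (N x # u) = (\<Union>w \<in> I (fst x) (snd x). (@) w ` lang I u)"

lemma lang_append: "lang I (u @ v) = (\<Union>w \<in> lang I u. (@) w ` lang I v)"
  by (induction I u rule: lang.induct) (simp_all add: image_UN image_image, blast)

lemma lang_terminals [simp]: "lang I (map T w) = {w}"
  by (induction w) auto

lemma lang_singleton [simp]: "lang I [N x] = I (fst x) (snd x)"
  by auto

lemma attach_simps [simp]:
  "attach \<delta> [] = []" "attach \<delta> (N A # \<alpha>) = N (A, \<delta>) # attach \<delta> \<alpha>" "attach \<delta> (T a # \<alpha>) = T a # attach \<delta> \<alpha>"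
  by (simp_all add: attach_def)

text \<open>A derivation step can only shrink \<open>lang I\<close>, and the final terminal string
  denotes the singleton of \<open>w\<close>. Hence any \<open>I\<close> closed under the productions
  bounds what is generated.\<close>

lemma derives_sound:
  assumes "derives \<Gamma> u (map T w)"
    and "\<And>A \<alpha> \<delta>. Copy A \<alpha> \<in> productions \<Gamma> \<Longrightarrow> lang I (attach \<delta> \<alpha>) \<subseteq> I A \<delta>"
    and "\<And>A B f \<delta>. Push A B f \<in> productions \<Gamma> \<Longrightarrow> I B (f # \<delta>) \<subseteq> I A \<delta>"
    and "\<And>A f \<alpha> \<delta>. Pop A f \<alpha> \<in> productions \<Gamma> \<Longrightarrow> lang I (attach \<delta> \<alpha>) \<subseteq> I A (f # \<delta>)"
  shows "w \<in> lang I u"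
  using assms(1)
proof (induction rule: converse_rtranclp_induct)
  case (step u u')
  have "lang I u' \<subseteq> lang I u" if "derives1 \<Gamma> u u'"
    using that
  proof cases
    case (copy A \<alpha> p \<delta> q)
    then show ?thesis using assms(2)[of A \<alpha> \<delta>] by (simp add: lang_append) blast
  next
    case (push A B f p \<delta> q)
    then show ?thesis using assms(3)[of A B f \<delta>] by (simp add: lang_append) blast
  next
    case (pop A f \<alpha> p \<delta> q)
    then show ?thesis using assms(4)[of A f \<alpha> \<delta>] by (simp add: lang_append) blast
  qed
  then show ?case using step by blast
qed simp

lemma derives1_context: "derives1 \<Gamma> u v \<Longrightarrow> derives1 \<Gamma> (p @ u @ q) (p @ v @ q)"
proof (induction rule: derives1.induct)
  case (copy A \<alpha> u \<delta> v)
  then show ?case using derives1.copy[of A \<alpha> \<Gamma> "p @ u" \<delta> "v @ q"] by simp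
next
  case (push A B f u \<delta> v)
  then show ?case using derives1.push[of A B f \<Gamma> "p @ u" \<delta> "v @ q"] by simp
next
  case (pop A f \<alpha> u \<delta> v)
  then show ?case using derives1.pop[of A f \<alpha> \<Gamma> "p @ u" \<delta> "v @ q"] by simp
qed

lemma derives_context: "derives \<Gamma> u v \<Longrightarrow> derives \<Gamma> (p @ u @ q) (p @ v @ q)"
  by (induction rule: rtranclp_induct) (auto intro: derives1_context rtranclp.rtrancl_into_rtrancl)

lemma derives_append: "derives \<Gamma> u u' \<Longrightarrow> derives \<Gamma> v v' \<Longrightarrow> derives \<Gamma> (u @ v) (u' @ v')"
  using derives_context[of \<Gamma> u u' "[]" v] derives_context[of \<Gamma> v v' u' "[]"] by simp

lemma derives1_mono:
  "derives1 \<Gamma> u v \<Longrightarrow> productions \<Gamma> \<subseteq> productions \<Gamma>' \<Longrightarrow> derives1 \<Gamma>' u v"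
  by (induction rule: derives1.induct) (blast intro: derives1.intros)+

lemma derives_mono:
  "derives \<Gamma> u v \<Longrightarrow> productions \<Gamma> \<subseteq> productions \<Gamma>' \<Longrightarrow> derives \<Gamma>' u v"
  by (induction rule: rtranclp_induct) (auto intro: derives1_mono rtranclp.rtrancl_into_rtrancl)

text \<open>By \<open>derives_sound\<close> and the rules \<open>gen_copy\<close>,
  \<open>gen_push\<close> and \<open>gen_pop\<close>, this is the least interpretation closed under
  the productions.\<close>

definition gen :: "('n, 't, 'f) indexed_grammar \<Rightarrow> 'n \<Rightarrow> 'f list \<Rightarrow> 't list set" where
  "gen \<Gamma> A \<delta> = {w. derives \<Gamma> [N (A, \<delta>)] (map T w)}"

lemma lang_gen: "w \<in> lang (gen \<Gamma>) u \<Longrightarrow> derives \<Gamma> u (map T w)"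
proof (induction "gen \<Gamma>" u arbitrary: w rule: lang.induct)
  case (2 a u)
  then obtain w' where "w = a # w'" "derives \<Gamma> u (map T w')" by auto
  then show ?case using derives_context[of \<Gamma> u _ "[T a]" "[]"] by simp
next
  case (3 x u)
  then obtain v w' where "w = v @ w'" "derives \<Gamma> [N x] (map T v)" "derives \<Gamma> u (map T w')"
    by (auto simp: gen_def)
  then show ?case using derives_append[of \<Gamma> "[N x]"] by fastforce
qed simp

lemma gen_copy:
  assumes "Copy A \<alpha> \<in> productions \<Gamma>"
  shows "lang (gen \<Gamma>) (attach \<delta> \<alpha>) \<subseteq> gen \<Gamma> A \<delta>"
proof
  fix w assume "w \<in> lang (gen \<Gamma>) (attach \<delta> \<alpha>)"
  then have "derives \<Gamma> (attach \<delta> \<alpha>) (map T w)" by (rule lang_gen)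
  then show "w \<in> gen \<Gamma> A \<delta>"
    using derives1.copy[OF assms, of "[]" \<delta> "[]"] by (auto simp: gen_def intro: converse_rtranclp_into_rtranclp)
qed

lemma gen_push:
  assumes "Push A B f \<in> productions \<Gamma>"
  shows "gen \<Gamma> B (f # \<delta>) \<subseteq> gen \<Gamma> A \<delta>"
  using derives1.push[OF assms, of "[]" \<delta> "[]"] by (auto simp: gen_def intro: converse_rtranclp_into_rtranclp)

lemma gen_pop:
  assumes "Pop A f \<alpha> \<in> productions \<Gamma>"
  shows "lang (gen \<Gamma>) (attach \<delta> \<alpha>) \<subseteq> gen \<Gamma> A (f # \<delta>)"
proof
  fix w assume "w \<in> lang (gen \<Gamma>) (attach \<delta> \<alpha>)"
  then have "derives \<Gamma> (attach \<delta> \<alpha>) (map T w)" by (rule lang_gen)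
  then show "w \<in> gen \<Gamma> A (f # \<delta>)"
    using derives1.pop[OF assms, of "[]" \<delta> "[]"] by (auto simp: gen_def intro: converse_rtranclp_into_rtranclp)
qed

lemma lang_over:
  assumes "list_all (gsym_over \<Gamma>) \<alpha>" "\<And>A. A \<in> nonterminals \<Gamma> \<Longrightarrow> I A \<delta> \<subseteq> lists (terminals \<Gamma>)"
  shows "lang I (attach \<delta> \<alpha>) \<subseteq> lists (terminals \<Gamma>)"
  using assms(1)
proof (induction \<alpha>)
  case (Cons s \<alpha>)
  then have IH: "lang I (attach \<delta> \<alpha>) \<subseteq> lists (terminals \<Gamma>)" by simp
  show ?case
  proof (cases s)
    case (N A)
    then have "I A \<delta> \<subseteq> lists (terminals \<Gamma>)" using Cons.prems assms(2) by simp
    then show ?thesis unfolding N using IH by (auto simp del: in_lists_conv_set lists_eq_set) blast+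
  next
    case (T a)
    then have "a \<in> terminals \<Gamma>" using Cons.prems by simp
    then show ?thesis unfolding T using IH by (auto simp del: in_lists_conv_set lists_eq_set) blast+
  qed
qed auto

lemma gen_terminals:
  assumes wf: "wf_indexed_grammar \<Gamma>"
  shows "gen \<Gamma> A \<delta> \<subseteq> lists (terminals \<Gamma>)"
proof
  fix w assume "w \<in> gen \<Gamma> A \<delta>"
  then have "derives \<Gamma> [N (A, \<delta>)] (map T w)" by (simp add: gen_def)
  then have "w \<in> lang (\<lambda>A \<delta>. lists (terminals \<Gamma>)) [N (A, \<delta>)]"
    by (rule derives_sound)
      (use wf lang_over[where I = "\<lambda>A \<delta>. lists (terminals \<Gamma>)"] in \<open>fastforce simp: wf_indexed_grammar_def\<close>)+
  then show "w \<in> lists (terminals \<Gamma>)" by simp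
qed

lemma grammar_language_gen: "wf_indexed_grammar \<Gamma> \<Longrightarrow> grammar_language \<Gamma> = gen \<Gamma> (start \<Gamma>) []"
  using gen_terminals[of \<Gamma> "start \<Gamma>" "[]"] by (auto simp: grammar_language_def gen_def)

lemma lang_cong:
  "list_all (gsym_over \<Gamma>) \<alpha> \<Longrightarrow> (\<And>A. A \<in> nonterminals \<Gamma> \<Longrightarrow> I A \<delta> = J A \<delta>) \<Longrightarrow>
    lang I (attach \<delta> \<alpha>) = lang J (attach \<delta> \<alpha>)"
proof (induction \<alpha>)
  case (Cons s \<alpha>)
  then show ?case by (cases s) auto
qed simp

text \<open>Productions for fresh nonterminals \<open>M\<close> do not change what the old nonterminals generate, and what
  the fresh ones generate is bounded by any solution \<open>I\<close> of the corresponding inclusions.\<close>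

lemma gen_extension_sound:
  assumes wf: "wf_indexed_grammar \<Gamma>"
    and P: "productions \<Gamma>' = productions \<Gamma> \<union> Q" and M: "M \<inter> nonterminals \<Gamma> = {}"
    and Q: "\<And>r. r \<in> Q \<Longrightarrow> \<exists>A \<alpha>. r = Copy A \<alpha> \<and> A \<in> M"
    and I: "\<And>A \<alpha>. Copy A \<alpha> \<in> Q \<Longrightarrow> lang (\<lambda>B \<delta>. if B \<in> M then I B else gen \<Gamma> B \<delta>) (attach [] \<alpha>) \<subseteq> I A"
    and A: "A \<in> M"
  shows "gen \<Gamma>' A [] \<subseteq> I A"
proof
  fix w assume "w \<in> gen \<Gamma>' A []"
  \<comment> \<open>The set \<open>I B\<close> describes fresh nonterminals with empty index string
    only. Productions in \<open>Q\<close> copy this string unchanged, so nonempty strings may be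
    assigned \<open>UNIV\<close>.\<close>
  let ?J = "\<lambda>B \<delta>. if B \<in> M then (if \<delta> = [] then I B else UNIV) else gen \<Gamma> B \<delta>"
  have old: "?J B \<delta> = gen \<Gamma> B \<delta>" if "B \<in> nonterminals \<Gamma>" for B \<delta> using that M by auto
  have wf': "\<And>r. r \<in> productions \<Gamma> \<Longrightarrow> production_over \<Gamma> r" using wf by (simp add: wf_indexed_grammar_def)
  have "derives \<Gamma>' [N (A, [])] (map T w)" using \<open>w \<in> gen \<Gamma>' A []\<close> by (simp add: gen_def)
  then have "w \<in> lang ?J [N (A, [])]"
  proof (rule derives_sound)
    fix B \<alpha> and \<delta> :: "'c list" assume r: "Copy B \<alpha> \<in> productions \<Gamma>'"
    show "lang ?J (attach \<delta> \<alpha>) \<subseteq> ?J B \<delta>"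
    proof (cases "Copy B \<alpha> \<in> Q")
      case True
      then have "B \<in> M" using Q by auto
      moreover have "lang ?J (attach [] \<alpha>) = lang (\<lambda>B \<delta>. if B \<in> M then I B else gen \<Gamma> B \<delta>) (attach [] \<alpha>)"
      proof (induction \<alpha>)
        case (Cons s \<alpha>)
        then show ?case by (cases s) auto
      qed simp
      ultimately show ?thesis using I[OF True] by auto
    next
      case False
      then have r: "Copy B \<alpha> \<in> productions \<Gamma>" using r P by auto
      then have "lang ?J (attach \<delta> \<alpha>) = lang (gen \<Gamma>) (attach \<delta> \<alpha>)" "B \<in> nonterminals \<Gamma>"
        using wf'[OF r] lang_cong[of \<Gamma> \<alpha> ?J \<delta> "gen \<Gamma>"] old by auto
      then show ?thesis using gen_copy[OF r] old by auto
    qed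
  next
    fix B C f and \<delta> :: "'c list" assume "Push B C f \<in> productions \<Gamma>'"
    then have r: "Push B C f \<in> productions \<Gamma>" using P Q by auto
    then show "?J C (f # \<delta>) \<subseteq> ?J B \<delta>" using wf'[OF r] old gen_push[OF r] by auto
  next
    fix B f \<alpha> and \<delta> :: "'c list" assume "Pop B f \<alpha> \<in> productions \<Gamma>'"
    then have r: "Pop B f \<alpha> \<in> productions \<Gamma>" using P Q by auto
    then have "lang ?J (attach \<delta> \<alpha>) = lang (gen \<Gamma>) (attach \<delta> \<alpha>)" "B \<in> nonterminals \<Gamma>"
      using wf'[OF r] lang_cong[of \<Gamma> \<alpha> ?J \<delta> "gen \<Gamma>"] old by auto
    then show "lang ?J (attach \<delta> \<alpha>) \<subseteq> ?J B (f # \<delta>)" using gen_pop[OF r] old by auto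
  qed
  then show "w \<in> I A" using A by simp
qed

lemma gsym_over_mono:
  "\<lbrakk>gsym_over \<Gamma> s; nonterminals \<Gamma> \<subseteq> nonterminals \<Gamma>'; terminals \<Gamma> \<subseteq> terminals \<Gamma>'\<rbrakk> \<Longrightarrow> gsym_over \<Gamma>' s"
  by (cases s) auto

lemma production_over_mono:
  "\<lbrakk>production_over \<Gamma> r; nonterminals \<Gamma> \<subseteq> nonterminals \<Gamma>'; terminals \<Gamma> \<subseteq> terminals \<Gamma>'; indices \<Gamma> \<subseteq> indices \<Gamma>'\<rbrakk>
    \<Longrightarrow> production_over \<Gamma>' r"
  by (cases r) (auto simp: list_all_iff intro: gsym_over_mono)

lemma wf_extension:
  assumes "wf_indexed_grammar \<Gamma>" "finite M" "finite X" "finite Q" "m \<in> M"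
    and \<Gamma>': "\<Gamma>' = \<Gamma>\<lparr>nonterminals := M \<union> nonterminals \<Gamma>, terminals := X \<union> terminals \<Gamma>,
      start := m, productions := productions \<Gamma> \<union> Q\<rparr>"
    and "\<And>r. r \<in> Q \<Longrightarrow> production_over \<Gamma>' r"
  shows "wf_indexed_grammar \<Gamma>'"
proof -
  have "production_over \<Gamma>' r" if "r \<in> productions \<Gamma>" for r
    by (rule production_over_mono[of \<Gamma>]) (use that assms(1) in \<open>auto simp: wf_indexed_grammar_def \<Gamma>'\<close>)
  then show ?thesis using assms unfolding wf_indexed_grammar_def by auto
qed

section \<open>Closure of indexed languages under final letters and initial powers\<close>

lemma indexed_language_suffix:
  assumes "indexed_language L" "finite C"
  shows "indexed_language {w @ [c] | w c. w \<in> L \<and> c \<in> C}"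
proof -
  obtain \<Gamma> :: "(nat, 'a, nat) indexed_grammar" where wf: "wf_indexed_grammar \<Gamma>" and L: "grammar_language \<Gamma> = L"
    using assms(1) unfolding indexed_language_def by blast
  have "finite (nonterminals \<Gamma>)" using wf by (simp add: wf_indexed_grammar_def)
  then obtain m where m: "m \<notin> nonterminals \<Gamma>" using ex_new_if_finite infinite_UNIV_nat by blast
  let ?s = "start \<Gamma>"
  define Q where "Q = (\<lambda>c. Copy m [N ?s, T c] :: (nat, 'a, nat) production) ` C"
  define \<Gamma>' where "\<Gamma>' = \<Gamma>\<lparr>nonterminals := {m} \<union> nonterminals \<Gamma>, terminals := C \<union> terminals \<Gamma>,
    start := m, productions := productions \<Gamma> \<union> Q\<rparr>"
  have P': "productions \<Gamma>' = productions \<Gamma> \<union> Q" by (simp add: \<Gamma>'_def)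
  have wf': "wf_indexed_grammar \<Gamma>'"
    by (rule wf_extension[OF wf _ assms(2) _ _ \<Gamma>'_def])
      (use wf assms(2) in \<open>auto simp: Q_def \<Gamma>'_def wf_indexed_grammar_def\<close>)
  have s: "?s \<noteq> m" using wf m by (auto simp: wf_indexed_grammar_def)
  have gL: "gen \<Gamma> ?s [] = L" using L grammar_language_gen[OF wf] by simp
  let ?L = "{w @ [c] | w c. w \<in> L \<and> c \<in> C}"
  have "gen \<Gamma>' m [] \<subseteq> ?L"
  proof (rule gen_extension_sound[OF wf P', of "{m}" "\<lambda>_. ?L"])
    fix A \<alpha> assume "Copy A \<alpha> \<in> Q"
    then show "lang (\<lambda>B \<delta>. if B \<in> {m} then ?L else gen \<Gamma> B \<delta>) (attach [] \<alpha>) \<subseteq> ?L"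
      using s gL by (auto simp: Q_def)
  qed (use m in \<open>auto simp: Q_def\<close>)
  moreover have "?L \<subseteq> gen \<Gamma>' m []"
  proof -
    have "w @ [c] \<in> gen \<Gamma>' m []" if "w \<in> L" "c \<in> C" for w c
    proof -
      have "w \<in> gen \<Gamma>' ?s []"
        using that(1) derives_mono[of \<Gamma> _ _ \<Gamma>'] P' unfolding gL[symmetric] by (auto simp: gen_def)
      then have "w @ [c] \<in> lang (gen \<Gamma>') (attach [] [N ?s, T c])" by auto
      moreover have "Copy m [N ?s, T c] \<in> productions \<Gamma>'" using that(2) by (simp add: P' Q_def)
      ultimately show ?thesis by (rule subsetD[OF gen_copy, rotated])
    qed
    then show ?thesis by blast
  qed
  moreover have "start \<Gamma>' = m" by (simp add: \<Gamma>'_def)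
  ultimately have "grammar_language \<Gamma>' = ?L" using grammar_language_gen[OF wf'] by simp
  then show ?thesis unfolding indexed_language_def using wf' by blast
qed

text \<open>This prepends one power block: \<open>a\<close> is the padding letter, \<open>b\<close>
  and \<open>c\<close> are a generator and its inverse. Separate nonterminals for the two signs
  prevent \<open>b\<close> and \<open>c\<close> from being mixed in one block.\<close>

lemma indexed_language_prefix:
  assumes "indexed_language L"
  shows "indexed_language {a # replicate k x @ w | k x w. x \<in> {b, c} \<and> w \<in> L}"
proof -
  obtain \<Gamma> :: "(nat, 'a, nat) indexed_grammar" where wf: "wf_indexed_grammar \<Gamma>" and L: "grammar_language \<Gamma> = L"
    using assms(1) unfolding indexed_language_def by blast
  have "finite (nonterminals \<Gamma>)" using wf by (simp add: wf_indexed_grammar_def)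
  then obtain m where m: "\<forall>A\<in>nonterminals \<Gamma>. A < m" using finite_nat_set_iff_bounded by blast
  let ?s = "start \<Gamma>" and ?p = "Suc m" and ?q = "Suc (Suc m)"
  define Q :: "(nat, 'a, nat) production set" where "Q = {Copy m [T a, N ?p], Copy m [T a, N ?q],
    Copy ?p [T b, N ?p], Copy ?p [N ?s], Copy ?q [T c, N ?q], Copy ?q [N ?s]}"
  define \<Gamma>' where "\<Gamma>' = \<Gamma>\<lparr>nonterminals := {m, ?p, ?q} \<union> nonterminals \<Gamma>, terminals := {a, b, c} \<union> terminals \<Gamma>,
    start := m, productions := productions \<Gamma> \<union> Q\<rparr>"
  have P': "productions \<Gamma>' = productions \<Gamma> \<union> Q" by (simp add: \<Gamma>'_def)
  have wf': "wf_indexed_grammar \<Gamma>'"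
    by (rule wf_extension[OF wf _ _ _ _ \<Gamma>'_def])
      (use wf in \<open>auto simp: Q_def \<Gamma>'_def wf_indexed_grammar_def\<close>)
  have "?s \<in> nonterminals \<Gamma>" using wf by (simp add: wf_indexed_grammar_def)
  then have s: "?s < m" using m by blast
  have gL: "gen \<Gamma> ?s [] = L" using L grammar_language_gen[OF wf] by simp
  let ?L = "{a # replicate k x @ w | k x w. x \<in> {b, c} \<and> w \<in> L}"
  let ?K = "\<lambda>x. {replicate k x @ w | k w. w \<in> L}"
  let ?I = "\<lambda>A. if A = m then ?L else if A = ?p then ?K b else ?K c"
  have rep: "x # replicate k x @ w = replicate (Suc k) x @ w" "w = replicate 0 x @ w" for k and x :: 'a and w by simp_all
  have K: "(#) x ` ?K x \<subseteq> ?K x" "L \<subseteq> ?K x" for x using rep by blast+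
  have "gen \<Gamma>' m [] \<subseteq> ?I m"
  proof (rule gen_extension_sound[OF wf P', of "{m, ?p, ?q}" ?I])
    fix A \<alpha> assume "Copy A \<alpha> \<in> Q"
    moreover have "(#) a ` ?K b \<subseteq> ?L" "(#) a ` ?K c \<subseteq> ?L" by blast+
    ultimately show "lang (\<lambda>B \<delta>. if B \<in> {m, ?p, ?q} then ?I B else gen \<Gamma> B \<delta>) (attach [] \<alpha>) \<subseteq> ?I A"
      using s gL K[of b] K[of c] unfolding Q_def by (elim insertE) (simp_all add: image_subset_iff)
  qed (use m in \<open>auto simp: Q_def\<close>)
  then have "gen \<Gamma>' m [] \<subseteq> ?L" by simp
  moreover have "?L \<subseteq> gen \<Gamma>' m []"
  proof -
    have L': "L \<subseteq> gen \<Gamma>' ?s []"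
      using derives_mono[of \<Gamma> _ _ \<Gamma>'] P' unfolding gL[symmetric] by (auto simp: gen_def)
    have g: "lang (gen \<Gamma>') (attach [] \<alpha>) \<subseteq> gen \<Gamma>' A []" if "Copy A \<alpha> \<in> Q" for A \<alpha>
      by (rule gen_copy) (use that P' in simp)
    have b: "replicate k b @ w \<in> gen \<Gamma>' ?p []" if "w \<in> L" for k w
    proof (induction k)
      case 0
      then show ?case using g[of ?p "[N ?s]"] L' that by (auto simp: Q_def)
    next
      case (Suc k)
      then show ?case using g[of ?p "[T b, N ?p]"] by (auto simp: Q_def)
    qed
    have c: "replicate k c @ w \<in> gen \<Gamma>' ?q []" if "w \<in> L" for k w
    proof (induction k)
      case 0
      then show ?case using g[of ?q "[N ?s]"] L' that by (auto simp: Q_def)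
    next
      case (Suc k)
      then show ?case using g[of ?q "[T c, N ?q]"] by (auto simp: Q_def)
    qed
    have "a # replicate k x @ w \<in> gen \<Gamma>' m []" if "x \<in> {b, c}" "w \<in> L" for k x w
      using that b[of w k] c[of w k] g[of m "[T a, N ?p]"] g[of m "[T a, N ?q]"] by (auto simp: Q_def)
    then show ?thesis by blast
  qed
  moreover have "start \<Gamma>' = m" by (simp add: \<Gamma>'_def)
  ultimately have "grammar_language \<Gamma>' = ?L" using grammar_language_gen[OF wf'] by simp
  then show ?thesis unfolding indexed_language_def using wf' by blast
qed

section \<open>Christoffel words\<close>

text \<open>With \<open>False\<close> for \<open>x\<close> and \<open>True\<close> for \<open>y\<close>, index \<open>0\<close> is \<open>x \<mapsto> x, y \<mapsto> xy\<close> and index \<open>1\<close> is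
  \<open>x \<mapsto> xy, y \<mapsto> y\<close>.\<close>

fun letter_subst :: "nat \<Rightarrow> bool \<Rightarrow> bool list" where
  "letter_subst i b = (if b = (i \<noteq> 0) then [b] else [False, True])"

definition subst :: "nat \<Rightarrow> bool list \<Rightarrow> bool list" where
  "subst i u = concat (map (letter_subst i) u)"

text \<open>\<open>fold\<close> applies the leading index first, which is the order in which the
  grammar pops indices.\<close>

definition expand :: "nat list \<Rightarrow> bool list \<Rightarrow> bool list" where
  "expand \<sigma> u = fold subst \<sigma> u"

lemma subst_simps [simp]:
  "subst i [] = []" "subst i (b # u) = letter_subst i b @ subst i u" "subst i (u @ v) = subst i u @ subst i v"
  by (simp_all add: subst_def del: letter_subst.simps)

declare letter_subst.simps [simp del]

lemma expand_simps [simp]: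
  "expand [] u = u" "expand (i # \<sigma>) u = expand \<sigma> (subst i u)" "expand (\<sigma> @ [i]) u = subst i (expand \<sigma> u)"
  by (simp_all add: expand_def)

lemma expand_append [simp]: "expand \<sigma> (u @ v) = expand \<sigma> u @ expand \<sigma> v"
  by (induction \<sigma> arbitrary: u v) simp_all

abbreviation cnt :: "bool \<Rightarrow> bool list \<Rightarrow> int" where
  "cnt b u \<equiv> int (count_list u b)"

lemma cnt_subst:
  "cnt False (subst i u) = cnt False u + (if i = 0 then cnt True u else 0)"
  "cnt True (subst i u) = cnt True u + (if i = 0 then 0 else cnt False u)"
  by (induction u) (auto simp: letter_subst.simps)

text \<open>For a word with letter counts \<open>p, q\<close> and a prefix with letter counts \<open>i, j\<close>, the number \<open>q i - p j\<close>
  measures the deviation of the prefix from the line through the end point.\<close>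

definition balanced :: "bool list \<Rightarrow> bool" where
  "balanced u \<longleftrightarrow> (\<forall>v s. u = v @ s \<longrightarrow>
     0 \<le> cnt True u * cnt False v - cnt False u * cnt True v \<and>
     cnt True u * cnt False v - cnt False u * cnt True v < cnt False u + cnt True u)"

text \<open>A cut can fall inside the image of a letter only if that image has two letters; that
  letter is \<open>i = 0\<close>, read as a truth value.\<close>

lemma subst_prefix:
  assumes "subst i u = v' @ s'"
  shows "\<exists>v s. u = v @ s \<and> (v' = subst i v \<or> (\<exists>s''. s = (i = 0) # s'' \<and> v' = subst i v @ [False]))"
  using assms
proof (induction u arbitrary: v' s')
  case (Cons b u)
  have e: "letter_subst i b @ subst i u = v' @ s'" using Cons.prems by simp
  show ?case
  proof (cases "length (letter_subst i b) \<le> length v'")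
    case True
    then obtain v'' where v'': "v' = letter_subst i b @ v''" "subst i u = v'' @ s'"
      using e by (auto simp: append_eq_append_conv_if) (metis append_take_drop_id)
    obtain v s where vs: "u = v @ s" "v'' = subst i v \<or> (\<exists>s''. s = (i = 0) # s'' \<and> v'' = subst i v @ [False])"
      using Cons.IH[OF v''(2)] by blast
    show ?thesis by (intro exI[of _ "b # v"] exI[of _ s]) (use vs v''(1) in auto)
  next
    case False
    show ?thesis
    proof (cases v')
      case Nil
      then show ?thesis by (intro exI[of _ "[]"] exI[of _ "b # u"]) simp
    next
      case (Cons x xs)
      then have b: "b = (i = 0)" "letter_subst i b = [False, True]" using False by (auto simp: letter_subst.simps split: if_splits)
      then have "v' = [False]" using Cons False e by (cases xs) auto
      then show ?thesis using b by (intro exI[of _ "[]"] exI[of _ "b # u"]) simp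
    qed
  qed
qed simp

text \<open>Both substitutions act on the letter counts with determinant \<open>1\<close>, so at
  block boundaries the deviation is unchanged while its bound does not decrease. Only prefixes that
  cut a two-letter block need a further estimate.\<close>

lemma balanced_subst:
  assumes u: "balanced u"
  shows "balanced (subst i u)"
  unfolding balanced_def
proof (intro allI impI)
  fix v' s' assume e: "subst i u = v' @ s'"
  obtain v s where vs: "u = v @ s" and v': "v' = subst i v \<or> (\<exists>s''. s = (i = 0) # s'' \<and> v' = subst i v @ [False])"
    using subst_prefix[OF e] by (elim exE conjE)
  let ?p = "cnt False u" and ?q = "cnt True u"
  have pq: "0 \<le> ?p" "0 \<le> ?q" by simp_all
  have b: "0 \<le> ?q * cnt False v - ?p * cnt True v" "?q * cnt False v - ?p * cnt True v < ?p + ?q"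
    using u[unfolded balanced_def, rule_format, OF vs] by simp_all
  show "0 \<le> cnt True (subst i u) * cnt False v' - cnt False (subst i u) * cnt True v' \<and>
    cnt True (subst i u) * cnt False v' - cnt False (subst i u) * cnt True v' < cnt False (subst i u) + cnt True (subst i u)"
  proof (cases "v' = subst i v")
    case True
    then show ?thesis using b pq by (auto simp: cnt_subst algebra_simps)
  next
    case False
    then obtain s'' where s: "s = (i = 0) # s''" "v' = subst i v @ [False]" using v' by blast
    have u': "u = (v @ [i = 0]) @ s''" using vs s by simp
    \<comment> \<open>For \<open>i = 1\<close> the cut adds \<open>?p + ?q\<close> to the deviation,
      and the upper bound comes from balance at the longer prefix
      \<open>v @ [False]\<close>.\<close>
    have "0 \<le> ?q * cnt False (v @ [i = 0]) - ?p * cnt True (v @ [i = 0])"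
      "?q * cnt False (v @ [i = 0]) - ?p * cnt True (v @ [i = 0]) < ?p + ?q"
      using u[unfolded balanced_def, rule_format, OF u'] by (simp_all only:)
    then show ?thesis using b pq s(2) by (cases "i = 0") (auto simp: cnt_subst algebra_simps)
  qed
qed

lemma count_list_replicate: "count_list (replicate k b) c = (if b = c then k else 0)"
  by (induction k) auto

lemma balanced_replicate:
  assumes "0 < d"
  shows "balanced (replicate d b)"
  unfolding balanced_def
proof (intro allI impI)
  fix v s assume "replicate d b = v @ s"
  then have "set v \<subseteq> {b}" using assms by (metis Un_upper1 set_append set_replicate not_gr_zero)
  then have "v = replicate (length v) b" by (induction v) auto
  then obtain k where "v = replicate k b" by blast
  then show "0 \<le> cnt True (replicate d b) * cnt False v - cnt False (replicate d b) * cnt True v \<and>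
    cnt True (replicate d b) * cnt False v - cnt False (replicate d b) * cnt True v
      < cnt False (replicate d b) + cnt True (replicate d b)"
    using assms by (simp add: count_list_replicate)
qed

lemma balanced_expand: "balanced u \<Longrightarrow> balanced (expand \<sigma> u)"
  by (induction \<sigma> rule: rev_induct) (auto intro: balanced_subst)

text \<open>Determinant \<open>1\<close> preserves the greatest common divisor of the two counts, so
  \<open>d\<close> is this divisor: the words are \<open>d\<close>-th powers of primitive
  ones.\<close>

definition christoffel :: "bool list set" where
  "christoffel = {expand \<sigma> (replicate d b) | \<sigma> d b. set \<sigma> \<subseteq> {0, 1} \<and> 0 < d}"

lemma christoffel_balanced: "u \<in> christoffel \<Longrightarrow> balanced u"
  by (auto simp: christoffel_def intro: balanced_expand balanced_replicate)

lemma christoffel_subst: "u \<in> christoffel \<Longrightarrow> i \<in> {0, 1} \<Longrightarrow> subst i u \<in> christoffel"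
proof -
  assume "u \<in> christoffel" "i \<in> {0, 1}"
  then obtain \<sigma> d b where "u = expand \<sigma> (replicate d b)" "set \<sigma> \<subseteq> {0, 1}" "0 < d" by (auto simp: christoffel_def)
  then show ?thesis unfolding christoffel_def using \<open>i \<in> {0, 1}\<close>
    by (intro CollectI exI[of _ "\<sigma> @ [i]"] exI[of _ d] exI[of _ b]) auto
qed

text \<open>The two substitutions act on the pair of letter counts as the elementary matrices, so the
  subtractive Euclidean algorithm produces a word with any prescribed counts.\<close>

lemma christoffel_exists:
  assumes "p \<noteq> 0 \<or> q \<noteq> 0"
  shows "\<exists>u\<in>christoffel. count_list u False = p \<and> count_list u True = q"
  using assms
proof (induction "p + q" arbitrary: p q rule: less_induct)
  case less
  have rep: "replicate d b \<in> christoffel" if "0 < d" for d b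
    unfolding christoffel_def using that by (intro CollectI exI[of _ "[]"] exI[of _ d] exI[of _ b]) auto
  consider "q = 0" | "p = 0" | "0 < q" "q \<le> p" | "0 < p" "p \<le> q" by linarith
  then show ?case
  proof cases
    case 1
    then show ?thesis using rep[of p False] less.prems by (intro bexI[of _ "replicate p False"]) (auto simp: count_list_replicate)
  next
    case 2
    then show ?thesis using rep[of q True] less.prems by (intro bexI[of _ "replicate q True"]) (auto simp: count_list_replicate)
  next
    case 3
    then obtain u where u: "u \<in> christoffel" "count_list u False = p - q" "count_list u True = q"
      using less.hyps[of "p - q" q] by auto
    then have "int (count_list (subst 0 u) False) = int p" "int (count_list (subst 0 u) True) = int q"
      unfolding cnt_subst using 3 by auto
    then show ?thesis using christoffel_subst[OF u(1), of 0] by (intro bexI[of _ "subst 0 u"]) auto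
  next
    case 4
    then obtain u where u: "u \<in> christoffel" "count_list u False = p" "count_list u True = q - p"
      using less.hyps[of p "q - p"] by auto
    then have "int (count_list (subst 1 u) False) = int p" "int (count_list (subst 1 u) True) = int q"
      unfolding cnt_subst using 4 by auto
    then show ?thesis using christoffel_subst[OF u(1), of 1] by (intro bexI[of _ "subst 1 u"]) auto
  qed
qed

text \<open>For the empty word the strict upper bound in \<open>balanced\<close> would read
  \<open>0 < 0\<close>.\<close>

lemma christoffel_nonempty: "u \<in> christoffel \<Longrightarrow> u \<noteq> []"
proof -
  assume "u \<in> christoffel"
  then have "balanced u" by (rule christoffel_balanced)
  then show ?thesis unfolding balanced_def by fastforce
qed

section \<open>An indexed grammar for powers of Christoffel words in four quadrants\<close>

definition slope_words :: "'a \<Rightarrow> (nat \<Rightarrow> bool \<Rightarrow> 'a) \<Rightarrow> 'a list set" where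
  "slope_words e x = insert [e] {map (x j) u | j u. j < 4 \<and> u \<in> christoffel}"

text \<open>Nonterminals \<open>4\<close> and \<open>5\<close> stand for the two letters, \<open>2\<close> and \<open>3\<close> for nonempty powers of them, and
  \<open>1\<close> chooses the substitutions. The index \<open>0\<close> or \<open>1\<close> applies a substitution, and the bottom index
  \<open>j + 2\<close> fixes the quadrant.\<close>

definition slope_grammar :: "'a \<Rightarrow> (nat \<Rightarrow> bool \<Rightarrow> 'a) \<Rightarrow> (nat, 'a, nat) indexed_grammar" where
  "slope_grammar e x = \<lparr>nonterminals = {0..5}, terminals = insert e (\<Union>j<4. range (x j)),
     indices = {0..5}, start = 0,
     productions = {Copy 0 [T e], Push 1 1 0, Push 1 1 1, Copy 1 [N 2], Copy 1 [N 3],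
       Copy 2 [N 4, N 2], Copy 2 [N 4], Copy 3 [N 5, N 3], Copy 3 [N 5],
       Pop 4 0 [N 4], Pop 5 0 [N 4, N 5], Pop 4 1 [N 4, N 5], Pop 5 1 [N 5]} \<union>
       (\<lambda>j. Push 0 1 (j + 2)) ` {..<4} \<union> (\<lambda>j. Pop 4 (j + 2) [T (x j False)]) ` {..<4} \<union>
       (\<lambda>j. Pop 5 (j + 2) [T (x j True)]) ` {..<4}\<rparr>"

lemma slope_grammar_wf: "wf_indexed_grammar (slope_grammar e x)"
proof -
  have "finite (\<Union>j<(4::nat). range (x j))" by simp
  moreover have "x j b \<in> (\<Union>j<(4::nat). range (x j))" if "j < 4" for j b using that by blast
  ultimately show ?thesis unfolding wf_indexed_grammar_def slope_grammar_def by auto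
qed

lemma slope_stack_Cons:
  fixes i :: nat
  assumes "i < 2" "i # \<delta> = \<sigma> @ [j + 2]"
  obtains \<sigma>' where "\<sigma> = i # \<sigma>'" "\<delta> = \<sigma>' @ [j + 2]"
  using assms by (cases \<sigma>) auto

lemma slope_stack_bottom:
  fixes i :: nat
  assumes "set \<sigma> \<subseteq> {0, 1}" "(i + 2) # \<delta> = \<sigma> @ [j + 2]"
  shows "\<sigma> = [] \<and> i = j"
  using assms by (cases \<sigma>) auto

lemma lang_pair: "w \<in> I A \<delta> \<Longrightarrow> w' \<in> I B \<delta> \<Longrightarrow> w @ w' \<in> lang I (attach \<delta> [N A, N B])"
  by auto

lemma slope_grammar_sound: "gen (slope_grammar e x) 0 [] \<subseteq> slope_words e x"
proof
  fix w assume "w \<in> gen (slope_grammar e x) 0 []"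
  then have d: "derives (slope_grammar e x) [N (0, [])] (map T w)" by (simp add: gen_def)
  \<comment> \<open>Index strings other than substitutions followed by one quadrant marker impose no
    condition, so the inclusions have content only on well-formed strings.\<close>
  define V where "V \<delta> Q = {w. \<forall>\<sigma> j. set \<sigma> \<subseteq> {0, 1} \<longrightarrow> j < 4 \<longrightarrow> \<delta> = \<sigma> @ [j + 2] \<longrightarrow> Q \<sigma> j w}"
    for \<delta> :: "nat list" and Q :: "nat list \<Rightarrow> nat \<Rightarrow> 'a list \<Rightarrow> bool"
  let ?\<Pi> = "productions (slope_grammar e x)"
  let ?C = "\<lambda>\<sigma> j w. \<exists>u\<in>christoffel. w = map (x j) u"
  let ?P = "\<lambda>b \<sigma> j w. \<exists>d>0. w = map (x j) (expand \<sigma> (replicate d b))"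
  let ?L = "\<lambda>b \<sigma> j w. w = map (x j) (expand \<sigma> [b])"
  define I where "I A \<delta> = (if A = 0 then {w. \<delta> = [] \<longrightarrow> w \<in> slope_words e x}
    else if A = 1 then V \<delta> ?C
    else if A = 2 then V \<delta> (?P False)
    else if A = 3 then V \<delta> (?P True)
    else if A = 4 then V \<delta> (?L False)
    else V \<delta> (?L True))" for A :: nat and \<delta>
  have VI: "w \<in> V \<delta> Q" if "\<And>\<sigma> j. set \<sigma> \<subseteq> {0, 1} \<Longrightarrow> j < 4 \<Longrightarrow> \<delta> = \<sigma> @ [j + 2] \<Longrightarrow> Q \<sigma> j w" for w \<delta> Q
    using that by (simp add: V_def)
  have VD: "Q \<sigma> j w" if "w \<in> V (\<sigma> @ [j + 2]) Q" "set \<sigma> \<subseteq> {0, 1}" "j < 4" for w \<sigma> j Q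
    using that by (simp add: V_def)
  have I_simps: "I 0 \<delta> = {w. \<delta> = [] \<longrightarrow> w \<in> slope_words e x}"
    "I 1 \<delta> = V \<delta> ?C"
    "I (Suc 0) \<delta> = V \<delta> ?C"
    "I 2 \<delta> = V \<delta> (?P False)"
    "I 3 \<delta> = V \<delta> (?P True)"
    "I 4 \<delta> = V \<delta> (?L False)"
    "I 5 \<delta> = V \<delta> (?L True)" for \<delta>
    by (simp_all add: I_def)
  have power: "w @ w' \<in> V \<delta> (?P b)"
    if pw: "w \<in> V \<delta> (?L b)"
      "w' \<in> V \<delta> (?P b)" for w w' \<delta> b
  proof (rule VI)
    fix \<sigma> j assume a: "set \<sigma> \<subseteq> {0, 1}" "j < 4" "\<delta> = \<sigma> @ [j + 2]"
    obtain d where "w' = map (x j) (expand \<sigma> (replicate d b))" using VD[OF pw(2)[unfolded a(3)] a(1,2)] by blast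
    moreover have "w = map (x j) (expand \<sigma> [b])" using VD[OF pw(1)[unfolded a(3)] a(1,2)] .
    ultimately have "w @ w' = map (x j) (expand \<sigma> (replicate (Suc d) b))"
      using expand_append[of \<sigma> "[b]" "replicate d b"] by simp
    then show "\<exists>d>0. w @ w' = map (x j) (expand \<sigma> (replicate d b))" by blast
  qed
  have power1: "V \<delta> (?L b)
    \<subseteq> V \<delta> (?P b)" for \<delta> b
    unfolding V_def by (auto intro!: exI[of _ "1::nat"])
  have chr: "V \<delta> (?P b)
    \<subseteq> V \<delta> ?C" for \<delta> b
  proof
    fix w assume w: "w \<in> V \<delta> (?P b)"
    show "w \<in> V \<delta> ?C"
    proof (rule VI)
      fix \<sigma> j assume a: "set \<sigma> \<subseteq> {0, 1}" "j < 4" "\<delta> = \<sigma> @ [j + 2]"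
      obtain d where "0 < d" "w = map (x j) (expand \<sigma> (replicate d b))" using VD[OF w[unfolded a(3)] a(1,2)] by blast
      then show "\<exists>u\<in>christoffel. w = map (x j) u" using a(1) unfolding christoffel_def by blast
    qed
  qed
  have push: "V (i # \<delta>) ?C
    \<subseteq> V \<delta> ?C" if "i \<in> {0, 1}" for i \<delta>
  proof
    fix w assume w: "w \<in> V (i # \<delta>) ?C"
    show "w \<in> V \<delta> ?C"
    proof (rule VI)
      fix \<sigma> j assume "set \<sigma> \<subseteq> {0, 1}" "j < 4" "\<delta> = \<sigma> @ [j + 2]"
      then show "\<exists>u\<in>christoffel. w = map (x j) u" using VD[of w "i # \<sigma>" j] w that by simp
    qed
  qed
  have letter1: "V \<delta> (?L b) \<subseteq> V (i # \<delta>) (?L b)"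
    if l: "i < 2" "letter_subst i b = [b]" for i \<delta> b
  proof
    fix w assume w: "w \<in> V \<delta> (?L b)"
    show "w \<in> V (i # \<delta>) (?L b)"
    proof (rule VI)
      fix \<sigma> j assume a: "set \<sigma> \<subseteq> {0, 1}" "j < 4" "i # \<delta> = \<sigma> @ [j + 2]"
      obtain \<sigma>' where s: "\<sigma> = i # \<sigma>'" "\<delta> = \<sigma>' @ [j + 2]" by (rule slope_stack_Cons[OF l(1) a(3)])
      show "w = map (x j) (expand \<sigma> [b])" using VD[OF w[unfolded s(2)]] a that(2) unfolding s(1) by simp
    qed
  qed
  have letter2: "w @ w' \<in> V (i # \<delta>) (?L b)"
    if l: "i < 2" "letter_subst i b = [False, True]" "w \<in> V \<delta> (?L False)"
      "w' \<in> V \<delta> (?L True)" for i \<delta> b w w'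
  proof (rule VI)
    fix \<sigma> j assume a: "set \<sigma> \<subseteq> {0, 1}" "j < 4" "i # \<delta> = \<sigma> @ [j + 2]"
    obtain \<sigma>' where s: "\<sigma> = i # \<sigma>'" "\<delta> = \<sigma>' @ [j + 2]" by (rule slope_stack_Cons[OF l(1) a(3)])
    show "w @ w' = map (x j) (expand \<sigma> [b])"
      using VD[OF that(3)[unfolded s(2)]] VD[OF that(4)[unfolded s(2)]] a that(2) expand_append[of \<sigma>' "[False]" "[True]"]
      unfolding s(1) by simp
  qed
  have bottom: "[x i b] \<in> V ((i + 2) # \<delta>) (?L b)" for i \<delta> b
  proof (rule VI)
    fix \<sigma> j assume a: "set \<sigma> \<subseteq> {0, 1}" "j < 4" "(i + 2) # \<delta> = \<sigma> @ [j + 2]"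
    then show "[x i b] = map (x j) (expand \<sigma> [b])" using slope_stack_bottom[OF a(1,3)] by simp
  qed
  have start: "V ((j + 2) # \<delta>) ?C \<subseteq> {w. \<delta> = [] \<longrightarrow> w \<in> slope_words e x}"
    if "j < 4" for j \<delta>
  proof
    fix w assume w: "w \<in> V ((j + 2) # \<delta>) ?C"
    have "w \<in> slope_words e x" if "\<delta> = []"
    proof -
      have "\<exists>u\<in>christoffel. w = map (x j) u" using VD[of w "[]" j] w that \<open>j < 4\<close> by simp
      then show ?thesis using \<open>j < 4\<close> by (auto simp: slope_words_def)
    qed
    then show "w \<in> {w. \<delta> = [] \<longrightarrow> w \<in> slope_words e x}" by simp
  qed
  have "w \<in> lang I [N (0, [])]"
    using d
  proof (rule derives_sound)
    fix A \<alpha> and \<delta> :: "nat list" assume "Copy A \<alpha> \<in> ?\<Pi>"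
    then show "lang I (attach \<delta> \<alpha>) \<subseteq> I A \<delta>"
      using power power1 chr
      by (auto simp: slope_grammar_def I_simps slope_words_def subset_iff)
  next
    fix A B f and \<delta> :: "nat list" assume "Push A B f \<in> ?\<Pi>"
    then consider "A = 1" "B = 1" "f \<in> {0, 1}" | j where "A = 0" "B = 1" "f = j + 2" "j < 4"
      by (auto simp: slope_grammar_def)
    then show "I B (f # \<delta>) \<subseteq> I A \<delta>"
    proof cases
      case 1
      show ?thesis unfolding 1(1,2) I_simps(2) by (rule push[OF 1(3)])
    next
      case 2
      show ?thesis unfolding 2(1-3) I_simps(1,2) by (rule start[OF 2(4)])
    qed
  next
    fix A f \<alpha> and \<delta> :: "nat list" assume "Pop A f \<alpha> \<in> ?\<Pi>"
    then show "lang I (attach \<delta> \<alpha>) \<subseteq> I A (f # \<delta>)"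
      using letter1[of 0 False \<delta>] letter1[of 1 True \<delta>] letter2[of 0 True _ \<delta>] letter2[of 1 False _ \<delta>] bottom
      by (auto simp: slope_grammar_def I_simps letter_subst.simps)
  qed
  then show "w \<in> slope_words e x" by (simp add: I_simps)
qed

text \<open>Above the quadrant marker, \<open>\<sigma>\<close> is pushed from its last index to its
  first, so that its head leads; induction on \<open>\<sigma>\<close> then follows the pops.\<close>

lemma slope_grammar_complete: "slope_words e x \<subseteq> gen (slope_grammar e x) 0 []"
proof -
  let ?g = "gen (slope_grammar e x)" and ?\<Pi> = "productions (slope_grammar e x)"
  have copy: "lang ?g (attach \<delta> \<alpha>) \<subseteq> ?g A \<delta>" if "Copy A \<alpha> \<in> ?\<Pi>" for A \<alpha> \<delta>
    by (rule gen_copy[OF that])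
  have push: "?g B (f # \<delta>) \<subseteq> ?g A \<delta>" if "Push A B f \<in> ?\<Pi>" for A B f \<delta>
    by (rule gen_push[OF that])
  have pop: "lang ?g (attach \<delta> \<alpha>) \<subseteq> ?g A (f # \<delta>)" if "Pop A f \<alpha> \<in> ?\<Pi>" for A f \<alpha> \<delta>
    by (rule gen_pop[OF that])
  let ?s = "\<lambda>\<sigma> j. \<sigma> @ [j + 2]"
  have letter: "map (x j) (expand \<sigma> [False]) \<in> ?g 4 (?s \<sigma> j) \<and> map (x j) (expand \<sigma> [True]) \<in> ?g 5 (?s \<sigma> j)"
    if "set \<sigma> \<subseteq> {0, 1}" "j < 4" for \<sigma> j
    using that(1)
  proof (induction \<sigma>)
    case Nil
    show ?case using pop[of 4 "j + 2" "[T (x j False)]" "[]"] pop[of 5 "j + 2" "[T (x j True)]" "[]"] that(2)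
      by (simp add: slope_grammar_def)
  next
    case (Cons i \<sigma>)
    then have IH: "map (x j) (expand \<sigma> [False]) \<in> ?g 4 (?s \<sigma> j)" "map (x j) (expand \<sigma> [True]) \<in> ?g 5 (?s \<sigma> j)"
      and i: "i = 0 \<or> i = 1" by auto
    have both: "map (x j) (expand \<sigma> [False, True]) \<in> lang ?g (attach (?s \<sigma> j) [N 4, N 5])"
      using IH expand_append[of \<sigma> "[False]" "[True]"] by auto
    have one: "map (x j) (expand \<sigma> [False]) \<in> lang ?g (attach (?s \<sigma> j) [N 4])"
      "map (x j) (expand \<sigma> [True]) \<in> lang ?g (attach (?s \<sigma> j) [N 5])" using IH by auto
    from i show ?case
    proof
      assume "i = 0"
      then show ?thesis
        using subsetD[OF pop both, of 5 0] subsetD[OF pop one(1), of 4 0] by (simp add: slope_grammar_def letter_subst.simps)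
    next
      assume "i = 1"
      then show ?thesis
        using subsetD[OF pop both, of 4 1] subsetD[OF pop one(2), of 5 1] by (simp add: slope_grammar_def letter_subst.simps)
    qed
  qed
  have power: "map (x j) (expand \<sigma> (replicate (Suc d) b)) \<in> ?g (if b then 3 else 2) (?s \<sigma> j)"
    if "set \<sigma> \<subseteq> {0, 1}" "j < 4" for \<sigma> j d b
  proof (induction d)
    case 0
    then show ?case
      using letter[OF that] copy[of 2 "[N 4]" "?s \<sigma> j"] copy[of 3 "[N 5]" "?s \<sigma> j"]
      by (auto simp: slope_grammar_def)
  next
    case (Suc d)
    have "map (x j) (expand \<sigma> (replicate (Suc (Suc d)) b)) =
      map (x j) (expand \<sigma> [b]) @ map (x j) (expand \<sigma> (replicate (Suc d) b))"
      using expand_append[of \<sigma> "[b]" "replicate (Suc d) b"] by simp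
    moreover have "map (x j) (expand \<sigma> [b]) \<in> ?g (if b then 5 else 4) (?s \<sigma> j)" using letter[OF that] by simp
    ultimately have "map (x j) (expand \<sigma> (replicate (Suc (Suc d)) b)) \<in>
        lang ?g (attach (?s \<sigma> j) [N (if b then 5 else 4), N (if b then 3 else 2)])"
      using lang_pair[of _ ?g _ "?s \<sigma> j", OF _ Suc] by (simp only:)
    then show ?case
      using subsetD[OF copy, of 2 "[N 4, N 2]"] subsetD[OF copy, of 3 "[N 5, N 3]"] by (auto simp: slope_grammar_def split: if_splits)
  qed
  have unwind: "?g 1 (?s \<sigma> j) \<subseteq> ?g 1 [j + 2]" if "set \<sigma> \<subseteq> {0, 1}" for \<sigma> j
    using that
  proof (induction \<sigma>)
    case (Cons i \<sigma>)
    then have "Push 1 1 i \<in> ?\<Pi>" by (auto simp: slope_grammar_def)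
    from push[OF this, of "?s \<sigma> j"] Cons show ?case by auto
  qed simp
  have "map (x j) u \<in> ?g 0 []" if u: "j < 4" "u \<in> christoffel" for j u
  proof -
    obtain \<sigma> d b where s: "u = expand \<sigma> (replicate d b)" "set \<sigma> \<subseteq> {0, 1}" "0 < d" using u(2) by (auto simp: christoffel_def)
    then obtain d' where "d = Suc d'" using gr0_implies_Suc by blast
    then have "map (x j) u \<in> ?g (if b then 3 else 2) (?s \<sigma> j)" using power[OF s(2) u(1)] s(1) by simp
    then have "map (x j) u \<in> ?g 1 (?s \<sigma> j)"
      using copy[of 1 "[N 2]" "?s \<sigma> j"] copy[of 1 "[N 3]" "?s \<sigma> j"] by (auto simp: slope_grammar_def split: if_splits)
    then have "map (x j) u \<in> ?g 1 [j + 2]" using unwind[OF s(2)] by blast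
    moreover have "Push 0 1 (j + 2) \<in> ?\<Pi>" using u(1) by (auto simp: slope_grammar_def)
    ultimately show ?thesis using push by blast
  qed
  moreover have "[e] \<in> ?g 0 []" using copy[of 0 "[T e]" "[]"] by (auto simp: slope_grammar_def)
  ultimately show ?thesis unfolding slope_words_def by blast
qed

lemma slope_words_indexed: "indexed_language (slope_words e x)"
proof -
  have "grammar_language (slope_grammar e x) = gen (slope_grammar e x) 0 []"
    using grammar_language_gen[OF slope_grammar_wf] by (simp add: slope_grammar_def)
  also have "\<dots> = slope_words e x"
    using slope_grammar_sound slope_grammar_complete by (rule equalityI)
  finally show ?thesis
    unfolding indexed_language_def by (intro exI[of _ "slope_grammar e x"] conjI slope_grammar_wf)
qed

section \<open>Rank two\<close>

context virtually_split
begin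

text \<open>For \<open>j < 4\<close> the low binary digit of \<open>j\<close> is the sign of the
  first coordinate and the high digit that of the second.\<close>

definition quadrant_letter :: "nat \<Rightarrow> bool \<Rightarrow> 'a" where
  "quadrant_letter j b = (if b then (if 2 \<le> j then inv (bs ! 1) else bs ! 1)
     else (if odd j then inv (bs ! 0) else bs ! 0))"

definition quadrant_sign :: "nat \<Rightarrow> bool \<Rightarrow> int" where
  "quadrant_sign j b = (if b then (if 2 \<le> j then - 1 else 1) else (if odd j then - 1 else 1))"

lemma \<phi>_quadrant_word:
  assumes "n = 2" "N = 1"
  shows "set (map (quadrant_letter j) v) \<subseteq> A"
    and "\<phi> (val (map (quadrant_letter j) v)) 0 = quadrant_sign j False * cnt False v"
    and "\<phi> (val (map (quadrant_letter j) v)) 1 = quadrant_sign j True * cnt True v"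
proof -
  have b: "bs ! 0 \<in> A" "bs ! 1 \<in> A" using bs assms nth_mem[of 0 bs] nth_mem[of 1 bs] by auto
  have l: "quadrant_letter j b \<in> A" for b unfolding quadrant_letter_def using b by simp
  then show A: "set (map (quadrant_letter j) v) \<subseteq> A" for v by auto
  have "\<phi> (quadrant_letter j c) i = (if i = of_bool c then quadrant_sign j c else 0)" if "i < 2" for c i
    using b \<phi>_bs[of 0 i] \<phi>_bs[of 1 i] assms that by (auto simp: quadrant_letter_def quadrant_sign_def)
  then have p: "\<phi> (quadrant_letter j c) 0 = (if c then 0 else quadrant_sign j c)"
    "\<phi> (quadrant_letter j c) 1 = (if c then quadrant_sign j c else 0)" for c by auto
  have m: "val (map (quadrant_letter j) v) \<in> A" for v using A by (rule val_A)
  show "\<phi> (val (map (quadrant_letter j) v)) 0 = quadrant_sign j False * cnt False v"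
    by (induction v) (use l m in \<open>auto simp: \<phi>_mult p algebra_simps\<close>)
  show "\<phi> (val (map (quadrant_letter j) v)) 1 = quadrant_sign j True * cnt True v"
    by (induction v) (use l m in \<open>auto simp: \<phi>_mult p[unfolded One_nat_def] algebra_simps\<close>)
qed

lemma length_cnt: "int (length u) = cnt False u + cnt True u"
  by (induction u) auto

lemma straight_quadrant_word:
  assumes "n = 2" "N = 1" and u: "u \<in> christoffel"
  shows "straight 1 (map (quadrant_letter j) u)"
proof -
  note \<phi> = \<phi>_quadrant_word[OF assms(1,2)]
  let ?w = "map (quadrant_letter j) u"
  let ?p = "real (count_list u False)" and ?q = "real (count_list u True)"
  have s: "\<bar>real_of_int (quadrant_sign j b)\<bar> = 1" for b by (simp add: quadrant_sign_def)
  have len: "real (length u) = ?p + ?q" using length_cnt[of u] by linarith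
  have ne: "0 < ?p + ?q" using christoffel_nonempty[OF u] len by (metis length_greater_0_conv of_nat_0_less_iff)
  have pos: "\<bar>real_of_int (\<phi> (val (take k ?w)) i) - real k / real (length ?w) * real_of_int (\<phi> (val ?w) i)\<bar> \<le> 1"
    if k: "k \<le> length ?w" "i < 2" for k i
  proof -
    define v where "v = take k u"
    let ?i = "real (count_list v False)" and ?j = "real (count_list v True)"
    have kv: "real k = ?i + ?j" using length_cnt[of v] k(1) by (simp add: v_def)
    have "u = v @ drop k u" by (simp add: v_def)
    from christoffel_balanced[OF u, unfolded balanced_def, rule_format, OF this]
    have "0 \<le> real_of_int (cnt True u * cnt False v - cnt False u * cnt True v)"
      "real_of_int (cnt True u * cnt False v - cnt False u * cnt True v) \<le> real_of_int (cnt False u + cnt True u)"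
      by linarith+
    then have D: "0 \<le> ?q * ?i - ?p * ?j" "?q * ?i - ?p * ?j \<le> ?p + ?q" by simp_all
    then have "\<bar>(?q * ?i - ?p * ?j) / (?p + ?q)\<bar> \<le> 1" using ne by simp
    \<comment> \<open>Up to sign, both coordinate errors are the quantity bounded by
      \<open>balanced\<close>, divided by the length of the word.\<close>
    moreover have "?i - (?i + ?j) / (?p + ?q) * ?p = (?q * ?i - ?p * ?j) / (?p + ?q)"
      "?j - (?i + ?j) / (?p + ?q) * ?q = - ((?q * ?i - ?p * ?j) / (?p + ?q))"
      using ne by (simp_all add: field_simps)
    ultimately have 1: "\<bar>?i - (?i + ?j) / (?p + ?q) * ?p\<bar> \<le> 1" "\<bar>?j - (?i + ?j) / (?p + ?q) * ?q\<bar> \<le> 1"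
      by (simp_all only: abs_minus_cancel)
    have t: "take k ?w = map (quadrant_letter j) v" by (simp add: v_def take_map)
    have scale: "\<bar>c * a - r * (c * b)\<bar> \<le> 1" if "\<bar>c\<bar> = 1" "\<bar>a - r * b\<bar> \<le> 1" for a b c r :: real
    proof -
      have "c * a - r * (c * b) = c * (a - r * b)" by (simp add: algebra_simps)
      then show ?thesis using that by (simp add: abs_mult)
    qed
    consider "i = 0" | "i = 1" using k(2) by linarith
    then show ?thesis
    proof cases
      case 1
      then show ?thesis unfolding t using scale[OF s[of False] \<open>\<bar>?i - _\<bar> \<le> 1\<close>] \<phi>(2) len kv by simp
    next
      case 2
      then show ?thesis unfolding t using scale[OF s[of True] \<open>\<bar>?j - _\<bar> \<le> 1\<close>] \<phi>(3)[unfolded One_nat_def] len kv by simp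
    qed
  qed
  have bound: "\<bar>real_of_int (\<phi> (val ?w) i)\<bar> \<le> 1 * real (length ?w)" if i: "i < 2" for i
  proof -
    consider "i = 0" | "i = 1" using i by linarith
    then show ?thesis
    proof cases
      case 1
      then show ?thesis using \<phi>(2)[of j u] s[of False] len by (simp add: abs_mult)
    next
      case 2
      then show ?thesis using \<phi>(3)[of j u] s[of True] len by (simp add: abs_mult)
    qed
  qed
  show ?thesis
    unfolding straight_def using \<phi>(1)[of j u] christoffel_nonempty[OF u] pos bound assms(1) by auto
qed

lemma slope_word_exists:
  assumes "n = 2" "N = 1" "a \<in> A"
  shows "\<exists>w\<in>slope_words \<one> quadrant_letter. val w = a"
proof (cases "\<phi> a 0 = 0 \<and> \<phi> a 1 = 0")
  case True
  \<comment> \<open>Words in \<open>christoffel\<close> are nonempty and lie in one quadrant, so the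
    trivial element needs its own word.\<close>
  then have "a = \<one>" using \<phi>_inj[OF assms(3)] assms(1) by (auto simp: less_2_cases_iff)
  then show ?thesis by (intro bexI[of _ "[\<one>]"]) (auto simp: slope_words_def)
next
  case False
  then have "nat \<bar>\<phi> a 0\<bar> \<noteq> 0 \<or> nat \<bar>\<phi> a 1\<bar> \<noteq> 0" by auto
  then obtain u where u: "u \<in> christoffel" "count_list u False = nat \<bar>\<phi> a 0\<bar>" "count_list u True = nat \<bar>\<phi> a 1\<bar>"
    using christoffel_exists by blast
  define j :: nat where "j = (if \<phi> a 0 < 0 then 1 else 0) + (if \<phi> a 1 < 0 then 2 else 0)"
  have j: "j < 4" by (simp add: j_def)
  have s: "quadrant_sign j False * \<bar>\<phi> a 0\<bar> = \<phi> a 0" "quadrant_sign j True * \<bar>\<phi> a 1\<bar> = \<phi> a 1"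
    by (auto simp: quadrant_sign_def j_def)
  have "val (map (quadrant_letter j) u) = a"
  proof (rule \<phi>_eqI[OF val_A[OF \<phi>_quadrant_word(1)[OF assms(1,2)]] assms(3)])
    fix i assume "i < n"
    then have "i = 0 \<or> i = 1" using assms(1) by auto
    then show "\<phi> (val (map (quadrant_letter j) u)) i = \<phi> a i"
      using \<phi>_quadrant_word(2,3)[OF assms(1,2), of j u] u s by auto
  qed
  then show ?thesis using u(1) j unfolding slope_words_def by blast
qed

text \<open>The exponents of a normal word are independent of each other, so its blocks can be put
  in front one by one, the last block first.\<close>

lemma comb_indexed:
  assumes "indexed_language W"
  shows "indexed_language (comb W)"
proof -
  let ?V = "{w @ [c] | w c. w \<in> W \<and> c \<in> T}"
  have V: "indexed_language ?V" by (rule indexed_language_suffix[OF assms T(1)])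
  have "indexed_language {normal_word us es @ v | es v. length es = length us \<and> v \<in> ?V}" for us
  proof (induction us)
    case Nil
    then show ?case using V by simp
  next
    case (Cons t us)
    let ?L = "{normal_word us es @ v | es v. length es = length us \<and> v \<in> ?V}"
    have "{\<one> # replicate k x @ w | k x w. x \<in> {t, inv t} \<and> w \<in> ?L} =
      {normal_word (t # us) es @ v | es v. length es = length (t # us) \<and> v \<in> ?V}" (is "?X = ?Y")
    proof
      show "?X \<subseteq> ?Y"
      proof
        fix z assume "z \<in> ?X"
        then obtain k x es v where z: "z = \<one> # replicate k x @ normal_word us es @ v" "x \<in> {t, inv t}" "length es = length us" "v \<in> ?V"
          by blast
        define e where "e = (if x = t then int k else - int k)"
        have "power_word t e = \<one> # replicate k x" using z(2) by (auto simp: power_word_def e_def)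
        then have "z = normal_word (t # us) (e # es) @ v" using z(1) by simp
        then show "z \<in> ?Y" using z(3,4) by (intro CollectI exI[of _ "e # es"] exI[of _ v]) simp
      qed
      show "?Y \<subseteq> ?X"
      proof
        fix z assume "z \<in> ?Y"
        then obtain es' v where z: "z = normal_word (t # us) es' @ v" "length es' = Suc (length us)" "v \<in> ?V"
          by auto
        then obtain e es where e: "es' = e # es" "length es = length us" by (cases es') auto
        show "z \<in> ?X" unfolding z(1) e(1)
          by (intro CollectI exI[of _ "nat \<bar>e\<bar>"] exI[of _ "if 0 \<le> e then t else inv t"] exI[of _ "normal_word us es @ v"] conjI)
            (use e z in \<open>auto simp: power_word_def\<close>)
      qed
    qed
    then show ?case using indexed_language_prefix[OF Cons, of \<one> t "inv t"] by simp
  qed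
  moreover have "comb W = {normal_word ts es @ v | es v. length es = length ts \<and> v \<in> ?V}"
    unfolding comb_def by blast
  ultimately show ?thesis by simp
qed

lemma indexed_comb:
  assumes "n = 2" "N = 1"
  shows "\<exists>S L. generating_set G S \<and> async_combing G S L \<and> indexed_language L"
proof -
  let ?W = "slope_words \<one> quadrant_letter"
  let ?SA = "insert \<one> (\<Union>j<4. range (quadrant_letter j))"
  have l: "quadrant_letter j b \<in> A" for j b using \<phi>_quadrant_word(1)[OF assms, of j "[b]"] by simp
  have one: "straight 1 [\<one>]"
  proof -
    have "val (take k [\<one>]) = \<one>" for k by (cases k) auto
    then show ?thesis by (simp add: straight_def)
  qed
  have W: "?W \<subseteq> lists ?SA"
  proof
    fix w assume "w \<in> ?W"
    then consider "w = [\<one>]" | j u where "w = map (quadrant_letter j) u" "j < 4"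
      unfolding slope_words_def by blast
    then show "w \<in> lists ?SA"
    proof cases
      case 2
      have "set w \<subseteq> range (quadrant_letter j)" unfolding 2(1) by auto
      also have "\<dots> \<subseteq> ?SA" using 2(2) by blast
      finally show ?thesis by (simp only: lists_eq_set mem_Collect_eq)
    qed simp
  qed
  have st: "straight 1 w" if "w \<in> ?W" for w
    using that one straight_quadrant_word[OF assms] unfolding slope_words_def by blast
  have "finite ?SA" by simp
  moreover have "?SA \<subseteq> A" using l by auto
  ultimately obtain S where "generating_set G S" "async_combing G S (comb ?W)"
    using comb_async_combing[OF _ _ W st slope_word_exists[OF assms]] by blast
  then show ?thesis using comb_indexed[OF slope_words_indexed] by blast
qed

lemma async_combing_exists: "has_async_combing G"
proof -
  let ?SA = "{x \<in> A. \<forall>i<n. \<bar>\<phi> x i\<bar> \<le> 2 * N + 1}"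
  let ?W = "{w \<in> lists ?SA. straight (of_int N) w}"
  have "\<exists>w\<in>?W. val w = a" if a: "a \<in> A" for a
  proof -
    obtain w where w: "straight N w" "\<forall>x\<in>set w. \<forall>i<n. \<bar>\<phi> x i\<bar> \<le> 2 * N + 1" "val w = a"
      using straight_exists[OF a] by blast
    have "set w \<subseteq> A" using w(1) by (simp add: straight_def)
    then show ?thesis using w by (intro bexI[of _ w]) auto
  qed
  moreover have "finite ?SA" by (rule finite_box)
  ultimately show ?thesis
    using comb_async_combing[of ?SA ?W "of_int N"] unfolding has_async_combing_def by blast
qed

end

text \<open>The value \<open>N = 1\<close> expresses that \<open>bs\<close> is a true basis, so that
  words in its letters and their inverses reach every element of \<open>A\<close>.\<close>

lemma (in group) lattice_rank_two:
  assumes A: "abelian_sub A" and r: "free_abelian_of_rank 2 (G\<lparr>carrier := A\<rparr>)"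
  shows "\<exists>bs \<phi>. lattice G A 2 1 bs \<phi>"
proof -
  let ?F = "free_Abelian_group {..<2::nat}"
  obtain f where f: "f \<in> iso (G\<lparr>carrier := A\<rparr>) ?F"
    using r unfolding free_abelian_of_rank_def is_iso_def by blast
  then have bij: "bij_betw f A (carrier ?F)" and hom: "\<And>a b. a \<in> A \<Longrightarrow> b \<in> A \<Longrightarrow> f (a \<otimes> b) = f a + f b"
    by (auto simp: iso_def hom_def)
  define g where "g i = inv_into A f (frag_of i)" for i :: nat
  have g: "g i \<in> A" "f (g i) = frag_of i" if "i < 2" for i
  proof -
    have "frag_of i \<in> f ` A" using bij that by (simp add: bij_betw_def)
    then show "g i \<in> A" "f (g i) = frag_of i" unfolding g_def by (auto intro: inv_into_into f_inv_into_f)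
  qed
  have sub: "subgroup A G" using A by (simp add: abelian_sub_def)
  have lk: "Poly_Mapping.lookup (f (g k)) i = (if i = k then 1 else 0)" if "k < 2" for k i
    by (simp only: g(2)[OF that] lookup_frag_of)
  have "lattice G A 2 1 [g 0, g 1] (\<lambda>a i. Poly_Mapping.lookup (f a) i)"
  proof unfold_locales
    fix j i :: nat assume "j < 2" "i < 2"
    then have "j = 0 \<or> j = 1" "i = 0 \<or> i = 1" by auto
    then show "Poly_Mapping.lookup (f ([g 0, g 1] ! j)) i = (if i = j then 1 else 0)"
      using lk[of 0 i] lk[of 1 i] by (elim disjE) simp_all
  next
    fix a assume a: "a \<in> A" "\<forall>i<2. Poly_Mapping.lookup (f a) i = 0"
    have "Poly_Mapping.keys (f a) \<subseteq> {..<2}" using bij a(1) by (auto simp: bij_betw_def free_Abelian_group_def)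
    then have "Poly_Mapping.lookup (f a) i = 0" for i
      using a(2) by (cases "i < 2") (auto simp: in_keys_iff subset_iff)
    then have "f a = 0" by (intro poly_mapping_eqI) simp
    moreover have "f \<one> = 0" using hom[of \<one> \<one>] subgroup.one_closed[OF sub] by simp
    ultimately show "a = \<one>" using bij a(1) subgroup.one_closed[OF sub] by (auto simp: bij_betw_def inj_on_def)
  qed (use A g hom in \<open>auto simp: lookup_add\<close>)
  then show ?thesis by blast
qed

theorem proposition7p1:
  fixes G :: "('a, 'b) monoid_scheme"
  assumes "group G"
    and "polycyclic G"
    and "metabelian G"
    and "torsion_free G"
    and "centre G \<inter> derived_subgroup G = {\<one>\<^bsub>G\<^esub>}"
  shows "has_async_combing G \<and>
    (free_abelian_of_rank 2 (G\<lparr>carrier := derived_subgroup G\<rparr>) \<longrightarrow>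
       (\<exists>S L. generating_set G S \<and> async_combing G S L \<and> indexed_language L))"
proof -
  interpret group G by fact
  let ?A = "derived_subgroup G"
  have sub: "subgroup ?A G" by (rule derived_is_subgroup) simp
  interpret D: comm_group "G\<lparr>carrier := ?A\<rparr>" using assms(3) by (simp add: metabelian_def)
  have A: "abelian_sub ?A" unfolding abelian_sub_def using sub D.m_comm by simp
  have pc: "polycyclic_seq G (carrier G)" using assms(2) by (simp add: polycyclic_def)
  have "?A \<lhd> G" by (rule derived_self_is_normal)
  then have norm: "g \<otimes>\<^bsub>G\<^esub> a \<otimes>\<^bsub>G\<^esub> inv\<^bsub>G\<^esub> g \<in> ?A" if "g \<in> carrier G" "a \<in> ?A" for g a
    using that by (simp add: normal.inv_op_closed2)
  have comm: "g \<otimes>\<^bsub>G\<^esub> h \<otimes>\<^bsub>G\<^esub> inv\<^bsub>G\<^esub> g \<otimes>\<^bsub>G\<^esub> inv\<^bsub>G\<^esub> h \<in> ?A" if "g \<in> carrier G" "h \<in> carrier G" for g h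
    unfolding derived_def by (rule generate.incl) (use that in blast)
  \<comment> \<open>Uniform in the lattice data: it is applied to a virtual basis for the combing
    and to a true basis for the indexed language.\<close>
  have split: "\<exists>H ts T. virtually_split G ?A n N bs \<phi> H ts T" if "lattice G ?A n N bs \<phi>" for n N bs \<phi>
  proof -
    interpret acted_lattice G ?A n N bs \<phi>
      using that norm comm by (intro acted_lattice.intro acted_lattice_axioms.intro)
    show ?thesis by (rule virtual_splitting[OF pc assms(5)])
  qed
  obtain n N bs \<phi> where "lattice G ?A n N bs \<phi>"
    using lattice_exists[OF A pc subgroup.subset[OF sub] assms(4)] by blast
  then obtain H ts T where "virtually_split G ?A n N bs \<phi> H ts T" using split by blast
  then have "has_async_combing G" by (rule virtually_split.async_combing_exists)
  moreover have "\<exists>S L. generating_set G S \<and> async_combing G S L \<and> indexed_language L"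
    if r: "free_abelian_of_rank 2 (G\<lparr>carrier := ?A\<rparr>)"
  proof -
    obtain bs \<phi> where "lattice G ?A 2 1 bs \<phi>" using lattice_rank_two[OF A r] by blast
    then obtain H ts T where "virtually_split G ?A 2 1 bs \<phi> H ts T" using split by blast
    then show ?thesis by (rule virtually_split.indexed_comb) simp_all
  qed
  ultimately show ?thesis by blast
qed

end
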